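(* Let $\gamma:\mathbb S^1\to\mathbb H^2$ be a smooth, simple, closed, strictly horoconvex curve. Let $L$ be its length, $A$ the area of the enclosed region and $k_g$ its geodesic curvature. Let $k_E=\sqrt{k_g^2-1}$ be the curvature of $\gamma$ when regarded as a strong spacelike curve in $\mathbb R^{2,1}$. Then $$L^2-A(4\pi+A)\le4\pi^2-\left(\int_\gamma k_E\,ds\right)^2.$$ In fact, $$L^2-A(4\pi+A)=4\pi^2-\left(\int_\gamma k_E\,ds\right)^2-\mathcal R(\gamma),$$ where $$\mathcal R(\gamma):=\iint_{\gamma\times\gamma}\frac{(k_g(s)-k_g(\tau))^2}{\sqrt{(k_g(s)^2-1)(k_g(\tau)^2-1)}+k_g(s)k_g(\tau)-1}\,ds\,d\tau\ge0.$$ Equality holds in the inequality if and only if $\gamma$ is a geodesic circle.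
   Context: $\mathbb H^2$ is the hyperbolic plane of curvature $-1$, in the hyperboloid model $\{-x_0^2+x_1^2+x_2^2=-1,\ x_0>0\}\subset\mathbb R^{2,1}$, where $\mathbb R^{2,1}$ carries the metric $-dx_0^2+dx_1^2+dx_2^2$. The geodesic curvature is $k_g=\langle\overline\nabla_T\nu,T\rangle$ with $T$ the unit tangent and $\nu$ the outward unit normal of the enclosed region. A closed curve is strictly horoconvex if $k_g>1$ everywhere. A curve in $\mathbb R^{2,1}$ is strong spacelike if its unit tangent and curvature vector span a spacelike $2$-plane at each point. A strictly horoconvex curve in $\mathbb H^2$ is strong spacelike with curvature $k_E=\sqrt{k_g^2-1}$. $s,\tau$ denote arclength. *)

theory Defs
  imports "HOL-Analysis.Analysis"
begin

section \<open>The hyperboloid model\<close>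

text \<open>The coordinates $x_0, x_1, x_2$ of $\mathbb{R}^{2,1}$ are the components
  \<open>x $ 1\<close>, \<open>x $ 2\<close>, \<open>x $ 3\<close>, so \<open>x $ 1\<close> is the timelike one.\<close>

definition mink :: "real^3 \<Rightarrow> real^3 \<Rightarrow> real" where
  "mink x y = - (x $ 1 * y $ 1) + x $ 2 * y $ 2 + x $ 3 * y $ 3"

definition hyp_plane :: "(real^3) set" where
  "hyp_plane = {x. mink x x = -1 \<and> x $ 1 > 0}"

definition hyp_dist :: "real^3 \<Rightarrow> real^3 \<Rightarrow> real" where
  "hyp_dist x y = arcosh (- mink x y)"

definition geodesic_circle :: "(real^3) set \<Rightarrow> bool" where
  "geodesic_circle C \<longleftrightarrow>
     (\<exists>p\<in>hyp_plane. \<exists>r>0. C = {x\<in>hyp_plane. hyp_dist p x = r})"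

text \<open>The unit speed geodesic of the hyperbolic plane with initial point \<open>x\<close> and initial
  (unit, tangent) velocity \<open>n\<close>.\<close>

definition hyp_geodesic :: "real^3 \<Rightarrow> real^3 \<Rightarrow> real \<Rightarrow> real^3" where
  "hyp_geodesic x n e = cosh e *\<^sub>R x + sinh e *\<^sub>R n"

text \<open>Hyperbolic area is the Riemannian area in the global chart \<open>(x\<^sub>1, x\<^sub>2)\<close>: the density is
  the square root of the Gram determinant of the coordinate vector fields.\<close>

definition hyp_chart :: "real \<times> real \<Rightarrow> real^3" where
  "hyp_chart p = vector [sqrt (1 + (fst p)\<^sup>2 + (snd p)\<^sup>2), fst p, snd p]"

definition hyp_area_density :: "real \<times> real \<Rightarrow> real" where
  "hyp_area_density p =
     (let X = vector_derivative (\<lambda>u. hyp_chart (u, snd p)) (at (fst p));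
          Y = vector_derivative (\<lambda>v. hyp_chart (fst p, v)) (at (snd p))
      in sqrt (mink X X * mink Y Y - (mink X Y)\<^sup>2))"

definition hyp_area :: "(real^3) set \<Rightarrow> real" where
  "hyp_area S = set_lebesgue_integral lborel {p. hyp_chart p \<in> S} hyp_area_density"


section \<open>Smooth closed curves\<close>

text \<open>A curve on $\mathbb{S}^1 = \mathbb{R}/2\pi\mathbb{Z}$ is a \<open>2\<pi>\<close>-periodic function of a real
  parameter, which need not be arclength; the parametrization is assumed to be an immersion, so
  that the unit tangent exists.\<close>

definition velocity :: "(real \<Rightarrow> real^3) \<Rightarrow> real \<Rightarrow> real^3" where
  "velocity f t = vector_derivative f (at t)"

definition smooth_param :: "(real \<Rightarrow> real^3) \<Rightarrow> bool" where
  "smooth_param f \<longleftrightarrow> (\<forall>n. (velocity ^^ n) f differentiable_on UNIV)"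

definition smooth_simple_closed_curve_H2 :: "(real \<Rightarrow> real^3) \<Rightarrow> bool" where
  "smooth_simple_closed_curve_H2 \<gamma> \<longleftrightarrow>
     range \<gamma> \<subseteq> hyp_plane \<and>
     (\<forall>t. \<gamma> (t + 2 * pi) = \<gamma> t) \<and>
     smooth_param \<gamma> \<and>
     (\<forall>t. velocity \<gamma> t \<noteq> 0) \<and>
     inj_on \<gamma> {0..<2 * pi}"

definition speed :: "(real \<Rightarrow> real^3) \<Rightarrow> real \<Rightarrow> real" where
  "speed \<gamma> t = sqrt (mink (velocity \<gamma> t) (velocity \<gamma> t))"

text \<open>The derivative of a vector field along \<open>\<gamma>\<close> with respect to arclength, in $\mathbb{R}^{2,1}$.\<close>

definition arc_deriv :: "(real \<Rightarrow> real^3) \<Rightarrow> (real \<Rightarrow> real^3) \<Rightarrow> real \<Rightarrow> real^3" where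
  "arc_deriv \<gamma> V t = velocity V t /\<^sub>R speed \<gamma> t"

definition unit_tangent :: "(real \<Rightarrow> real^3) \<Rightarrow> real \<Rightarrow> real^3" where
  "unit_tangent \<gamma> = arc_deriv \<gamma> \<gamma>"

definition curve_length :: "(real \<Rightarrow> real^3) \<Rightarrow> real" where
  "curve_length \<gamma> = integral {0..2 * pi} (speed \<gamma>)"

definition arc_integral :: "(real \<Rightarrow> real^3) \<Rightarrow> (real \<Rightarrow> real) \<Rightarrow> real" where
  "arc_integral \<gamma> f = integral {0..2 * pi} (\<lambda>t. f t * speed \<gamma> t)"

definition arc_integral2 :: "(real \<Rightarrow> real^3) \<Rightarrow> (real \<Rightarrow> real \<Rightarrow> real) \<Rightarrow> real" where
  "arc_integral2 \<gamma> f =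
     integral ({0..2 * pi} \<times> {0..2 * pi}) (\<lambda>(s, t). f s t * speed \<gamma> s * speed \<gamma> t)"


section \<open>Spacelike curves in Minkowski space\<close>

definition spacelike_curvature_vector :: "(real \<Rightarrow> real^3) \<Rightarrow> real \<Rightarrow> real^3" where
  "spacelike_curvature_vector \<gamma> = arc_deriv \<gamma> (unit_tangent \<gamma>)"

definition spacelike_plane :: "(real^3) set \<Rightarrow> bool" where
  "spacelike_plane W \<longleftrightarrow> subspace W \<and> dim W = 2 \<and> (\<forall>w\<in>W. w \<noteq> 0 \<longrightarrow> mink w w > 0)"

definition strong_spacelike :: "(real \<Rightarrow> real^3) \<Rightarrow> bool" where
  "strong_spacelike \<gamma> \<longleftrightarrow>
     (\<forall>t. spacelike_plane (span {unit_tangent \<gamma> t, spacelike_curvature_vector \<gamma> t}))"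

definition spacelike_curvature :: "(real \<Rightarrow> real^3) \<Rightarrow> real \<Rightarrow> real" where
  "spacelike_curvature \<gamma> t =
     sqrt (mink (spacelike_curvature_vector \<gamma> t) (spacelike_curvature_vector \<gamma> t))"


section \<open>Enclosed region and geodesic curvature\<close>

text \<open>The analogue of \<^const>\<open>inside\<close> relative to the hyperbolic plane. Boundedness in the ambient
  Euclidean norm agrees with boundedness in the hyperbolic distance.\<close>

definition enclosed_region :: "(real \<Rightarrow> real^3) \<Rightarrow> (real^3) set" where
  "enclosed_region \<gamma> =
     {x \<in> hyp_plane - range \<gamma>. bounded (connected_component_set (hyp_plane - range \<gamma>) x)}"

definition is_outward_unit_normal :: "(real \<Rightarrow> real^3) \<Rightarrow> real \<Rightarrow> real^3 \<Rightarrow> bool" where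
  "is_outward_unit_normal \<gamma> t n \<longleftrightarrow>
     mink n (\<gamma> t) = 0 \<and> mink n (velocity \<gamma> t) = 0 \<and> mink n n = 1 \<and>
     (\<forall>\<^sub>F e in at_right 0.
        hyp_geodesic (\<gamma> t) n e \<notin> enclosed_region \<gamma> \<and>
        hyp_geodesic (\<gamma> t) n (- e) \<in> enclosed_region \<gamma>)"

text \<open>The two unit normals at a point are opposite, and at most one of them is outward.\<close>

definition outward_unit_normal :: "(real \<Rightarrow> real^3) \<Rightarrow> real \<Rightarrow> real^3" where
  "outward_unit_normal \<gamma> t = (THE n. is_outward_unit_normal \<gamma> t n)"

text \<open>The Levi-Civita derivative of the hyperbolic plane along \<open>\<gamma>\<close> is the tangential part of the
  derivative in $\mathbb{R}^{2,1}$ (recall \<open>mink (\<gamma> t) (\<gamma> t) = -1\<close>). Pairing with tangent vectors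
  does not see the projection, so either derivative may be used for the geodesic curvature.\<close>

definition cov_deriv :: "(real \<Rightarrow> real^3) \<Rightarrow> (real \<Rightarrow> real^3) \<Rightarrow> real \<Rightarrow> real^3" where
  "cov_deriv \<gamma> V t = arc_deriv \<gamma> V t + mink (arc_deriv \<gamma> V t) (\<gamma> t) *\<^sub>R \<gamma> t"

definition geodesic_curvature :: "(real \<Rightarrow> real^3) \<Rightarrow> real \<Rightarrow> real" where
  "geodesic_curvature \<gamma> t =
     mink (cov_deriv \<gamma> (outward_unit_normal \<gamma>) t) (unit_tangent \<gamma> t)"

definition strictly_horoconvex :: "(real \<Rightarrow> real^3) \<Rightarrow> bool" where
  "strictly_horoconvex \<gamma> \<longleftrightarrow> (\<forall>t. geodesic_curvature \<gamma> t > 1)"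

definition horo_curvature :: "(real \<Rightarrow> real^3) \<Rightarrow> real \<Rightarrow> real" where
  "horo_curvature \<gamma> t = sqrt ((geodesic_curvature \<gamma> t)\<^sup>2 - 1)"

definition curvature_remainder :: "(real \<Rightarrow> real^3) \<Rightarrow> real" where
  "curvature_remainder \<gamma> = arc_integral2 \<gamma> (\<lambda>s t.
     (geodesic_curvature \<gamma> s - geodesic_curvature \<gamma> t)\<^sup>2 /
     (sqrt (((geodesic_curvature \<gamma> s)\<^sup>2 - 1) * ((geodesic_curvature \<gamma> t)\<^sup>2 - 1))
        + geodesic_curvature \<gamma> s * geodesic_curvature \<gamma> t - 1))"


section \<open>Consistency checks\<close>

lemma mink_cov_deriv:
  assumes "mink (\<gamma> t) X = 0"
  shows "mink (cov_deriv \<gamma> V t) X = mink (arc_deriv \<gamma> V t) X"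
proof -
  have "mink (a + c *\<^sub>R b) X = mink a X + c * mink b X" for a b :: "real^3" and c
    by (simp add: mink_def algebra_simps)
  then show ?thesis using assms by (simp add: cov_deriv_def)
qed

lemma hyp_plane_eq_range_chart: "hyp_plane = range hyp_chart"
proof
  show "range hyp_chart \<subseteq> hyp_plane"
    by (auto simp: hyp_plane_def hyp_chart_def mink_def power2_eq_square[symmetric]
        add_pos_nonneg)
  show "hyp_plane \<subseteq> range hyp_chart"
  proof
    fix x assume x: "x \<in> hyp_plane"
    then have "(x $ 1)\<^sup>2 = 1 + (x $ 2)\<^sup>2 + (x $ 3)\<^sup>2" and "x $ 1 > 0"
      by (auto simp: hyp_plane_def mink_def power2_eq_square)
    then have "sqrt (1 + (x $ 2)\<^sup>2 + (x $ 3)\<^sup>2) = x $ 1"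
      by (metis less_imp_le real_sqrt_unique)
    then have "x = hyp_chart (x $ 2, x $ 3)"
      by (simp add: hyp_chart_def vec_eq_iff forall_3)
    then show "x \<in> range hyp_chart" by blast
  qed
qed

lemma has_vector_derivative_vector3:
  assumes "(f has_vector_derivative f') (at t)" "(g has_vector_derivative g') (at t)"
    "(h has_vector_derivative h') (at t)"
  shows "((\<lambda>t. vector [f t, g t, h t] :: real^3) has_vector_derivative vector [f', g', h']) (at t)"
proof -
  have eq: "vector [a, b, c] = a *\<^sub>R axis 1 1 + b *\<^sub>R axis 2 1 + c *\<^sub>R (axis 3 1 :: real^3)"
    for a b c :: real
    by (simp add: vec_eq_iff forall_3 axis_def)
  show ?thesis
    unfolding eq
    by (intro has_vector_derivative_add)
      (use assms in \<open>auto simp: has_vector_derivative_def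
         intro!: derivative_eq_intros\<close>)
qed

lemma hyp_area_density_eq: "hyp_area_density (u, v) = 1 / sqrt (1 + u\<^sup>2 + v\<^sup>2)"
proof -
  define w where "w = sqrt (1 + u\<^sup>2 + v\<^sup>2)"
  have pos: "1 + u\<^sup>2 + v\<^sup>2 > 0" by (simp add: add_pos_nonneg)
  then have w: "w > 0" "w\<^sup>2 = 1 + u\<^sup>2 + v\<^sup>2" by (simp_all add: w_def)
  have du: "((\<lambda>u. sqrt (1 + u\<^sup>2 + v\<^sup>2)) has_vector_derivative u / w) (at u)"
    unfolding w_def has_real_derivative_iff_has_vector_derivative[symmetric]
    using pos by (auto intro!: derivative_eq_intros simp: field_simps)
  have dv: "((\<lambda>v. sqrt (1 + u\<^sup>2 + v\<^sup>2)) has_vector_derivative v / w) (at v)"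
    unfolding w_def has_real_derivative_iff_has_vector_derivative[symmetric]
    using pos by (auto intro!: derivative_eq_intros simp: field_simps)
  have X: "vector_derivative (\<lambda>u. hyp_chart (u, v)) (at u) = vector [u / w, 1, 0]"
    unfolding hyp_chart_def fst_conv snd_conv
    by (intro vector_derivative_at has_vector_derivative_vector3 du
        has_vector_derivative_id has_vector_derivative_const)
  have Y: "vector_derivative (\<lambda>v. hyp_chart (u, v)) (at v) = vector [v / w, 0, 1]"
    unfolding hyp_chart_def fst_conv snd_conv
    by (intro vector_derivative_at has_vector_derivative_vector3 dv
        has_vector_derivative_id has_vector_derivative_const)
  have "(1 - (u / w)\<^sup>2) * (1 - (v / w)\<^sup>2) - (u / w * (v / w))\<^sup>2 = (w\<^sup>2 - u\<^sup>2 - v\<^sup>2) / w\<^sup>2"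
    using w(1) by (simp add: field_simps power2_eq_square)
  also have "\<dots> = (1 / w)\<^sup>2" using w by (simp add: power_divide)
  finally have "sqrt ((1 - (u / w)\<^sup>2) * (1 - (v / w)\<^sup>2) - (u / w * (v / w))\<^sup>2) = 1 / w"
    using w(1) by simp
  then show ?thesis
    unfolding hyp_area_density_def fst_conv snd_conv X Y Let_def w_def[symmetric]
    by (simp add: mink_def power2_eq_square)
qed

lemma mink_tangent_pos:
  assumes x: "mink x x = -1" and xv: "mink x v = 0" and "v \<noteq> 0"
  shows "mink v v > 0"
proof -
  have x1: "x $ 1 * x $ 1 = 1 + x $ 2 * x $ 2 + x $ 3 * x $ 3"
    and v1: "x $ 1 * v $ 1 = x $ 2 * v $ 2 + x $ 3 * v $ 3"
    using x xv by (simp_all add: mink_def)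
  have pos: "x $ 1 * x $ 1 > 0"
    unfolding x1 by (simp add: add_pos_nonneg)
  have eq: "x $ 1 * x $ 1 * mink v v
      = (x $ 1 * x $ 1) * (v $ 2 * v $ 2 + v $ 3 * v $ 3) - (x $ 1 * v $ 1) * (x $ 1 * v $ 1)"
    by (simp add: mink_def algebra_simps)
  also have "\<dots> = (v $ 2)\<^sup>2 + (v $ 3)\<^sup>2 + (x $ 2 * v $ 3 - x $ 3 * v $ 2)\<^sup>2"
    unfolding x1 v1 by (simp add: power2_eq_square algebra_simps)
  finally have *: "x $ 1 * x $ 1 * mink v v
      = (v $ 2)\<^sup>2 + (v $ 3)\<^sup>2 + (x $ 2 * v $ 3 - x $ 3 * v $ 2)\<^sup>2" .
  have "v $ 2 \<noteq> 0 \<or> v $ 3 \<noteq> 0"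
  proof (rule ccontr)
    assume "\<not> ?thesis"
    then have "v = 0" using v1 pos by (auto simp: vec_eq_iff forall_3)
    then show False using \<open>v \<noteq> 0\<close> by simp
  qed
  then have "(v $ 2)\<^sup>2 + (v $ 3)\<^sup>2 > 0"
    by (simp add: sum_power2_gt_zero_iff)
  then have "x $ 1 * x $ 1 * mink v v > 0" unfolding * by (simp add: add_pos_nonneg)
  with pos show ?thesis by (simp add: zero_less_mult_iff)
qed

lemma mink_orthogonal_frame_eq_0:
  assumes "mink x x = -1" "mink x v = 0" "mink v v > 0" "mink n n = 1" "mink n x = 0" "mink n v = 0"
    and d: "mink d x = 0" "mink d v = 0" "mink d n = 0"
  shows "d = 0"
proof -
  define D where "D = x $ 1 * (v $ 2 * n $ 3 - v $ 3 * n $ 2)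
    - x $ 2 * (v $ 1 * n $ 3 - v $ 3 * n $ 1) + x $ 3 * (v $ 1 * n $ 2 - v $ 2 * n $ 1)"
  have gram: "D * D = - (mink x x * mink v v * mink n n + 2 * mink x v * mink n v * mink n x
     - mink x x * (mink n v)\<^sup>2 - mink v v * (mink n x)\<^sup>2 - mink n n * (mink x v)\<^sup>2)"
    unfolding D_def mink_def by algebra
  then have "D * D = mink v v" using assms by simp
  with assms have "D \<noteq> 0" by auto
  have "D * d $ 1 = - mink d x * (v $ 2 * n $ 3 - v $ 3 * n $ 2)
      + mink d v * (x $ 2 * n $ 3 - x $ 3 * n $ 2) - mink d n * (x $ 2 * v $ 3 - x $ 3 * v $ 2)"
    "D * d $ 2 = - mink d x * (v $ 1 * n $ 3 - v $ 3 * n $ 1)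
      + mink d v * (x $ 1 * n $ 3 - x $ 3 * n $ 1) - mink d n * (x $ 1 * v $ 3 - x $ 3 * v $ 1)"
    "D * d $ 3 = mink d x * (v $ 1 * n $ 2 - v $ 2 * n $ 1)
      - mink d v * (x $ 1 * n $ 2 - x $ 2 * n $ 1) + mink d n * (x $ 1 * v $ 2 - x $ 2 * v $ 1)"
    unfolding D_def mink_def by algebra+
  then show ?thesis using \<open>D \<noteq> 0\<close> d by (simp add: vec_eq_iff forall_3)
qed

lemma mink_velocity:
  assumes "smooth_simple_closed_curve_H2 \<gamma>"
  shows "mink (\<gamma> t) (velocity \<gamma> t) = 0"
proof -
  have "(velocity ^^ 0) \<gamma> differentiable_on UNIV"
    using assms unfolding smooth_simple_closed_curve_H2_def smooth_param_def by blast
  then have "\<gamma> differentiable at t"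
    by (simp add: differentiable_on_def)
  then have der: "(\<gamma> has_vector_derivative velocity \<gamma> t) (at t)"
    unfolding velocity_def by (rule vector_derivative_works[THEN iffD1])
  have c: "((\<lambda>t. \<gamma> t $ i) has_real_derivative velocity \<gamma> t $ i) (at t)" for i
    unfolding has_real_derivative_iff_has_vector_derivative
    using bounded_linear.has_vector_derivative[OF bounded_linear_vec_nth der] .
  have "((\<lambda>t. mink (\<gamma> t) (\<gamma> t)) has_real_derivative 2 * mink (\<gamma> t) (velocity \<gamma> t)) (at t)"
    unfolding mink_def by (auto intro!: derivative_eq_intros c simp: algebra_simps)
  moreover have "mink (\<gamma> t) (\<gamma> t) = -1" for t
    using assms by (auto simp: smooth_simple_closed_curve_H2_def hyp_plane_def)
  ultimately have "((\<lambda>t. -1) has_real_derivative 2 * mink (\<gamma> t) (velocity \<gamma> t)) (at t)"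
    by simp
  from DERIV_unique[OF this DERIV_const] show ?thesis by simp
qed

lemma is_outward_unit_normal_unique:
  assumes "smooth_simple_closed_curve_H2 \<gamma>"
    and n: "is_outward_unit_normal \<gamma> t n" and m: "is_outward_unit_normal \<gamma> t m"
  shows "m = n"
proof -
  let ?x = "\<gamma> t" and ?v = "velocity \<gamma> t"
  have x: "mink ?x ?x = -1" and v0: "?v \<noteq> 0"
    using assms(1) by (auto simp: smooth_simple_closed_curve_H2_def hyp_plane_def)
  note xv = mink_velocity[OF assms(1), of t]
  note vv = mink_tangent_pos[OF x xv v0]
  have nn: "mink n n = 1" "mink n ?x = 0" "mink n ?v = 0"
    and mm: "mink m m = 1" "mink m ?x = 0" "mink m ?v = 0"
    using n m by (auto simp: is_outward_unit_normal_def)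
  define c where "c = mink m n"
  have lin: "mink (m - c *\<^sub>R n) w = mink m w - c * mink n w" for w
    by (simp add: mink_def algebra_simps)
  have "m - c *\<^sub>R n = 0"
    by (rule mink_orthogonal_frame_eq_0[OF x xv vv nn]) (simp_all add: lin nn mm c_def[symmetric])
  then have mc: "m = c *\<^sub>R n" by simp
  have "mink (c *\<^sub>R n) (c *\<^sub>R n) = c\<^sup>2 * mink n n"
    by (simp add: mink_def power2_eq_square algebra_simps)
  then have "c\<^sup>2 = 1" using mm(1) nn(1) unfolding mc by simp
  then consider "c = 1" | "c = -1" by (auto simp: power2_eq_1_iff)
  then show ?thesis
  proof cases
    case 1
    then show ?thesis using mc by simp
  next
    case 2
    have "\<forall>\<^sub>F e in at_right 0. hyp_geodesic ?x n (- e) \<in> enclosed_region \<gamma>"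
      using n by (auto simp: is_outward_unit_normal_def elim: eventually_mono)
    moreover have "\<forall>\<^sub>F e in at_right 0. hyp_geodesic ?x n (- e) \<notin> enclosed_region \<gamma>"
      using m by (auto simp: is_outward_unit_normal_def mc 2 hyp_geodesic_def
          elim: eventually_mono)
    ultimately have "\<forall>\<^sub>F e in at_right (0::real). False"
      by eventually_elim simp
    then show ?thesis by simp
  qed
qed

end

theory Submission
  imports Defs
begin

text \<open>By Gauss--Bonnet the total geodesic curvature is \<open>K = 2\<pi> + A\<close>, and
  \<open>k k' - 1 - sqrt ((k\<^sup>2 - 1) (k'\<^sup>2 - 1)) = (k - k')\<^sup>2 / (sqrt ((k\<^sup>2 - 1) (k'\<^sup>2 - 1)) + k k' - 1)\<close>
  integrates over \<open>\<gamma> \<times> \<gamma>\<close> to the identity between \<open>K\<close>, the length and the total spacelike curvature.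

  For Gauss--Bonnet, the two sides of the Jordan curve in a geodesic tube give the outward normal
  \<open>N\<close>. Convexity of the region follows by a Tietze argument: a chord that stays in the closed region
  cannot touch the boundary, since \<open>s \<mapsto> \<langle>y, N s\<rangle>\<close> would have a critical zero there, which forces
  \<open>y\<close> onto the curve. Hence the region is star-shaped about each inner point \<open>p\<close>, with
  \<open>\<langle>p, N\<rangle> < 0\<close>, and in polar coordinates about \<open>p\<close> the form
  \<open>k ds - cosh r d\<theta>\<close> is exact, while \<open>A = \<integral> (cosh r - 1) d\<theta>\<close> and \<open>\<integral> d\<theta> = 2\<pi>\<close>.\<close>

section \<open>Algebra of the Minkowski form\<close>

text \<open>The region is given only as a bounded component, so the local convexity supplied by the
  Frenet equations has to be turned into a global statement before polar coordinates make sense. No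
  turning number of the tangent is computed. Since \<open>mink p (N t) < 0\<close>, the angle
  between the radial direction and the outward normal stays strictly between -pi/2 and pi/2, so
  \<open>arctan (a t / b t)\<close> is a periodic primitive of
  \<open>c t * \<omega> t - k t * \<sigma> t\<close>. What is left of topology is the winding number
  about \<open>p\<close>: it is positive because the polar angle increases, and it is 1 because a
  ray from \<open>p\<close> meets the curve only once. The term A (4 pi + A) comes from squaring K =
  2 pi + A. The remainder vanishes exactly for constant curvature \<kappa>, and then
  \<open>\<kappa> *\<^sub>R \<gamma> t - N t\<close> is a constant timelike vector, which points to
  the centre of the circle.\<close>

lemma bounded_bilinear_mink: "bounded_bilinear mink"
proof -
  have "bilinear mink"
    unfolding bilinear_def
    by (auto intro!: linearI simp: mink_def algebra_simps)
  then show ?thesis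
    by (simp add: bilinear_conv_bounded_bilinear)
qed

interpretation mink: bounded_bilinear mink
  by (rule bounded_bilinear_mink)

lemmas mink_simps = mink.add_left mink.add_right mink.diff_left mink.diff_right
  mink.scaleR_left mink.scaleR_right mink.minus_left mink.minus_right mink.zero_left mink.zero_right

lemma mink_commute: "mink x y = mink y x"
  by (simp add: mink_def)

lemma has_real_derivative_mink:
  assumes "(f has_vector_derivative f') (at t)" "(g has_vector_derivative g') (at t)"
  shows "((\<lambda>t. mink (f t) (g t)) has_real_derivative mink (f t) g' + mink f' (g t)) (at t)"
  unfolding has_real_derivative_iff_has_vector_derivative
  by (rule mink.has_vector_derivative[OF assms])

text \<open>The Lorentzian cross product: the Euclidean one with the timelike component negated, so
  that \<open>mink (lcross x y) z\<close> is the determinant of \<open>x\<close>, \<open>y\<close>,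
  \<open>z\<close>.\<close>

definition lcross :: "real^3 \<Rightarrow> real^3 \<Rightarrow> real^3" where
  "lcross x y = vector [x $ 3 * y $ 2 - x $ 2 * y $ 3, x $ 3 * y $ 1 - x $ 1 * y $ 3,
     x $ 1 * y $ 2 - x $ 2 * y $ 1]"

lemma lcross_nth [simp]:
  "lcross x y $ 1 = x $ 3 * y $ 2 - x $ 2 * y $ 3"
  "lcross x y $ 2 = x $ 3 * y $ 1 - x $ 1 * y $ 3"
  "lcross x y $ 3 = x $ 1 * y $ 2 - x $ 2 * y $ 1"
  by (simp_all add: lcross_def)

lemma bounded_bilinear_lcross: "bounded_bilinear lcross"
proof -
  have "bilinear lcross"
    unfolding bilinear_def
    by (auto intro!: linearI simp: vec_eq_iff forall_3 algebra_simps)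
  then show ?thesis
    by (simp add: bilinear_conv_bounded_bilinear)
qed

interpretation lcross: bounded_bilinear lcross
  by (rule bounded_bilinear_lcross)

lemma lcross_self [simp]: "lcross x x = 0"
  by (simp add: vec_eq_iff forall_3)

lemma mink_lcross_self [simp]:
  "mink (lcross x y) x = 0" "mink (lcross x y) y = 0"
  "mink x (lcross x y) = 0" "mink y (lcross x y) = 0"
  by (simp_all add: mink_def algebra_simps)

text \<open>Lagrange's identity with the sign opposite to the Euclidean one. This sign makes the
  cross product of a unit timelike and an orthogonal unit spacelike vector a unit spacelike
  vector.\<close>

lemma mink_lcross_lcross:
  "mink (lcross x y) (lcross u v) = mink x v * mink y u - mink x u * mink y v"
  by (simp add: mink_def) algebra

lemma mink_lcross_rotate: "mink (lcross x y) z = mink (lcross y z) x"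
  by (simp add: mink_def algebra_simps)

lemma mink_lcross_swap: "mink (lcross x y) z = - mink (lcross y x) z"
  by (simp add: mink_def algebra_simps)

lemma lcross_lcross: "lcross e (lcross x y) = mink e x *\<^sub>R y - mink e y *\<^sub>R x"
  by (simp add: vec_eq_iff forall_3 mink_def algebra_simps)

text \<open>Serves twice: for the moving frame \<open>\<gamma> t\<close>, \<open>T t\<close>,
  \<open>N t\<close> and for the fixed frame \<open>p\<close>, \<open>e1\<close>, \<open>e2\<close>
  at the pole.\<close>

locale mink_frame =
  fixes x v n :: "real^3"
  assumes xx: "mink x x = -1" and xv: "mink x v = 0" and vv: "mink v v = 1"
    and nn: "mink n n = 1" and nx: "mink n x = 0" and nv: "mink n v = 0"
begin

lemma expand: "y = - mink y x *\<^sub>R x + mink y v *\<^sub>R v + mink y n *\<^sub>R n"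
proof -
  note s = mink_simps xx xv vv nn nx nv
    mink_commute[of v x] mink_commute[of x n] mink_commute[of v n]
  have "y + mink y x *\<^sub>R x - mink y v *\<^sub>R v - mink y n *\<^sub>R n = 0"
    by (rule mink_orthogonal_frame_eq_0[of x v n]) (simp_all add: s)
  then show ?thesis by (simp add: algebra_simps)
qed

lemma mink_expand:
  "mink y z = - (mink y x * mink z x) + mink y v * mink z v + mink y n * mink z n"
  by (subst expand[of y])
    (simp add: mink_simps mink_commute[of x z] mink_commute[of v z] mink_commute[of n z])

end

section \<open>The hyperbolic plane\<close>

lemma hyp_planeD: "x \<in> hyp_plane \<Longrightarrow> mink x x = -1" "x \<in> hyp_plane \<Longrightarrow> x $ 1 > 0"
  by (auto simp: hyp_plane_def)

lemma mink_hyp_plane_le: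
  assumes "x \<in> hyp_plane" "y \<in> hyp_plane"
  shows "mink x y \<le> -1" and "mink x y = -1 \<Longrightarrow> x = y"
proof -
  have x1: "(x $ 1)\<^sup>2 = 1 + (x $ 2)\<^sup>2 + (x $ 3)\<^sup>2" and y1: "(y $ 1)\<^sup>2 = 1 + (y $ 2)\<^sup>2 + (y $ 3)\<^sup>2"
    and pos: "x $ 1 > 0" "y $ 1 > 0"
    using assms by (auto simp: hyp_plane_def mink_def power2_eq_square)
  \<comment> \<open>Lagrange's identity for the Euclidean vectors (1, x2, x3) and (1, y2, y3), whose
    squared lengths are the squares of the timelike coordinates; \<open>D\<close> is the square of
    their cross product.\<close>
  define D where "D = (x $ 2 - y $ 2)\<^sup>2 + (x $ 3 - y $ 3)\<^sup>2 + (x $ 2 * y $ 3 - x $ 3 * y $ 2)\<^sup>2"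
  have eq: "(x $ 1 * y $ 1)\<^sup>2 = (1 + x $ 2 * y $ 2 + x $ 3 * y $ 3)\<^sup>2 + D"
    unfolding power_mult_distrib x1 y1 D_def by algebra
  have D0: "D \<ge> 0" by (simp add: D_def)
  then have "\<bar>1 + x $ 2 * y $ 2 + x $ 3 * y $ 3\<bar> \<le> \<bar>x $ 1 * y $ 1\<bar>"
    using eq by (simp add: abs_le_square_iff)
  then show "mink x y \<le> -1" using pos by (simp add: mink_def)
  assume "mink x y = -1"
  then have "x $ 1 * y $ 1 = 1 + x $ 2 * y $ 2 + x $ 3 * y $ 3" by (simp add: mink_def)
  with eq have "D = 0" by simp
  then have 1: "x $ 2 = y $ 2" "x $ 3 = y $ 3"
    unfolding D_def by (auto simp: add_nonneg_eq_0_iff)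
  then have "(x $ 1)\<^sup>2 = (y $ 1)\<^sup>2" using x1 y1 by simp
  then have "x $ 1 = y $ 1" using pos by (simp add: power2_eq_iff_nonneg)
  then show "x = y" using 1 by (simp add: vec_eq_iff forall_3)
qed

definition hyp_normalize :: "real^3 \<Rightarrow> real^3" where
  "hyp_normalize y = y /\<^sub>R sqrt (- mink y y)"

lemma hyp_normalize_in:
  assumes "mink y y < 0" "y $ 1 > 0" shows "hyp_normalize y \<in> hyp_plane"
  using assms by (simp add: hyp_plane_def hyp_normalize_def mink_simps divide_simps flip: power2_eq_square)

lemma hyp_normalize_eq: "x \<in> hyp_plane \<Longrightarrow> hyp_normalize x = x"
  by (simp add: hyp_normalize_def hyp_planeD)

lemma hyp_normalize_scaleR: "r > 0 \<Longrightarrow> hyp_normalize (r *\<^sub>R y) = hyp_normalize y"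
proof -
  assume r: "r > 0"
  have "sqrt (- mink (r *\<^sub>R y) (r *\<^sub>R y)) = r * sqrt (- mink y y)"
    using r real_sqrt_mult[of "r * r" "- mink y y"] by (simp add: mink_simps mult.assoc)
  then show ?thesis using r by (simp add: hyp_normalize_def)
qed

lemma hyp_normalize_eqD:
  assumes "mink y y < 0" "hyp_normalize y = x"
  obtains r where "r > 0" "y = r *\<^sub>R x"
  using assms that[of "sqrt (- mink y y)"] by (auto simp: hyp_normalize_def)

text \<open>Geodesics of the hyperboloid are radial projections of straight chords, so
  \<open>hyp_normalize (seg p q l)\<close> runs along the geodesic from \<open>p\<close> to
  \<open>q\<close>. Before normalization every pairing with a fixed vector is affine in
  \<open>l\<close>.\<close>

definition seg :: "real^3 \<Rightarrow> real^3 \<Rightarrow> real \<Rightarrow> real^3" where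
  "seg p q l = (1 - l) *\<^sub>R p + l *\<^sub>R q"

lemma seg_timelike:
  assumes "p \<in> hyp_plane" "q \<in> hyp_plane" "0 \<le> l" "l \<le> 1"
  shows "mink (seg p q l) (seg p q l) < 0" "seg p q l $ 1 > 0"
proof -
  have "mink (seg p q l) (seg p q l) = - (1 - l)\<^sup>2 - l\<^sup>2 + 2 * (l * (1 - l)) * mink p q"
    using assms(1,2) by (simp add: seg_def mink_simps hyp_planeD mink_commute[of q p] power2_eq_square
        algebra_simps)
  also have "\<dots> \<le> - (1 - l)\<^sup>2 - l\<^sup>2 + 2 * (l * (1 - l)) * (-1)"
    using assms mink_hyp_plane_le(1)[of p q] by (intro add_left_mono mult_left_mono) auto
  also have "\<dots> = -1" by (simp add: power2_eq_square algebra_simps)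
  finally show "mink (seg p q l) (seg p q l) < 0" by simp
  show "seg p q l $ 1 > 0"
  proof (cases "l = 0")
    case True
    then show ?thesis using assms by (simp add: seg_def hyp_planeD)
  next
    case False
    then have "0 < l * q $ 1" "0 \<le> (1 - l) * p $ 1" using assms hyp_planeD(2)[of p] hyp_planeD(2)[of q] by auto
    then show ?thesis by (simp add: seg_def)
  qed
qed

lemma seg_in: "\<lbrakk>p \<in> hyp_plane; q \<in> hyp_plane; 0 \<le> l; l \<le> 1\<rbrakk> \<Longrightarrow> hyp_normalize (seg p q l) \<in> hyp_plane"
  by (intro hyp_normalize_in seg_timelike)

text \<open>The chart takes values in the complex plane because the Jordan curve theorem is applied
  there; \<open>lift\<close> is its inverse.\<close>

definition proj :: "real^3 \<Rightarrow> complex" where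
  "proj x = Complex (x $ 2) (x $ 3)"

definition lift :: "complex \<Rightarrow> real^3" where
  "lift w = hyp_chart (Re w, Im w)"

lemma lift_in [simp]: "lift w \<in> hyp_plane"
  by (simp add: lift_def hyp_plane_eq_range_chart)

lemma proj_lift [simp]: "proj (lift w) = w"
  by (simp add: proj_def lift_def hyp_chart_def complex_eq_iff)

lemma lift_proj: "x \<in> hyp_plane \<Longrightarrow> lift (proj x) = x"
  by (auto simp: hyp_plane_eq_range_chart proj_def lift_def hyp_chart_def)

lemma inj_on_proj: "inj_on proj hyp_plane"
  by (metis inj_onI lift_proj)

lemma proj_image_iff: "\<lbrakk>C \<subseteq> hyp_plane; x \<in> hyp_plane\<rbrakk> \<Longrightarrow> proj x \<in> proj ` C \<longleftrightarrow> x \<in> C"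
  by (rule inj_on_image_mem_iff[OF inj_on_proj])

lemma bounded_linear_proj: "bounded_linear proj"
proof -
  have "linear proj" by (auto intro!: linearI simp: proj_def complex_eq_iff)
  then show ?thesis by (rule linear_conv_bounded_linear[THEN iffD1])
qed

lemmas continuous_on_proj = bounded_linear.continuous_on[OF bounded_linear_proj]

lemma continuous_on_vector3:
  assumes "continuous_on S f" "continuous_on S g" "continuous_on S h"
  shows "continuous_on S (\<lambda>x. vector [f x, g x, h x] :: real^3)"
proof -
  have "vector [f x, g x, h x] = f x *\<^sub>R axis 1 1 + g x *\<^sub>R axis 2 1 + h x *\<^sub>R (axis 3 1 :: real^3)" for x
    by (simp add: vec_eq_iff forall_3 axis_def)
  then show ?thesis using assms by (auto intro!: continuous_intros)
qed

lemma continuous_on_lift: "continuous_on S lift"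
  unfolding lift_def hyp_chart_def fst_conv snd_conv
  by (intro continuous_on_vector3 continuous_intros)

lemma continuous_on_lift_comp: "continuous_on S f \<Longrightarrow> continuous_on S (\<lambda>x. lift (f x))"
  by (rule continuous_on_compose2[OF continuous_on_lift]) auto

text \<open>The quadratic equation alone leaves a choice of sheet. The timelike coordinate never
  vanishes along the geodesic, so by connectedness it keeps the sign it has at parameter 0.\<close>

lemma hyp_geodesic_in:
  assumes "x \<in> hyp_plane" "mink n n = 1" "mink n x = 0"
  shows "hyp_geodesic x n e \<in> hyp_plane"
proof -
  have eq: "mink (hyp_geodesic x n e) (hyp_geodesic x n e) = -1" for e
    using assms cosh_square_eq[of e]
    by (simp add: hyp_geodesic_def mink_simps hyp_planeD mink_commute[of x n] power2_eq_square)
  have cont: "continuous_on UNIV (\<lambda>e. hyp_geodesic x n e $ 1)"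
    unfolding hyp_geodesic_def by (intro continuous_intros)
  have ne: "hyp_geodesic x n e $ 1 \<noteq> 0" for e
  proof
    assume "hyp_geodesic x n e $ 1 = 0"
    then show False using eq[of e] sum_squares_ge_zero[of "hyp_geodesic x n e $ 2" "hyp_geodesic x n e $ 3"]
      unfolding mink_def by simp
  qed
  have "hyp_geodesic x n e $ 1 > 0"
  proof (rule ccontr)
    assume "\<not> ?thesis"
    then have neg: "hyp_geodesic x n e $ 1 \<le> 0" by simp
    have pos: "hyp_geodesic x n 0 $ 1 > 0" using assms by (simp add: hyp_geodesic_def hyp_planeD)
    have "connected (range (\<lambda>e. hyp_geodesic x n e $ 1))"
      using cont by (rule connected_continuous_image) simp
    then have "0 \<in> range (\<lambda>e. hyp_geodesic x n e $ 1)"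
      using neg pos unfolding connected_iff_interval
      by (metis less_imp_le rangeI)
    then show False using ne by auto
  qed
  with eq show ?thesis by (simp add: hyp_plane_def)
qed

section \<open>The enclosed region in the coordinate chart\<close>

text \<open>\<open>proj\<close> is a homeomorphism from the hyperbolic plane to the complex plane;
  each inclusion is the maximality of a component applied to a continuous image.\<close>

lemma proj_connected_component:
  assumes x: "x \<in> hyp_plane - C" and C: "C \<subseteq> hyp_plane"
  shows "proj ` connected_component_set (hyp_plane - C) x
    = connected_component_set (- (proj ` C)) (proj x)"
proof
  let ?A = "connected_component_set (hyp_plane - C) x"
  let ?B = "connected_component_set (- (proj ` C)) (proj x)"
  have sub: "?A \<subseteq> hyp_plane - C" by (rule connected_component_subset)
  show "proj ` ?A \<subseteq> ?B"
  proof (rule connected_component_maximal)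
    show "proj x \<in> proj ` ?A" using x by auto
    show "connected (proj ` ?A)"
      by (intro connected_continuous_image continuous_on_proj connected_connected_component
          continuous_on_id)
    show "proj ` ?A \<subseteq> - proj ` C"
    proof (rule image_subsetI)
      fix y assume "y \<in> ?A"
      then have "y \<in> hyp_plane - C" using sub by blast
      then show "proj y \<in> - proj ` C" using proj_image_iff[OF C] by simp
    qed
  qed
  have "proj x \<notin> proj ` C" using x proj_image_iff[OF C] by simp
  have "lift ` ?B \<subseteq> ?A"
  proof (rule connected_component_maximal)
    show "x \<in> lift ` ?B" using x \<open>proj x \<notin> proj ` C\<close>
      by (intro image_eqI[of _ _ "proj x"]) (auto simp: lift_proj)
    show "connected (lift ` ?B)"
      by (intro connected_continuous_image continuous_on_lift connected_connected_component)
    show "lift ` ?B \<subseteq> hyp_plane - C"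
    proof
      fix y assume "y \<in> lift ` ?B"
      then obtain w where w: "w \<in> ?B" "y = lift w" by blast
      then have "w \<notin> proj ` C" using connected_component_subset by blast
      then show "y \<in> hyp_plane - C" using w by (auto intro: image_eqI[of _ _ "lift w"])
    qed
  qed
  then have "proj ` lift ` ?B \<subseteq> proj ` ?A" by (rule image_mono)
  then show "?B \<subseteq> proj ` ?A" by (simp add: image_image)
qed

text \<open>The direction that is not linear uses compactness: \<open>lift\<close> maps the compact
  closure of the projected set to a bounded set.\<close>

lemma bounded_proj_image_iff:
  assumes "A \<subseteq> hyp_plane" shows "bounded (proj ` A) \<longleftrightarrow> bounded A"
proof
  assume "bounded (proj ` A)"
  then have "compact (lift ` closure (proj ` A))"
    by (intro compact_continuous_image continuous_on_lift) simp
  then have "bounded (lift ` closure (proj ` A))" by (rule compact_imp_bounded)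
  moreover have "A \<subseteq> lift ` closure (proj ` A)"
  proof
    fix x assume "x \<in> A"
    then have "proj x \<in> closure (proj ` A)" by (intro closure_subset[THEN subsetD] imageI)
    moreover have "x = lift (proj x)" using \<open>x \<in> A\<close> assms by (auto simp: lift_proj)
    ultimately show "x \<in> lift ` closure (proj ` A)" by (rule rev_image_eqI)
  qed
  ultimately show "bounded A" by (rule bounded_subset)
qed (rule bounded_linear_image[OF _ bounded_linear_proj])

text \<open>Translates the region into the planar notion \<open>inside\<close>, to which the Jordan
  curve theorem applies.\<close>

lemma enclosed_region_eq:
  assumes "range \<gamma> \<subseteq> hyp_plane"
  shows "enclosed_region \<gamma> = {x \<in> hyp_plane. proj x \<in> inside (proj ` range \<gamma>)}"
proof -
  have "x \<in> enclosed_region \<gamma> \<longleftrightarrow> proj x \<in> inside (proj ` range \<gamma>)" if x: "x \<in> hyp_plane" for x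
  proof (cases "x \<in> range \<gamma>")
    case True
    then show ?thesis by (auto simp: enclosed_region_def inside_def)
  next
    case False
    then have nin: "proj x \<notin> proj ` range \<gamma>" 
      using x proj_image_iff[OF assms] by simp
    have "connected_component_set (hyp_plane - range \<gamma>) x \<subseteq> hyp_plane"
      using connected_component_subset by blast
    from bounded_proj_image_iff[OF this]
    show ?thesis using False x nin assms
      by (simp add: enclosed_region_def inside_def proj_connected_component)
  qed
  then show ?thesis by (auto simp: enclosed_region_def)
qed

section \<open>The frame of a closed curve\<close>

lemma velocity_eqI: "(f has_vector_derivative D) (at t) \<Longrightarrow> velocity f t = D"
  by (simp add: velocity_def vector_derivative_at)

lemma velocity_periodic:
  assumes per: "\<And>t. f (t + c) = f t" and "f differentiable at (t + c)"
  shows "velocity f (t + c) = velocity f t"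
proof -
  have "(f has_vector_derivative velocity f (t + c)) (at (t + c))"
    unfolding velocity_def using assms(2) vector_derivative_works by blast
  moreover have "((\<lambda>t. t + c) has_vector_derivative 1) (at t)"
    by (auto intro!: derivative_eq_intros)
  ultimately have "((f \<circ> (\<lambda>t. t + c)) has_vector_derivative 1 *\<^sub>R velocity f (t + c)) (at t)"
    by (intro vector_diff_chain_at)
  moreover have "f \<circ> (\<lambda>t. t + c) = f" using per by (auto simp: fun_eq_iff)
  ultimately show ?thesis by (auto dest: velocity_eqI)
qed

locale hyp_curve =
  fixes \<gamma> :: "real \<Rightarrow> real^3"
  assumes curve: "smooth_simple_closed_curve_H2 \<gamma>"
begin

abbreviation "\<sigma> \<equiv> speed \<gamma>"
abbreviation "T \<equiv> unit_tangent \<gamma>"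

lemma gamma_in: "\<gamma> t \<in> hyp_plane"
  and range_sub: "range \<gamma> \<subseteq> hyp_plane"
  and gamma_period: "\<gamma> (t + 2 * pi) = \<gamma> t"
  and velocity_nz: "velocity \<gamma> t \<noteq> 0"
  and gamma_inj: "inj_on \<gamma> {0..<2 * pi}"
  using curve by (auto simp: smooth_simple_closed_curve_H2_def)

lemma smooth: "(velocity ^^ n) \<gamma> differentiable at t"
  using curve by (auto simp: smooth_simple_closed_curve_H2_def smooth_param_def differentiable_on_def)

lemma D_gamma: "(\<gamma> has_vector_derivative velocity \<gamma> t) (at t)"
  using smooth[of 0 t] vector_derivative_works by (auto simp: velocity_def)

lemma D_velocity: "(velocity \<gamma> has_vector_derivative velocity (velocity \<gamma>) t) (at t)"
  using smooth[of 1 t] vector_derivative_works unfolding velocity_def by auto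

lemma cont_acc: "continuous_on S (velocity (velocity \<gamma>))"
  using smooth[of 2] unfolding numeral_2_eq_2
  by (auto intro!: continuous_at_imp_continuous_on differentiable_imp_continuous_within)

lemma cont_velocity: "continuous_on S (velocity \<gamma>)"
  using D_velocity by (intro continuous_at_imp_continuous_on ballI has_vector_derivative_continuous)

lemma cont_gamma: "continuous_on S \<gamma>"
  using D_gamma by (intro continuous_at_imp_continuous_on ballI has_vector_derivative_continuous)

lemma velocity_period: "velocity \<gamma> (t + 2 * pi) = velocity \<gamma> t"
  using smooth[of 0] by (intro velocity_periodic gamma_period) auto

lemma speed_period: "\<sigma> (t + 2 * pi) = \<sigma> t"
  by (simp add: speed_def velocity_period)

lemma mink_gamma: "mink (\<gamma> t) (\<gamma> t) = -1"
  using gamma_in hyp_planeD by blast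

lemma mink_vel_pos: "mink (velocity \<gamma> t) (velocity \<gamma> t) > 0"
  using mink_gamma mink_velocity[OF curve] velocity_nz by (rule mink_tangent_pos)

lemma speed_pos: "\<sigma> t > 0"
  using mink_vel_pos by (simp add: speed_def)

lemma speed_nz [simp]: "\<sigma> t \<noteq> 0"
  using speed_pos[of t] by simp

lemma T_eq: "T t = velocity \<gamma> t /\<^sub>R \<sigma> t"
  by (simp add: unit_tangent_def arc_deriv_def)

lemma vel_eq: "velocity \<gamma> t = \<sigma> t *\<^sub>R T t"
  using speed_pos[of t] by (simp add: T_eq)

lemma T_period: "T (t + 2 * pi) = T t"
  by (simp add: T_eq velocity_period speed_period)

lemma D_speed: "(\<sigma> has_real_derivative mink (velocity \<gamma> t) (velocity (velocity \<gamma>) t) / \<sigma> t) (at t)"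
proof -
  have "((\<lambda>t. sqrt (mink (velocity \<gamma> t) (velocity \<gamma> t))) has_real_derivative
     mink (velocity \<gamma> t) (velocity (velocity \<gamma>) t) / \<sigma> t) (at t)"
    using mink_vel_pos[of t]
    by (auto intro!: derivative_eq_intros has_real_derivative_mink D_velocity
      simp: speed_def mink_commute[of "velocity (velocity \<gamma>) t"] field_simps)
  then show ?thesis by (simp add: speed_def[abs_def])
qed

lemma cont_speed: "continuous_on S \<sigma>"
  using D_speed by (intro continuous_at_imp_continuous_on ballI DERIV_isCont)

text \<open>The derivative of the unit tangent by the quotient rule. This explicit form shows its
  continuity before the normal has been oriented; the Frenet form comes later.\<close>

definition T' :: "real \<Rightarrow> real^3" where
  "T' t = velocity (velocity \<gamma>) t /\<^sub>R \<sigma> t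
     - (mink (velocity \<gamma> t) (velocity (velocity \<gamma>) t) / \<sigma> t ^ 3) *\<^sub>R velocity \<gamma> t"

lemma cont_T': "continuous_on S T'"
  unfolding T'_def
  by (intro continuous_intros cont_acc cont_velocity cont_speed mink.continuous_on) simp_all

lemma D_T: "(T has_vector_derivative T' t) (at t)"
proof -
  have inv: "((\<lambda>t. inverse (\<sigma> t)) has_real_derivative
      - (mink (velocity \<gamma> t) (velocity (velocity \<gamma>) t) / \<sigma> t ^ 3)) (at t)"
    using speed_pos[of t]
    by (auto intro!: derivative_eq_intros D_speed simp: field_simps power3_eq_cube)
  have "((\<lambda>t. inverse (\<sigma> t) *\<^sub>R velocity \<gamma> t) has_vector_derivative T' t) (at t)"
    using has_vector_derivative_scaleR[OF inv D_velocity]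
    by (simp add: T'_def algebra_simps)
  then show ?thesis by (simp add: T_eq[abs_def])
qed

lemma cont_T: "continuous_on S T"
  using D_T by (intro continuous_at_imp_continuous_on ballI has_vector_derivative_continuous)

lemma mink_T [simp]: "mink (T t) (T t) = 1" "mink (\<gamma> t) (T t) = 0" "mink (T t) (\<gamma> t) = 0"
proof -
  have "\<sigma> t * \<sigma> t = mink (velocity \<gamma> t) (velocity \<gamma> t)"
    using mink_vel_pos[of t] by (simp add: speed_def)
  then show "mink (T t) (T t) = 1" using speed_pos[of t] mink_vel_pos[of t]
    by (simp add: T_eq mink_simps field_simps)
  show "mink (\<gamma> t) (T t) = 0" using mink_velocity[OF curve] by (simp add: T_eq mink_simps)
  then show "mink (T t) (\<gamma> t) = 0" by (simp add: mink_commute)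
qed

text \<open>A unit normal whose direction, outward or inward, is still undecided;
  \<open>orient\<close> settles it below.\<close>

definition nrm :: "real \<Rightarrow> real^3" where
  "nrm t = lcross (\<gamma> t) (T t)"

lemma D_nrm: "(nrm has_vector_derivative lcross (\<gamma> t) (T' t)) (at t)"
proof -
  have "lcross (velocity \<gamma> t) (T t) = 0"
    by (subst vel_eq) (simp add: lcross.scaleR_left)
  with lcross.has_vector_derivative[OF D_gamma D_T, of t] show ?thesis
    by (simp add: nrm_def[abs_def])
qed

lemma cont_nrm: "continuous_on S nrm"
  using D_nrm by (intro continuous_at_imp_continuous_on ballI has_vector_derivative_continuous)

lemma nrm_period: "nrm (t + 2 * pi) = nrm t"
  by (simp add: nrm_def gamma_period T_period)

lemma mink_nrm: "mink (nrm t) (nrm t) = 1" "mink (nrm t) (\<gamma> t) = 0" "mink (nrm t) (T t) = 0"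
  by (simp_all add: nrm_def mink_lcross_lcross mink_gamma)

lemma gamma_period_int: "\<gamma> (t + 2 * pi * of_int k) = \<gamma> t"
proof (induction k rule: int_induct[of _ 0])
  case base
  then show ?case by simp
next
  case (step1 i)
  then show ?case using gamma_period[of "t + 2 * pi * of_int i"] by (simp add: algebra_simps)
next
  case (step2 i)
  then show ?case using gamma_period[of "t + 2 * pi * of_int (i - 1)"] by (simp add: algebra_simps)
qed

lemma gamma_reduce: obtains k :: int and s where "s \<in> {a..<a + 2 * pi}" "t = s + 2 * pi * of_int k" "\<gamma> s = \<gamma> t"
proof -
  define k where "k = \<lfloor>(t - a) / (2 * pi)\<rfloor>"
  have "of_int k \<le> (t - a) / (2 * pi)" "(t - a) / (2 * pi) < of_int k + 1"
    unfolding k_def by linarith+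
  then have "2 * pi * of_int k \<le> t - a" "t - a < 2 * pi * (of_int k + 1)"
    using pi_gt_zero by (simp_all add: field_simps)
  then have "t - 2 * pi * of_int k \<in> {a..<a + 2 * pi}" by (auto simp: algebra_simps)
  then show ?thesis using that[of "t - 2 * pi * of_int k" k]
      gamma_period_int[of "t - 2 * pi * of_int k" k] by simp
qed

text \<open>Frees injectivity from the window starting at 0: after both parameters are reduced, they
  differ by an integer number of periods, and the bound makes this integer 0.\<close>

lemma gamma_eqD:
  assumes "\<gamma> s = \<gamma> t" "\<bar>s - t\<bar> < 2 * pi" shows "s = t"
proof -
  obtain k s0 where s0: "s0 \<in> {0..<0 + 2 * pi}" "s = s0 + 2 * pi * of_int k" "\<gamma> s0 = \<gamma> s"
    by (rule gamma_reduce)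
  obtain m t0 where t0: "t0 \<in> {0..<0 + 2 * pi}" "t = t0 + 2 * pi * of_int m" "\<gamma> t0 = \<gamma> t"
    by (rule gamma_reduce)
  have "\<gamma> s0 = \<gamma> t0" using s0(3) t0(3) assms(1) by simp
  then have "s0 = t0" using s0(1) t0(1) gamma_inj by (auto dest: inj_onD)
  then have "s - t = 2 * pi * of_int (k - m)" using s0 t0 by (simp add: algebra_simps)
  then have "2 * pi * \<bar>of_int (k - m)\<bar> < 2 * pi * 1" using assms(2) by (simp add: abs_mult)
  then have "\<bar>real_of_int (k - m)\<bar> < 1" by (subst (asm) mult_less_cancel_left_pos) auto
  then have "k = m" by linarith
  then show ?thesis using s0 t0 \<open>s0 = t0\<close> by simp
qed

section \<open>The projected Jordan curve and its two complementary domains\<close>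

abbreviation z :: "real \<Rightarrow> complex" where "z t \<equiv> proj (\<gamma> t)"

definition inner_dom :: "complex set" where "inner_dom = inside (range z)"
definition outer_dom :: "complex set" where "outer_dom = outside (range z)"

lemma cont_z: "continuous_on S z"
  by (intro continuous_on_proj cont_gamma)

lemma z_eq_iff: "z s = z t \<longleftrightarrow> \<gamma> s = \<gamma> t"
  using inj_on_proj gamma_in by (auto dest: inj_onD)

lemma Jordan:
  shows inner_ne: "inner_dom \<noteq> {}" and open_inner: "open inner_dom" and connected_inner: "connected inner_dom"
    and open_outer: "open outer_dom" and bounded_inner: "bounded inner_dom"
    and inner_Int_outer: "inner_dom \<inter> outer_dom = {}"
    and inner_Un_outer: "inner_dom \<union> outer_dom = - range z"
    and frontier_inner: "frontier inner_dom = range z"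
    and frontier_outer: "frontier outer_dom = range z"
proof -
  define c where "c s = z (2 * pi * s)" for s
  have inj: "c x = c y \<longrightarrow> x = y \<or> x = 0 \<and> y = 1 \<or> x = 1 \<and> y = 0"
    if "x \<in> {0..1}" "y \<in> {0..1}" for x y
  proof
    assume "c x = c y"
    then have eq: "\<gamma> (2 * pi * x) = \<gamma> (2 * pi * y)" by (simp add: c_def z_eq_iff)
    have ab: "\<bar>2 * pi * x - 2 * pi * y\<bar> = 2 * pi * \<bar>x - y\<bar>"
      by (simp add: abs_mult flip: right_diff_distrib)
    have "\<bar>x - y\<bar> \<le> 1" using that by (auto simp: abs_le_iff)
    then consider "\<bar>x - y\<bar> < 1" | "\<bar>x - y\<bar> = 1" by linarith
    then show "x = y \<or> x = 0 \<and> y = 1 \<or> x = 1 \<and> y = 0"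
    proof cases
      case 1
      then have "\<bar>2 * pi * x - 2 * pi * y\<bar> < 2 * pi" unfolding ab by simp
      then show ?thesis using gamma_eqD[OF eq] by simp
    next
      case 2
      then show ?thesis using that by auto
    qed
  qed
  have simple: "simple_path c"
    unfolding simple_path_def path_def loop_free_def
    using inj by (auto simp: c_def intro!: continuous_intros continuous_on_compose2[OF cont_z[of UNIV]])
  have closed: "pathfinish c = pathstart c"
    using gamma_period[of 0] by (simp add: c_def pathfinish_def pathstart_def)
  have img: "path_image c = range z"
  proof
    show "range z \<subseteq> path_image c"
    proof
      fix w assume "w \<in> range z"
      then obtain t where t: "w = z t" by blast
      obtain k s where s: "s \<in> {0..<2 * pi}" "\<gamma> s = \<gamma> t"
        using gamma_reduce[of 0 t] by (metis add_0)
      then have "w = c (s / (2 * pi))" "s / (2 * pi) \<in> {0..1}" using t by (auto simp: c_def)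
      then show "w \<in> path_image c" unfolding path_image_def by (rule image_eqI)
    qed
  qed (auto simp: path_image_def c_def)
  from Jordan_inside_outside[OF simple closed, unfolded img]
  show "inner_dom \<noteq> {}" "open inner_dom" "connected inner_dom" "open outer_dom" "bounded inner_dom"
    "inner_dom \<inter> outer_dom = {}" "inner_dom \<union> outer_dom = - range z"
    "frontier inner_dom = range z" "frontier outer_dom = range z"
    unfolding inner_dom_def outer_dom_def by blast+
qed

lemma region_eq: "enclosed_region \<gamma> = {x \<in> hyp_plane. proj x \<in> inner_dom}"
  using enclosed_region_eq[OF range_sub] by (simp add: inner_dom_def image_image)

lemma closure_inner: "closure inner_dom = inner_dom \<union> range z"
  using frontier_inner open_inner by (simp add: closure_Un_frontier)

lemma outer_iff: "w \<in> outer_dom \<longleftrightarrow> w \<notin> closure inner_dom"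
  using inner_Int_outer inner_Un_outer unfolding closure_inner by blast

section \<open>The two sides of the curve\<close>

text \<open>Fermi coordinates: the point at signed distance \<open>snd x\<close> on the geodesic
  normal to the curve at parameter \<open>fst x\<close>.\<close>

definition tube :: "real \<times> real \<Rightarrow> complex" where
  "tube x = proj (hyp_geodesic (\<gamma> (fst x)) (nrm (fst x)) (snd x))"

lemma tube_0: "tube (s, 0) = z s"
  by (simp add: tube_def hyp_geodesic_def)

text \<open>The inverse function argument: at \<open>(t, 0)\<close> the columns of the derivative
  are the projected velocity and normal, which are independent, and the derivative varies
  continuously.\<close>

lemma tube_locally_injective:
  obtains r where "r > 0" "inj_on tube (ball (t, 0) r)" 
proof -
  define A where "A x = proj (cosh (snd x) *\<^sub>R velocity \<gamma> (fst x)
     + sinh (snd x) *\<^sub>R lcross (\<gamma> (fst x)) (T' (fst x)))" for x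
  define B where "B x = proj (sinh (snd x) *\<^sub>R \<gamma> (fst x) + cosh (snd x) *\<^sub>R nrm (fst x))" for x
  define f' where "f' x h = fst h *\<^sub>R A x + snd h *\<^sub>R B x" for x h :: "real \<times> real"
  have comp: "continuous_on S (\<lambda>x :: real \<times> real. f (fst x))" if "continuous_on UNIV f" for f :: "real \<Rightarrow> real^3" and S
    using that by (rule continuous_on_compose2) (auto intro!: continuous_intros)
  have contA: "continuous_on UNIV A"
    unfolding A_def by (intro continuous_on_proj continuous_intros lcross.continuous_on comp
        cont_velocity cont_gamma cont_T')
  have contB: "continuous_on UNIV B"
    unfolding B_def by (intro continuous_on_proj continuous_intros comp cont_gamma cont_nrm)
  have der: "(tube has_derivative f' x) (at x)" for x
  proof -
    have cfst: "((\<lambda>x. f (fst x)) has_derivative (\<lambda>h. fst h *\<^sub>R D)) (at x)"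
      if "(f has_vector_derivative D) (at (fst x))" for f :: "real \<Rightarrow> real^3" and D
      using has_derivative_compose[OF has_derivative_fst[OF has_derivative_ident]
          that[unfolded has_vector_derivative_def]] .
    have "((\<lambda>x. hyp_geodesic (\<gamma> (fst x)) (nrm (fst x)) (snd x)) has_derivative
      (\<lambda>h. fst h *\<^sub>R (cosh (snd x) *\<^sub>R velocity \<gamma> (fst x)
         + sinh (snd x) *\<^sub>R lcross (\<gamma> (fst x)) (T' (fst x)))
        + snd h *\<^sub>R (sinh (snd x) *\<^sub>R \<gamma> (fst x) + cosh (snd x) *\<^sub>R nrm (fst x)))) (at x)"
      unfolding hyp_geodesic_def
      by (rule derivative_eq_intros cfst[OF D_gamma] cfst[OF D_nrm] refl
          DERIV_compose_FDERIV[OF has_field_derivative_cosh[OF DERIV_ident]]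
          DERIV_compose_FDERIV[OF has_field_derivative_sinh[OF DERIV_ident]])+
        (simp add: fun_eq_iff algebra_simps)
    from bounded_linear.has_derivative[OF bounded_linear_proj this]
    show ?thesis
      by (simp add: tube_def[abs_def] f'_def[abs_def] A_def B_def
          linear_add[OF bounded_linear.linear[OF bounded_linear_proj]]
          linear_scale[OF bounded_linear.linear[OF bounded_linear_proj]])
  qed
  have lin: "linear (f' x)" for x
    using der[of x] by (simp add: has_derivative_bounded_linear bounded_linear.linear)
  have "inj (f' (t, 0))"
  proof (rule linear_injective_0[OF lin, THEN iffD2], intro allI impI)
    fix h assume h: "f' (t, 0) h = 0"
    define y where "y = fst h *\<^sub>R velocity \<gamma> t + snd h *\<^sub>R nrm t"
    have "proj y = 0"
      using h by (simp add: f'_def A_def B_def y_def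
          linear_add[OF bounded_linear.linear[OF bounded_linear_proj]]
          linear_scale[OF bounded_linear.linear[OF bounded_linear_proj]])
    then have y23: "y $ 2 = 0" "y $ 3 = 0" by (simp_all add: proj_def complex_eq_iff)
    \<comment> \<open>\<open>proj\<close> annihilates only multiples of the time axis, and a nonzero
      one is never orthogonal to a point of the hyperbolic plane.\<close>
    have "mink y (\<gamma> t) = 0" using mink_nrm(2)[of t]
      by (simp add: y_def mink_simps vel_eq)
    then have "y $ 1 * \<gamma> t $ 1 = 0" using y23 by (simp add: mink_def)
    then have "y = 0" using y23 hyp_planeD(2)[OF gamma_in[of t]] by (simp add: vec_eq_iff forall_3)
    have "mink y (T t) = fst h * \<sigma> t" "mink y (nrm t) = snd h"
      using mink_nrm[of t] mink_commute[of "T t" "nrm t"] by (simp_all add: y_def mink_simps vel_eq)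
    then show "h = 0" using \<open>y = 0\<close> speed_pos[of t] by (simp add: mink_simps prod_eq_iff)
  qed
  then obtain g' where g': "linear g'" "g' \<circ> f' (t, 0) = id"
    using linear_injective_left_inverse[OF lin] by blast
  \<comment> \<open>The operator norm of a difference of derivatives is at most the sum of the norms
    of the column differences.\<close>
  have small: "\<exists>d>0. \<forall>x. dist (t, 0) x < d \<longrightarrow> onorm (\<lambda>v. f' x v - f' (t, 0) v) < e" if "e > 0" for e
  proof -
    have "isCont (\<lambda>x. norm (A x - A (t, 0)) + norm (B x - B (t, 0))) (t, 0)"
      using contA contB
      by (intro continuous_intros) (auto simp: continuous_on_eq_continuous_at)
    from this[unfolded continuous_at_eps_delta, rule_format, OF that]
    obtain d where d: "d > 0" "\<And>x. dist x (t, 0) < d \<Longrightarrow>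
        norm (A x - A (t, 0)) + norm (B x - B (t, 0)) < e" by auto
    have "onorm (\<lambda>v. f' x v - f' (t, 0) v) < e" if "dist (t, 0) x < d" for x
    proof -
      have "onorm (\<lambda>v. f' x v - f' (t, 0) v) \<le> norm (A x - A (t, 0)) + norm (B x - B (t, 0))"
      proof (rule onorm_bound)
        fix h :: "real \<times> real"
        have "f' x h - f' (t, 0) h = fst h *\<^sub>R (A x - A (t, 0)) + snd h *\<^sub>R (B x - B (t, 0))"
          by (simp add: f'_def algebra_simps)
        also have "norm \<dots> \<le> \<bar>fst h\<bar> * norm (A x - A (t, 0)) + \<bar>snd h\<bar> * norm (B x - B (t, 0))"
          by (metis norm_scaleR norm_triangle_ineq)
        also have "\<dots> \<le> norm h * norm (A x - A (t, 0)) + norm h * norm (B x - B (t, 0))"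
          by (intro add_mono mult_right_mono)
            (use norm_fst_le[of "fst h" "snd h"] norm_snd_le[of "snd h" "fst h"] in auto)
        finally show "norm (f' x h - f' (t, 0) h)
            \<le> (norm (A x - A (t, 0)) + norm (B x - B (t, 0))) * norm h"
          by (simp add: algebra_simps)
      qed auto
      also have "\<dots> < e" using d(2) that by (simp add: dist_commute)
      finally show ?thesis .
    qed
    then show ?thesis using d(1) by blast
  qed
  show ?thesis
    by (rule has_derivative_locally_injective[of "(t, 0)" UNIV g' f' tube])
      (use g' der small that in \<open>auto simp: linear_conv_bounded_linear\<close>)
qed

lemma cont_tube: "continuous_on S tube"
  unfolding tube_def hyp_geodesic_def
  by (intro continuous_on_proj continuous_intros continuous_on_compose2[OF cont_gamma[of UNIV]]
      continuous_on_compose2[OF cont_nrm[of UNIV]]) auto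

text \<open>The arc of one period window whose parameters keep distance \<open>r1\<close> from
  \<open>t\<close> is a compact set \<open>F\<close> missing \<open>z t\<close>. Near
  \<open>z t\<close> any curve point therefore has a nearby parameter \<open>s\<close>, and local
  injectivity identifies its tube coordinates with \<open>(s, 0)\<close>.\<close>

lemma tube_meets_curve_only_at_0:
  obtains r where "r > 0" "inj_on tube (ball (t, 0) r)"
    "\<And>x. x \<in> ball (t, 0) r \<Longrightarrow> tube x \<in> range z \<Longrightarrow> snd x = 0"
proof -
  obtain r1 where r1: "r1 > 0" "inj_on tube (ball (t, 0) r1)" by (rule tube_locally_injective)
  define F where "F = z ` ({t - pi..t + pi} - {t - r1<..<t + r1})"
  have "compact F" unfolding F_def
    by (intro compact_continuous_image cont_z compact_diff) auto
  have "z t \<notin> F"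
  proof
    assume "z t \<in> F"
    then obtain s where s: "s \<in> {t - pi..t + pi} - {t - r1<..<t + r1}" "z t = z s"
      unfolding F_def by (rule imageE)
    then have "\<gamma> s = \<gamma> t" by (simp add: z_eq_iff)
    moreover have "\<bar>s - t\<bar> < 2 * pi"
    proof -
      have "t - pi \<le> s" "s \<le> t + pi" using s(1) by auto
      then show ?thesis using pi_gt_zero by linarith
    qed
    ultimately have "s = t" by (rule gamma_eqD)
    then show False using s r1 by simp
  qed
  have "open (tube -` (- F))"
    using cont_tube \<open>compact F\<close> by (intro open_vimage) (auto simp: compact_imp_closed)
  moreover have "(t, 0) \<in> tube -` (- F)" using \<open>z t \<notin> F\<close> by (simp add: tube_0)
  ultimately obtain r2 where r2: "r2 > 0" "ball (t, 0) r2 \<subseteq> tube -` (- F)"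
    by (rule openE)
  show ?thesis
  proof (rule that[of "min r1 r2"])
    show "0 < min r1 r2" using r1 r2 by simp
    show "inj_on tube (ball (t, 0) (min r1 r2))" by (rule inj_on_subset[OF r1(2)]) auto
    fix x assume x: "x \<in> ball (t, 0) (min r1 r2)" "tube x \<in> range z"
    then obtain s0 where s0: "tube x = z s0" by blast
    obtain k s where s: "s \<in> {t - pi..<t - pi + 2 * pi}" "\<gamma> s = \<gamma> s0"
      using gamma_reduce[of "t - pi" s0] by metis
    have "z s = tube x" using s s0 by simp
    moreover have "tube x \<notin> F" using x r2 by auto
    ultimately have "z s \<notin> F" by simp
    then have "s \<notin> {t - pi..t + pi} - {t - r1<..<t + r1}" unfolding F_def by blast
    then have "s \<in> {t - r1<..<t + r1}" using s(1) by auto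
    then have "(s, 0) \<in> ball (t, 0) r1" by (simp add: dist_Pair_Pair dist_real_def abs_less_iff)
    moreover have "tube (s, 0) = tube x" using \<open>z s = tube x\<close> by (simp add: tube_0)
    ultimately have "x = (s, 0)" using r1(2) x(1) by (auto dest: inj_onD)
    then show "snd x = 0" by simp
  qed
qed

text \<open>The sign \<open>\<epsilon>\<close> is 1 if \<open>nrm\<close> points out of the region
  near \<open>t\<close> and -1 if it points into it.\<close>

definition sided :: "real \<Rightarrow> real \<Rightarrow> real \<Rightarrow> bool" where
  "sided \<epsilon> t r \<longleftrightarrow> r > 0 \<and> inj_on tube (ball (t, 0) r) \<and>
     (\<forall>x\<in>ball (t, 0) r. (\<epsilon> * snd x > 0 \<longrightarrow> tube x \<in> outer_dom) \<and> (\<epsilon> * snd x < 0 \<longrightarrow> tube x \<in> inner_dom))"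

lemma connected_one_side:
  assumes "connected S" "S \<inter> range z = {}"
  shows "S \<subseteq> inner_dom \<or> S \<subseteq> outer_dom"
proof -
  have S: "S \<subseteq> inner_dom \<union> outer_dom" using assms(2) inner_Un_outer by blast
  then have "inner_dom \<inter> S = {} \<or> outer_dom \<inter> S = {}"
    using connectedD[OF assms(1) open_inner open_outer] inner_Int_outer by blast
  then show ?thesis using S by blast
qed

text \<open>Each open half of the ball has a connected image off the curve, hence in one domain. The
  frontier of either domain is the whole curve, so both domains occur near \<open>z t\<close>, and
  the halves lie in different ones.\<close>

lemma sided_exists: "\<exists>r. sided 1 t r \<or> sided (-1) t r"
proof -
  obtain r where r: "r > 0" "inj_on tube (ball (t, 0) r)"
    "\<And>x. x \<in> ball (t, 0) r \<Longrightarrow> tube x \<in> range z \<Longrightarrow> snd x = 0"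
    by (rule tube_meets_curve_only_at_0[of t]) blast
  \<comment> \<open>Invariance of domain makes the tube image a neighbourhood of \<open>z t\<close>,
    so it meets every set having \<open>z t\<close> in its closure.\<close>
  have op: "open (tube ` ball (t, 0) r)"
    by (rule invariance_of_domain_gen) (use r cont_tube in auto)
  define P where "P = ball (t, 0::real) r \<inter> {x. snd x > 0}"
  define M where "M = ball (t, 0::real) r \<inter> {x. snd x < 0}"
  have "convex {x :: real \<times> real. snd x > 0}" "convex {x :: real \<times> real. snd x < 0}"
    using convex_halfspace_gt[of 0 "(0::real, 1::real)"] convex_halfspace_lt[of "(0::real, 1::real)" 0]
    by (simp_all add: inner_prod_def)
  then have "convex P" "convex M" unfolding P_def M_def by (auto intro: convex_Int)
  then have "connected (tube ` P)" "connected (tube ` M)"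
    by (simp_all add: connected_continuous_image cont_tube convex_connected)
  moreover have "tube ` P \<inter> range z = {}" "tube ` M \<inter> range z = {}"
    unfolding P_def M_def using r(3) by fastforce+
  ultimately have P: "tube ` P \<subseteq> inner_dom \<or> tube ` P \<subseteq> outer_dom" and M: "tube ` M \<subseteq> inner_dom \<or> tube ` M \<subseteq> outer_dom"
    using connected_one_side by blast+
  have zt: "z t \<in> tube ` ball (t, 0) r" using r(1) by (auto simp: tube_0[symmetric])
  have split: "w \<in> tube ` P \<or> w \<in> tube ` M \<or> w \<in> range z" if "w \<in> tube ` ball (t, 0) r" for w
  proof -
    obtain x where x: "x \<in> ball (t, 0) r" "w = tube x" using \<open>w \<in> _\<close> by blast
    consider "snd x > 0" | "snd x < 0" | "x = (fst x, 0)" by (metis linorder_neqE prod.collapse)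
    then show ?thesis
    proof cases
      case 3
      then have "w = z (fst x)" using x(2) tube_0 by metis
      then show ?thesis by blast
    qed (use x in \<open>auto simp: P_def M_def\<close>)
  qed
  have "z t \<in> closure inner_dom" "z t \<in> closure outer_dom"
    using frontier_inner frontier_outer by (auto simp: frontier_def)
  then obtain w1 w2 where w: "w1 \<in> inner_dom" "w1 \<in> tube ` ball (t, 0) r" "w2 \<in> outer_dom" "w2 \<in> tube ` ball (t, 0) r"
    using op zt by (metis (no_types) closure_iff_nhds_not_empty disjoint_iff order_refl)
  have "w1 \<notin> range z" "w2 \<notin> range z" using w inner_Un_outer by blast+
  then have "w1 \<in> tube ` P \<or> w1 \<in> tube ` M" "w2 \<in> tube ` P \<or> w2 \<in> tube ` M"
    using split w by blast+
  then have "tube ` P \<subseteq> outer_dom \<and> tube ` M \<subseteq> inner_dom \<or> tube ` P \<subseteq> inner_dom \<and> tube ` M \<subseteq> outer_dom"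
    using P M w inner_Int_outer by blast
  then have "sided 1 t r \<or> sided (-1) t r"
    using r(1,2) unfolding sided_def P_def M_def by auto
  then show ?thesis by blast
qed

text \<open>The version of \<open>sided\<close> on a single normal geodesic. At most one sign
  satisfies it, and \<open>sided\<close> at \<open>t\<close> gives it for all nearby parameters, so
  the parameters with a given sign form an open set.\<close>

definition sided_at :: "real \<Rightarrow> real \<Rightarrow> bool" where
  "sided_at \<epsilon> t \<longleftrightarrow> (\<forall>\<^sub>F e in at_right 0. tube (t, \<epsilon> * e) \<in> outer_dom \<and> tube (t, - (\<epsilon> * e)) \<in> inner_dom)"

lemma sided_imp_near:
  assumes "sided \<epsilon> t r" "\<epsilon> = 1 \<or> \<epsilon> = -1" "\<bar>s - t\<bar> < r" shows "sided_at \<epsilon> s"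
proof -
  have eps: "\<epsilon> * \<epsilon> = 1" "\<bar>\<epsilon>\<bar> = 1" using assms(2) by auto
  have d: "r - \<bar>s - t\<bar> > 0" using assms(3) by simp
  have "tube (s, \<epsilon> * e) \<in> outer_dom \<and> tube (s, - (\<epsilon> * e)) \<in> inner_dom" if "e > 0" "e < r - \<bar>s - t\<bar>" for e
  proof -
    have "dist (t, 0) (s, c) < r" if "\<bar>c\<bar> = e" for c
    proof -
      have "dist (t, 0) (s, c) \<le> \<bar>s - t\<bar> + \<bar>c\<bar>"
        using sqrt_sum_squares_le_sum_abs[of "dist t s" "dist 0 c"]
        by (simp add: dist_Pair_Pair dist_real_def abs_minus_commute)
      then show ?thesis using that \<open>e < _\<close> by simp
    qed
    then have "(s, \<epsilon> * e) \<in> ball (t, 0) r" "(s, - (\<epsilon> * e)) \<in> ball (t, 0) r"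
      using eps that by (auto simp: abs_mult)
    moreover have "\<epsilon> * snd (s, \<epsilon> * e) > 0" "\<epsilon> * snd (s, - (\<epsilon> * e)) < 0"
      using eps(1) that by (simp_all flip: mult.assoc)
    ultimately show ?thesis using assms(1) unfolding sided_def by blast
  qed
  then show ?thesis unfolding sided_at_def eventually_at_right_field using d
    by (intro exI[of _ "r - \<bar>s - t\<bar>"]) auto
qed

lemma sided_at_unique: "sided_at 1 t \<Longrightarrow> sided_at (-1) t \<Longrightarrow> False"
proof -
  assume "sided_at 1 t" "sided_at (-1) t"
  then have "\<forall>\<^sub>F e in at_right (0::real). tube (t, e) \<in> outer_dom \<and> tube (t, e) \<in> inner_dom"
    unfolding sided_at_def by eventually_elim auto
  then have "\<forall>\<^sub>F e in at_right (0::real). False"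
    by eventually_elim (use inner_Int_outer in blast)
  then show False by simp
qed

text \<open>The parameters of either sign form two disjoint open sets covering the connected real
  line, so one of them is empty.\<close>

lemma sided_global: "\<exists>\<epsilon>. (\<epsilon> = 1 \<or> \<epsilon> = -1) \<and> (\<forall>t. \<exists>r. sided \<epsilon> t r)"
proof -
  have op: "open {t. sided_at \<epsilon> t}" if e: "\<epsilon> = 1 \<or> \<epsilon> = -1" for \<epsilon>
    unfolding open_dist
  proof safe
    fix t assume t: "sided_at \<epsilon> t"
    obtain r \<epsilon>' where r: "sided \<epsilon>' t r" "\<epsilon>' = 1 \<or> \<epsilon>' = -1" using sided_exists by blast
    then have "sided_at \<epsilon>' t" by (intro sided_imp_near) (auto simp: sided_def)
    then have "\<epsilon>' = \<epsilon>" using sided_at_unique t e r(2) by blast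
    then show "\<exists>e>0. \<forall>y. dist y t < e \<longrightarrow> y \<in> {t. sided_at \<epsilon> t}"
      using r sided_imp_near[of \<epsilon> t r] by (intro exI[of _ r]) (auto simp: sided_def dist_real_def)
  qed
  have all: "sided_at 1 t \<or> sided_at (-1) t" for t
  proof -
    obtain r \<epsilon>' where r: "sided \<epsilon>' t r" "\<epsilon>' = 1 \<or> \<epsilon>' = -1" using sided_exists by blast
    then have "sided_at \<epsilon>' t" by (intro sided_imp_near) (auto simp: sided_def)
    then show ?thesis using r by auto
  qed
  have "{t. sided_at 1 t} \<inter> UNIV = {} \<or> {t. sided_at (-1) t} \<inter> UNIV = {}"
    using all sided_at_unique by (intro connectedD[OF connected_UNIV op op]) auto
  then obtain \<epsilon> where e: "\<epsilon> = 1 \<or> \<epsilon> = -1" "\<And>t. sided_at \<epsilon> t" using all by fastforce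
  have "\<exists>r. sided \<epsilon> t r" for t
  proof -
    obtain r \<epsilon>' where r: "sided \<epsilon>' t r" "\<epsilon>' = 1 \<or> \<epsilon>' = -1" using sided_exists by blast
    then have "sided_at \<epsilon>' t" by (intro sided_imp_near) (auto simp: sided_def)
    then have "\<epsilon>' = \<epsilon>" using sided_at_unique e r(2) by blast
    then show ?thesis using r by blast
  qed
  then show ?thesis using e by blast
qed

definition orient :: real where
  "orient = (SOME \<epsilon>. (\<epsilon> = 1 \<or> \<epsilon> = -1) \<and> (\<forall>t. \<exists>r. sided \<epsilon> t r))"

lemma orient: "orient = 1 \<or> orient = -1" "\<exists>r. sided orient t r"
  using someI_ex[OF sided_global] unfolding orient_def by blast+

lemma orient_sq [simp]: "orient * orient = 1" "orient * (orient * x) = x"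
  using orient(1) by auto

definition N :: "real \<Rightarrow> real^3" where
  "N t = orient *\<^sub>R nrm t"

lemma mink_N [simp]: "mink (N t) (N t) = 1" "mink (N t) (\<gamma> t) = 0" "mink (N t) (T t) = 0"
  "mink (\<gamma> t) (N t) = 0" "mink (T t) (N t) = 0"
  using mink_nrm[of t] by (simp_all add: N_def mink_simps mink_commute[of "\<gamma> t" "nrm t"]
      mink_commute[of "T t" "nrm t"])

sublocale frame: mink_frame "\<gamma> t" "T t" "N t" for t
  by unfold_locales (simp_all add: mink_gamma)

lemma hyp_geodesic_N: "proj (hyp_geodesic (\<gamma> s) (N s) e) = tube (s, orient * e)"
  using orient(1) by (auto simp: tube_def N_def hyp_geodesic_def)

lemma hyp_geodesic_N_in: "hyp_geodesic (\<gamma> s) (N s) e \<in> hyp_plane"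
  by (intro hyp_geodesic_in gamma_in) simp_all

lemma N_outward: "is_outward_unit_normal \<gamma> t (N t)"
proof -
  obtain r where "sided orient t r" using orient(2) by blast
  then have "sided_at orient t" using orient(1) by (intro sided_imp_near) (auto simp: sided_def)
  then have "\<forall>\<^sub>F e in at_right 0. hyp_geodesic (\<gamma> t) (N t) e \<notin> enclosed_region \<gamma> \<and>
        hyp_geodesic (\<gamma> t) (N t) (- e) \<in> enclosed_region \<gamma>"
    unfolding sided_at_def
    by eventually_elim
      (use inner_Int_outer hyp_geodesic_N_in in \<open>auto simp: region_eq hyp_geodesic_N\<close>)
  then show ?thesis
    unfolding is_outward_unit_normal_def by (simp add: vel_eq mink_simps)
qed

lemma outward_eq: "outward_unit_normal \<gamma> = N"
  unfolding outward_unit_normal_def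
  using N_outward is_outward_unit_normal_unique[OF curve] by (intro ext the_equality) blast+

text \<open>The tube covers a neighbourhood of \<open>z t\<close>, and a point at positive outward
  distance would lie in the outer domain, which misses the closed region.\<close>

lemma outward_tube:
  assumes "d > 0"
  obtains W where "open W" "z t \<in> W"
    "\<And>w. w \<in> W \<Longrightarrow> w \<in> closure inner_dom \<Longrightarrow>
       \<exists>s e. \<bar>s - t\<bar> < d \<and> e \<le> 0 \<and> w = proj (hyp_geodesic (\<gamma> s) (N s) e)"
proof -
  obtain r where r: "sided orient t r" using orient(2) by blast
  define B where "B = ball (t, 0 :: real) (min r d)"
  have B: "B \<subseteq> ball (t, 0) r" unfolding B_def by auto
  have "open (tube ` B)"
  proof (rule invariance_of_domain_gen)
    show "inj_on tube B" using r B unfolding sided_def by (blast intro: inj_on_subset)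
  qed (auto simp: B_def cont_tube)
  moreover have "z t \<in> tube ` B"
    using r assms by (auto simp: B_def sided_def tube_0[symmetric])
  moreover have "\<exists>s e. \<bar>s - t\<bar> < d \<and> e \<le> 0 \<and> w = proj (hyp_geodesic (\<gamma> s) (N s) e)"
    if w: "w \<in> tube ` B" "w \<in> closure inner_dom" for w
  proof -
    obtain s c where sc: "(s, c) \<in> B" "w = tube (s, c)" using w(1) by force
    have "\<not> orient * c > 0"
      using sc B r w(2) outer_iff unfolding sided_def by fastforce
    moreover have "\<bar>s - t\<bar> < d"
    proof -
      have "dist t s \<le> dist (t, 0) (s, c)" using dist_fst_le[of "(t, 0)" "(s, c)"] by simp
      then show ?thesis using sc(1) by (simp add: B_def dist_real_def abs_minus_commute)
    qed
    moreover have "w = proj (hyp_geodesic (\<gamma> s) (N s) (orient * c))"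
      using sc(2) by (simp add: hyp_geodesic_N)
    ultimately show ?thesis by (intro exI[of _ s] exI[of _ "orient * c"]) auto
  qed
  ultimately show ?thesis by (rule that)
qed

end

section \<open>Frenet equations\<close>

lemma mink_constant_derivative:
  assumes "(f has_vector_derivative f') (at t)" "(g has_vector_derivative g') (at t)"
    and "\<And>t. mink (f t) (g t) = c"
  shows "mink f' (g t) = - mink (f t) g'"
proof -
  have "((\<lambda>t. c) has_real_derivative mink (f t) g' + mink f' (g t)) (at t)"
    using has_real_derivative_mink[OF assms(1,2)] assms(3) by simp
  from DERIV_unique[OF this DERIV_const] show ?thesis by simp
qed

context hyp_curve
begin

abbreviation "k \<equiv> geodesic_curvature \<gamma>"

lemma D_N_aux: "(N has_vector_derivative orient *\<^sub>R lcross (\<gamma> t) (T' t)) (at t)"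
  unfolding N_def[abs_def]
  using has_vector_derivative_scaleR[OF DERIV_const[of orient] D_nrm] by simp

lemma k_eq: "k t = mink (orient *\<^sub>R lcross (\<gamma> t) (T' t)) (T t) / \<sigma> t"
proof -
  \<comment> \<open>The projection in \<open>cov_deriv\<close> only adds a multiple of
    \<open>\<gamma> t\<close>, which is orthogonal to the tangent.\<close>
  have "k t = mink (arc_deriv \<gamma> N t) (T t)"
    unfolding geodesic_curvature_def outward_eq by (rule mink_cov_deriv) simp
  then show ?thesis
    by (simp add: arc_deriv_def velocity_eqI[OF D_N_aux] mink_simps divide_inverse_commute)
qed

lemma cont_k: "continuous_on S k"
  unfolding k_eq[abs_def]
  by (intro continuous_intros mink.continuous_on lcross.continuous_on cont_gamma cont_T cont_T' cont_speed)
    simp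

lemma D_N: "(N has_vector_derivative (\<sigma> t * k t) *\<^sub>R T t) (at t)"
proof -
  let ?N' = "orient *\<^sub>R lcross (\<gamma> t) (T' t)"
  have "mink ?N' (\<gamma> t) = 0"
    using mink_constant_derivative[OF D_N_aux D_gamma, of 0 t] by (simp add: vel_eq mink_simps)
  moreover have "mink ?N' (N t) = 0"
    using mink_constant_derivative[OF D_N_aux D_N_aux, of 1 t] mink_commute[of ?N' "N t"] by simp
  moreover have "mink ?N' (T t) = \<sigma> t * k t"
    by (simp add: k_eq)
  ultimately have "?N' = (\<sigma> t * k t) *\<^sub>R T t"
    by (subst frame.expand[of ?N' t]) simp
  then show ?thesis using D_N_aux by metis
qed

text \<open>The components come from differentiating constant products of the frame. The term along
  \<open>\<gamma> t\<close> is the bending of the hyperboloid; the sign at \<open>N t\<close> makes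
  curvature positive when the tangent turns inwards.\<close>

lemma D_T_frenet: "(T has_vector_derivative \<sigma> t *\<^sub>R \<gamma> t - (\<sigma> t * k t) *\<^sub>R N t) (at t)"
proof -
  have "mink (T' t) (\<gamma> t) = - \<sigma> t"
    using mink_constant_derivative[OF D_T D_gamma, of 0 t] by (simp add: vel_eq mink_simps)
  moreover have "mink (T' t) (T t) = 0"
    using mink_constant_derivative[OF D_T D_T, of 1 t] mink_commute[of "T' t" "T t"] by simp
  moreover have "mink (T' t) (N t) = - (\<sigma> t * k t)"
    using mink_constant_derivative[OF D_T D_N, of 0 t] by (simp add: mink_simps)
  ultimately have "T' t = \<sigma> t *\<^sub>R \<gamma> t - (\<sigma> t * k t) *\<^sub>R N t"
    by (subst frame.expand[of "T' t" t]) simp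
  then show ?thesis using D_T by metis
qed

lemma D_gamma_T: "(\<gamma> has_vector_derivative \<sigma> t *\<^sub>R T t) (at t)"
  using D_gamma[of t] by (simp add: vel_eq)

lemma cont_N: "continuous_on S N"
  using D_N by (intro continuous_at_imp_continuous_on ballI has_vector_derivative_continuous)

lemma mink_const_vector_derivatives:
  shows "((\<lambda>t. mink y (\<gamma> t)) has_real_derivative \<sigma> t * mink y (T t)) (at t)"
    and "((\<lambda>t. mink y (T t)) has_real_derivative \<sigma> t * (mink y (\<gamma> t) - k t * mink y (N t))) (at t)"
    and "((\<lambda>t. mink y (N t)) has_real_derivative \<sigma> t * k t * mink y (T t)) (at t)"
  using has_real_derivative_mink[OF has_vector_derivative_const D_gamma_T, of y t]
    has_real_derivative_mink[OF has_vector_derivative_const D_T_frenet, of y t]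
    has_real_derivative_mink[OF has_vector_derivative_const D_N, of y t]
  by (simp_all add: mink_simps algebra_simps)

lemma curvature_vector: "spacelike_curvature_vector \<gamma> t = \<gamma> t - k t *\<^sub>R N t"
  by (simp add: spacelike_curvature_vector_def arc_deriv_def velocity_eqI[OF D_T_frenet] algebra_simps)

lemma mink_curvature_vector:
  "mink (spacelike_curvature_vector \<gamma> t) (spacelike_curvature_vector \<gamma> t) = (k t)\<^sup>2 - 1"
  "mink (T t) (spacelike_curvature_vector \<gamma> t) = 0"
  "mink (spacelike_curvature_vector \<gamma> t) (T t) = 0"
  by (simp_all add: curvature_vector mink_simps mink_gamma power2_eq_square)

lemma spacelike_curvature_eq: "spacelike_curvature \<gamma> t = horo_curvature \<gamma> t"
  by (simp add: spacelike_curvature_def mink_curvature_vector horo_curvature_def)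

end

locale horoconvex_curve = hyp_curve +
  assumes horo: "strictly_horoconvex \<gamma>"
begin

lemma k_gt: "k t > 1"
  using horo by (simp add: strictly_horoconvex_def)

lemma k_sq: "(k t)\<^sup>2 > 1"
  using power_strict_mono[OF k_gt[of t], of 2] by simp

text \<open>The tangent and the curvature vector are orthogonal with squares 1 and
  \<open>(k t)\<^sup>2 - 1\<close>, which is positive by horoconvexity.\<close>

lemma strong_spacelike: "strong_spacelike \<gamma>"
  unfolding strong_spacelike_def
proof
  fix t
  define \<kappa> where "\<kappa> = spacelike_curvature_vector \<gamma> t"
  have \<kappa>: "mink \<kappa> \<kappa> > 0" "mink (T t) \<kappa> = 0" "mink \<kappa> (T t) = 0"
    using k_sq[of t] by (simp_all add: \<kappa>_def mink_curvature_vector)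
  have mem: "\<exists>a b. w = a *\<^sub>R T t + b *\<^sub>R \<kappa>" if "w \<in> span {T t, \<kappa>}" for w
    using that by (auto simp: span_insert span_singleton algebra_simps)
  have \<kappa>0: "\<kappa> \<noteq> 0" using \<kappa>(1) by (auto simp: mink_simps)
  have notin: "T t \<notin> span {\<kappa>}"
  proof
    assume "T t \<in> span {\<kappa>}"
    then obtain c where "T t = c *\<^sub>R \<kappa>" by (auto simp: span_singleton)
    then have "mink (T t) (T t) = c * mink \<kappa> (T t)" by (metis mink.scaleR_left real_scaleR_def)
    then show False using \<kappa> by simp
  qed
  then have ne: "T t \<noteq> \<kappa>" using span_base by blast
  have "independent {T t, \<kappa>}"
    using notin \<kappa>0 ne by (simp add: independent_insert)
  from dim_span_eq_card_independent[OF this] have "dim (span {T t, \<kappa>}) = 2"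
    using ne by simp
  moreover have "mink w w > 0" if w: "w \<in> span {T t, \<kappa>}" "w \<noteq> 0" for w
  proof -
    obtain a b where ab: "w = a *\<^sub>R T t + b *\<^sub>R \<kappa>" using mem w(1) by blast
    then have eq: "mink w w = a\<^sup>2 + b\<^sup>2 * mink \<kappa> \<kappa>"
      using \<kappa> by (simp add: mink_simps power2_eq_square)
    have "a \<noteq> 0 \<or> b \<noteq> 0" using ab w(2) by auto
    then show ?thesis unfolding eq using \<kappa>(1)
      by (auto intro: add_pos_nonneg add_nonneg_pos)
  qed
  ultimately show "spacelike_plane (span {T t, spacelike_curvature_vector \<gamma> t})"
    unfolding spacelike_plane_def \<kappa>_def by auto
qed

section \<open>Convexity of the enclosed region\<close>

text \<open>Local convexity: near \<open>t\<close> the curve stays on the inner side of its tangent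
  geodesics. As a function of \<open>s\<close>, \<open>mink (\<gamma> r) (T s)\<close> decreases
  because its derivative is \<open>- \<sigma> s * F (r, s)\<close>, and it vanishes at
  \<open>s = r\<close>. So \<open>mink (\<gamma> r) (N s)\<close>, whose derivative is a positive
  multiple of it, has its maximum 0 at \<open>s = r\<close>. Both \<open>F\<close> and
  \<open>G\<close> equal 1 at \<open>(t, t)\<close>.\<close>

lemma local_support:
  obtains d where "d > 0"
    "\<And>r s. \<bar>r - t\<bar> < d \<Longrightarrow> \<bar>s - t\<bar> < d \<Longrightarrow> mink (\<gamma> r) (N s) \<le> 0 \<and> mink (N r) (N s) > 0"
proof -
  define F where "F x = k (snd x) * mink (\<gamma> (fst x)) (N (snd x)) - mink (\<gamma> (fst x)) (\<gamma> (snd x))" for x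
  define G where "G x = mink (N (fst x)) (N (snd x))" for x
  have "continuous_on UNIV F" "continuous_on UNIV G"
    unfolding F_def G_def
    by (intro continuous_intros mink.continuous_on continuous_on_compose2[OF cont_k[of UNIV]]
        continuous_on_compose2[OF cont_gamma[of UNIV]] continuous_on_compose2[OF cont_N[of UNIV]]; simp)+
  then have "open {x. 0 < F x}" "open {x. 0 < G x}"
    by (auto intro!: open_Collect_less continuous_intros)
  moreover have "0 < F (t, t)" "0 < G (t, t)"
    by (simp_all add: F_def G_def mink_gamma)
  ultimately obtain e where e: "e > 0" "ball (t, t) e \<subseteq> {x. 0 < F x} \<inter> {x. 0 < G x}"
    by (metis (no_types, lifting) IntI open_Int openE mem_Collect_eq)
  define d where "d = e / 2"
  have box: "0 < F (r, s)" "0 < G (r, s)" if "\<bar>r - t\<bar> < d" "\<bar>s - t\<bar> < d" for r s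
  proof -
    have "dist (t, t) (r, s) \<le> \<bar>r - t\<bar> + \<bar>s - t\<bar>"
      using sqrt_sum_squares_le_sum_abs[of "dist t r" "dist t s"]
      by (simp add: dist_Pair_Pair dist_real_def abs_minus_commute)
    then have "(r, s) \<in> ball (t, t) e" using that by (simp add: d_def)
    then show "0 < F (r, s)" "0 < G (r, s)" using e(2) by auto
  qed
  have main: "mink (\<gamma> r) (N s) \<le> 0" if rs: "\<bar>r - t\<bar> < d" "\<bar>s - t\<bar> < d" for r s
  proof -
    let ?h = "\<lambda>s. mink (\<gamma> r) (T s)" and ?g = "\<lambda>s. mink (\<gamma> r) (N s)"
    have dh: "\<sigma> u * (mink (\<gamma> r) (\<gamma> u) - k u * mink (\<gamma> r) (N u)) \<le> 0" if "\<bar>u - t\<bar> < d" for u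
      using box(1)[OF rs(1) that] speed_pos[of u]
      by (intro mult_nonneg_nonpos) (auto simp: F_def)
    have mono: "?h b \<le> ?h a" if "a \<le> b" "\<bar>a - t\<bar> < d" "\<bar>b - t\<bar> < d" for a b
    proof (rule DERIV_nonpos_imp_nonincreasing[OF that(1)])
      fix u assume "a \<le> u" "u \<le> b"
      then have "\<bar>u - t\<bar> < d" using that by linarith
      then show "\<exists>y. (?h has_real_derivative y) (at u) \<and> y \<le> 0"
        using mink_const_vector_derivatives(2) dh by blast
    qed
    have ku: "k u > 0" for u using k_gt[of u] by simp
    show ?thesis
    proof (cases "r \<le> s")
      case True
      have "?g s \<le> ?g r"
      proof (rule DERIV_nonpos_imp_nonincreasing[OF True])
        fix u assume u: "r \<le> u" "u \<le> s"
        then have "\<bar>u - t\<bar> < d" using rs by linarith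
        then have "?h u \<le> 0" using mono[of r u] u rs by simp
        then have "\<sigma> u * k u * ?h u \<le> 0" using speed_pos[of u] ku[of u]
          by (intro mult_nonneg_nonpos) auto
        then show "\<exists>y. (?g has_real_derivative y) (at u) \<and> y \<le> 0"
          using mink_const_vector_derivatives(3) by blast
      qed
      then show ?thesis by simp
    next
      case False
      then have "s \<le> r" by simp
      then have "?g s \<le> ?g r"
      proof (rule DERIV_nonneg_imp_nondecreasing)
        fix u assume u: "s \<le> u" "u \<le> r"
        then have "\<bar>u - t\<bar> < d" using rs by linarith
        then have "?h u \<ge> 0" using mono[of u r] u rs by simp
        then have "\<sigma> u * k u * ?h u \<ge> 0" using speed_pos[of u] ku[of u] by simp
        then show "\<exists>y. (?g has_real_derivative y) (at u) \<and> 0 \<le> y"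
          using mink_const_vector_derivatives(3) by blast
      qed
      then show ?thesis by simp
    qed
  qed
  show ?thesis
    by (rule that[of d]) (use e main box in \<open>auto simp: d_def G_def\<close>)
qed

text \<open>A nearby point of the closed region is
  \<open>cosh e *\<^sub>R \<gamma> r + sinh e *\<^sub>R N r\<close> with \<open>e \<le> 0\<close>;
  both terms pair nonpositively with \<open>N s\<close>, the second because
  \<open>mink (N r) (N s) > 0\<close>.\<close>

lemma closure_local_support:
  obtains d W where "d > 0" "open W" "z t \<in> W"
    "\<And>y s. y \<in> hyp_plane \<Longrightarrow> proj y \<in> W \<Longrightarrow> proj y \<in> closure inner_dom \<Longrightarrow> \<bar>s - t\<bar> < d \<Longrightarrow> mink y (N s) \<le> 0"
proof -
  obtain d where d: "d > 0"
    "\<And>r s. \<bar>r - t\<bar> < d \<Longrightarrow> \<bar>s - t\<bar> < d \<Longrightarrow> mink (\<gamma> r) (N s) \<le> 0 \<and> mink (N r) (N s) > 0"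
    by (rule local_support[of t]) blast
  obtain W where W: "open W" "z t \<in> W"
    "\<And>w. w \<in> W \<Longrightarrow> w \<in> closure inner_dom \<Longrightarrow>
       \<exists>s e. \<bar>s - t\<bar> < d \<and> e \<le> 0 \<and> w = proj (hyp_geodesic (\<gamma> s) (N s) e)"
    by (rule outward_tube[OF d(1), of t]) blast
  have "mink y (N s) \<le> 0"
    if y: "y \<in> hyp_plane" "proj y \<in> W" "proj y \<in> closure inner_dom" and s: "\<bar>s - t\<bar> < d" for y s
  proof -
    obtain r e where r: "\<bar>r - t\<bar> < d" "e \<le> 0" "proj y = proj (hyp_geodesic (\<gamma> r) (N r) e)"
      using W(3)[OF y(2,3)] by blast
    then have "y = hyp_geodesic (\<gamma> r) (N r) e"
      using y(1) hyp_geodesic_N_in inj_on_proj by (auto dest: inj_onD)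
    then have "mink y (N s) = cosh e * mink (\<gamma> r) (N s) + sinh e * mink (N r) (N s)"
      by (simp add: hyp_geodesic_def mink_simps)
    also have "\<dots> \<le> 0"
      using d(2)[OF r(1) s] r(2)
      by (intro add_nonpos_nonpos mult_nonneg_nonpos mult_nonpos_nonneg) auto
    finally show ?thesis .
  qed
  with d(1) W(1,2) show ?thesis by (rule that)
qed

text \<open>The function \<open>\<lambda>s. mink y (N s)\<close> has a local maximum at
  \<open>t\<close>, and its derivative there is a positive multiple of
  \<open>mink y (T t)\<close>.\<close>

lemma support_critical:
  assumes "d > 0" "\<And>s. \<bar>s - t\<bar> < d \<Longrightarrow> mink y (N s) \<le> 0" "mink y (N t) = 0"
  shows "mink y (T t) = 0"
proof -
  have "\<sigma> t * k t * mink y (T t) = 0"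
    by (rule DERIV_local_max[OF mink_const_vector_derivatives(3) assms(1)])
      (use assms in \<open>auto simp: abs_minus_commute\<close>)
  then show ?thesis using k_gt[of t] by simp
qed

text \<open>In the frame at \<open>t\<close> such a point is a multiple of
  \<open>\<gamma> t\<close>, and the hyperboloid equation with the choice of sheet fixes the
  factor.\<close>

lemma orthogonal_eq_gamma:
  assumes "p \<in> hyp_plane" "mink p (T t) = 0" "mink p (N t) = 0" shows "p = \<gamma> t"
proof -
  have "p = - mink p (\<gamma> t) *\<^sub>R \<gamma> t" using frame.expand[of p t] assms by simp
  then have "mink p p = - (mink p (\<gamma> t))\<^sup>2"
    by (metis assms frame.mink_expand add.right_neutral mult_zero_left power2_eq_square)
  then have "(mink p (\<gamma> t))\<^sup>2 = 1" using assms(1) by (simp add: hyp_planeD)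
  then have "mink p (\<gamma> t) = -1" using mink_hyp_plane_le(1)[OF assms(1) gamma_in[of t]]
    by (auto simp: power2_eq_1_iff)
  then show ?thesis using mink_hyp_plane_le(2)[OF assms(1) gamma_in] by blast
qed

lemma not_inner_gamma: "proj p \<in> inner_dom \<Longrightarrow> p \<noteq> \<gamma> t"
  using inner_Un_outer by blast

section \<open>Tietze's argument with geodesic chords\<close>

definition chord :: "real^3 \<Rightarrow> real^3 \<Rightarrow> real \<Rightarrow> complex" where
  "chord p q l = proj (hyp_normalize (seg p q l))"

lemma cont_chord:
  assumes p: "p \<in> hyp_plane"
  shows "continuous_on ({0..1} \<times> UNIV) (\<lambda>x. chord p (lift (snd x)) (fst x))"
proof -
  have "continuous_on ({0..1} \<times> UNIV) (\<lambda>x. seg p (lift (snd x)) (fst x))"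
    unfolding seg_def by (intro continuous_intros continuous_on_lift_comp)
  then show ?thesis
    unfolding chord_def hyp_normalize_def
    by (intro continuous_on_proj continuous_intros mink.continuous_on)
      (use seg_timelike(1)[OF p lift_in] in \<open>auto simp: less_imp_neq\<close>)
qed

lemma cont_chord_param:
  assumes "p \<in> hyp_plane" "q \<in> hyp_plane"
  shows "continuous_on {0..1} (chord p q)"
proof -
  have "continuous_on {0..1} ((\<lambda>x. chord p (lift (snd x)) (fst x)) \<circ> (\<lambda>l. (l, proj q)))"
    by (intro continuous_on_compose continuous_intros continuous_on_subset[OF cont_chord[OF assms(1)]]) auto
  then show ?thesis by (simp add: o_def lift_proj assms(2))
qed

text \<open>Normalizing divides by a positive number, so a sign condition on the geodesic becomes an
  affine inequality in \<open>l\<close>.\<close>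

lemma chord_support:
  assumes pq: "p \<in> hyp_plane" "q \<in> hyp_plane" "0 \<le> l" "l \<le> 1"
    and le: "mink (hyp_normalize (seg p q l)) n \<le> 0"
  shows "(1 - l) * mink p n + l * mink q n \<le> 0"
proof -
  obtain r where "r > 0" "seg p q l = r *\<^sub>R hyp_normalize (seg p q l)"
    using hyp_normalize_eqD[OF seg_timelike(1)[OF pq] refl] by metis
  then have "mink (seg p q l) n \<le> 0"
    using le by (metis less_imp_le mink.scaleR_left mult_nonneg_nonpos real_scaleR_def)
  then show ?thesis by (simp add: seg_def mink_simps)
qed

text \<open>A touching chord would have to lie on the tangent geodesic at the contact point
  \<open>\<gamma> t\<close>. Its points near the contact would then be critical zeros as well, and
  this forces the inner endpoint \<open>p\<close> to be \<open>\<gamma> t\<close>.\<close>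

lemma chord_not_touching:
  assumes p: "p \<in> hyp_plane" "proj p \<in> inner_dom" and q: "q \<in> hyp_plane"
    and cl: "\<And>l. 0 \<le> l \<Longrightarrow> l \<le> 1 \<Longrightarrow> chord p q l \<in> closure inner_dom"
    and l: "0 < l" "l < 1"
  shows "chord p q l \<notin> range z"
proof
  assume "chord p q l \<in> range z"
  then obtain t where t: "chord p q l = z t" by blast
  then have nt: "hyp_normalize (seg p q l) = \<gamma> t"
    using seg_in[OF p(1) q, of l] l gamma_in[of t] inj_on_proj unfolding chord_def by (auto dest: inj_onD)
  obtain \<mu> where mu: "\<mu> > 0" "seg p q l = \<mu> *\<^sub>R \<gamma> t"
    using hyp_normalize_eqD[OF seg_timelike(1)[OF p(1) q, of l] nt] l by auto
  obtain d W where W: "d > 0" "open W" "z t \<in> W"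
    "\<And>y s. y \<in> hyp_plane \<Longrightarrow> proj y \<in> W \<Longrightarrow> proj y \<in> closure inner_dom \<Longrightarrow> \<bar>s - t\<bar> < d \<Longrightarrow> mink y (N s) \<le> 0"
    by (rule closure_local_support[of t]) blast
  have "isCont (chord p q) l"
    using continuous_on_subset[OF cont_chord_param[OF p(1) q], of "{0<..<1}"] l
    by (force simp: continuous_on_eq_continuous_at greaterThanLessThan_subseteq_atLeastAtMost_iff)
  then have "\<forall>\<^sub>F x in nhds l. chord p q x \<in> W"
    using W(2,3) t unfolding isCont_def tendsto_def eventually_nhds_conv_at by auto
  moreover have "\<forall>\<^sub>F x in nhds l. x \<in> {0<..<1}"
    using l by (intro eventually_nhds_in_open) auto
  ultimately have "\<forall>\<^sub>F x in nhds l. x \<in> {0<..<1} \<and> chord p q x \<in> W"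
    by eventually_elim simp
  then obtain \<eta> where eta: "\<eta> > 0" "\<And>x. dist x l < \<eta> \<Longrightarrow> x \<in> {0<..<1} \<and> chord p q x \<in> W"
    unfolding eventually_nhds_metric by blast
  have sup: "(1 - x) * mink p (N s) + x * mink q (N s) \<le> 0" if "dist x l < \<eta>" "\<bar>s - t\<bar> < d" for x s
  proof (rule chord_support[OF p(1) q])
    show x: "0 \<le> x" "x \<le> 1" using eta(2)[OF that(1)] by auto
    show "mink (hyp_normalize (seg p q x)) (N s) \<le> 0"
      using W(4)[OF seg_in[OF p(1) q x]] eta(2)[OF that(1)] cl[OF x] that(2)
      unfolding chord_def by blast
  qed
  let ?A = "mink p (N t)" and ?B = "mink q (N t)"
  define h where "h = \<eta> / 2"
  have h: "h > 0" "dist (l + h) l < \<eta>" "dist (l - h) l < \<eta>"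
    using eta(1) by (simp_all add: h_def dist_real_def)
  have 0: "(1 - l) * ?A + l * ?B = 0"
    using arg_cong[OF mu(2), of "\<lambda>y. mink y (N t)"] by (simp add: seg_def mink_simps)
  \<comment> \<open>An affine function that vanishes at \<open>l\<close> and is nonpositive on both
    sides of it is constant.\<close>
  have "(1 - (l + h)) * ?A + (l + h) * ?B \<le> 0" "(1 - (l - h)) * ?A + (l - h) * ?B \<le> 0"
    using sup h W(1) by (metis abs_zero diff_self)+
  then have "h * (?B - ?A) \<le> 0" "h * (?A - ?B) \<le> 0" using 0 by (simp_all add: algebra_simps)
  then have "?A = ?B" using h(1) by (simp add: mult_le_0_iff)
  with 0 have A: "?A = 0" and B: "?B = 0" by (simp_all add: algebra_simps)
  \<comment> \<open>A second critical zero next to the contact point: two zeros of the affine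
    function \<open>\<lambda>x. mink (seg p q x) (T t)\<close> make it vanish at \<open>p\<close>
    too.\<close>
  have "mink (seg p q (l + h)) (T t) = 0"
  proof (rule support_critical[OF W(1)])
    show "mink (seg p q (l + h)) (N s) \<le> 0" if "\<bar>s - t\<bar> < d" for s
      using sup[OF h(2) that] by (simp add: seg_def mink_simps)
  qed (simp add: seg_def mink_simps A B)
  then have 1: "(1 - (l + h)) * mink p (T t) + (l + h) * mink q (T t) = 0"
    by (simp add: seg_def mink_simps)
  have 2: "(1 - l) * mink p (T t) + l * mink q (T t) = 0"
    using arg_cong[OF mu(2), of "\<lambda>y. mink y (T t)"] by (simp add: seg_def mink_simps)
  have "h * (mink q (T t) - mink p (T t)) = ((1 - (l + h)) * mink p (T t) + (l + h) * mink q (T t))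
      - ((1 - l) * mink p (T t) + l * mink q (T t))" by (simp add: algebra_simps)
  then have "h * (mink q (T t) - mink p (T t)) = 0" unfolding 1 2 by simp
  then have "mink q (T t) = mink p (T t)" using h(1) by simp
  then have "mink p (T t) = 0" using 2 by (simp add: algebra_simps)
  with A p show False using orthogonal_eq_gamma not_inner_gamma by blast
qed

lemma chord_ends [simp]: "p \<in> hyp_plane \<Longrightarrow> chord p q 0 = proj p" "q \<in> hyp_plane \<Longrightarrow> chord p q 1 = proj q"
  by (simp_all add: chord_def seg_def hyp_normalize_eq)

text \<open>\<open>S\<close> collects the endpoints whose chord from \<open>p\<close> stays inside.
  It is relatively open by compactness of the parameter interval, relatively closed by
  \<open>chord_not_touching\<close>, and contains \<open>p\<close>; the inner domain is
  connected.\<close>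

lemma inner_dom_convex:
  assumes p: "p \<in> hyp_plane" "proj p \<in> inner_dom" and q: "q \<in> hyp_plane" "proj q \<in> inner_dom"
    and l: "0 \<le> l" "l \<le> 1"
  shows "chord p q l \<in> inner_dom"
proof -
  let ?F = "\<lambda>x. chord p (lift (snd x)) (fst x)"
  define S where "S = {w \<in> inner_dom. \<forall>l\<in>{0..1}. chord p (lift w) l \<in> inner_dom}"
  have S2: "S = {w \<in> inner_dom. \<forall>l\<in>{0..1}. chord p (lift w) l \<in> closure inner_dom}"
  proof (intro set_eqI iffI)
    fix w assume w: "w \<in> {w \<in> inner_dom. \<forall>l\<in>{0..1}. chord p (lift w) l \<in> closure inner_dom}"
    have "chord p (lift w) l \<in> inner_dom" if "l \<in> {0..1}" for l
    proof (cases "l = 0 \<or> l = 1")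
      case True
      then show ?thesis using p w by auto
    next
      case False
      then have "chord p (lift w) l \<notin> range z"
        using that w by (intro chord_not_touching p lift_in) auto
      then show ?thesis using w that by (auto simp: closure_inner)
    qed
    then show "w \<in> S" using w by (simp add: S_def)
  qed (auto simp: S_def intro: closure_subset[THEN subsetD])
  \<comment> \<open>The bad endpoints are a projection along the compact interval of a closed set,
    hence closed; this is where joint continuity in \<open>l\<close> and \<open>w\<close>
    enters.\<close>
  have "closed {w. \<exists>l. l \<in> {0..1} \<and> (l, w) \<in> ({0..1} \<times> UNIV) \<inter> ?F -` (- inner_dom)}"
    by (intro closed_compact_projection continuous_closed_preimage cont_chord p closed_Times)
      (auto simp: open_inner closed_Compl)
  then have "closedin (top_of_set inner_dom) (inner_dom \<inter> {w. \<exists>l. l \<in> {0..1} \<and> (l, w) \<in> ({0..1} \<times> UNIV) \<inter> ?F -` (- inner_dom)})"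
    by (rule closedin_closed_Int)
  moreover have "inner_dom - S = inner_dom \<inter> {w. \<exists>l. l \<in> {0..1} \<and> (l, w) \<in> ({0..1} \<times> UNIV) \<inter> ?F -` (- inner_dom)}"
    by (auto simp: S_def)
  ultimately have "closedin (top_of_set inner_dom) (inner_dom - S)" by simp
  moreover have "S \<subseteq> inner_dom" by (auto simp: S_def)
  ultimately have "openin (top_of_set inner_dom) S" by (simp add: openin_closedin_eq)
  moreover have "closedin (top_of_set inner_dom) S"
  proof -
    have "closed ((\<lambda>w. chord p (lift w) l) -` closure inner_dom)" if "l \<in> {0..1}" for l
    proof (intro closed_vimage)
      have "continuous_on UNIV (?F \<circ> (\<lambda>w. (l, w)))"
        by (intro continuous_on_compose continuous_intros continuous_on_subset[OF cont_chord[OF p(1)]])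
          (use that in auto)
      then show "continuous_on UNIV (\<lambda>w. chord p (lift w) l)" by (simp add: o_def)
    qed simp
    then have "closed (\<Inter>l\<in>{0..1}. (\<lambda>w. chord p (lift w) l) -` closure inner_dom)" by blast
    moreover have "S = inner_dom \<inter> (\<Inter>l\<in>{0..1}. (\<lambda>w. chord p (lift w) l) -` closure inner_dom)"
      unfolding S2 by auto
    ultimately show ?thesis using closedin_closed_Int by metis
  qed
  moreover have "proj p \<in> S"
    using p by (auto simp: S_def chord_def seg_def lift_proj hyp_normalize_eq simp flip: scaleR_left_distrib)
  ultimately have "S = inner_dom" using connected_inner unfolding connected_clopen by blast
  then have "proj q \<in> S" using q by simp
  then show ?thesis using l q by (simp add: S_def lift_proj)
qed

lemma chord_closure:
  assumes p: "p \<in> hyp_plane" "proj p \<in> inner_dom" and q: "q \<in> hyp_plane" "proj q \<in> closure inner_dom"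
    and l: "0 \<le> l" "l \<le> 1"
  shows "chord p q l \<in> closure inner_dom"
proof -
  have "continuous_on (closure inner_dom) ((\<lambda>x. chord p (lift (snd x)) (fst x)) \<circ> (\<lambda>w. (l, w)))"
    by (intro continuous_on_compose continuous_intros continuous_on_subset[OF cont_chord[OF p(1)]])
      (use l in auto)
  then have "(\<lambda>w. chord p (lift w) l) ` closure inner_dom \<subseteq> closure inner_dom"
    using inner_dom_convex[OF p lift_in _ l] closure_subset
    by (intro image_closure_subset) (auto simp: o_def)
  then have "chord p (lift (proj q)) l \<in> closure inner_dom" using q by blast
  then show ?thesis by (simp add: q lift_proj)
qed

text \<open>Convexity makes the local support inequality global: close to its end
  \<open>\<gamma> t\<close>, the chord from \<open>p\<close> lies where the local inequality holds.
  Since \<open>N t\<close> is orthogonal to \<open>\<gamma> t\<close>, the inequality there reads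
  \<open>(1 - l) * mink p (N t) \<le> 0\<close>.\<close>

lemma support_nonpos:
  assumes p: "p \<in> hyp_plane" "proj p \<in> inner_dom"
  shows "mink p (N t) \<le> 0"
proof -
  obtain d W where W: "d > 0" "open W" "z t \<in> W"
    "\<And>y s. y \<in> hyp_plane \<Longrightarrow> proj y \<in> W \<Longrightarrow> proj y \<in> closure inner_dom \<Longrightarrow> \<bar>s - t\<bar> < d \<Longrightarrow> mink y (N s) \<le> 0"
    by (rule closure_local_support[of t]) blast
  have "(chord p (\<gamma> t) \<longlongrightarrow> chord p (\<gamma> t) 1) (at 1 within {0..1})"
    using cont_chord_param[OF p(1) gamma_in[of t]] by (simp add: continuous_on_def)
  then have "\<forall>\<^sub>F l in at 1 within {0..1}. chord p (\<gamma> t) l \<in> W"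
    using W(2,3) gamma_in[of t] by (simp add: tendsto_def)
  moreover have "\<forall>\<^sub>F l in at 1 within {0..1::real}. l \<in> {0..1} \<and> l \<noteq> 1"
    by (simp add: eventually_at_filter)
  ultimately have "\<forall>\<^sub>F l in at 1 within {0..1::real}. chord p (\<gamma> t) l \<in> W \<and> l \<in> {0..1} \<and> l \<noteq> 1"
    by eventually_elim simp
  moreover have "at 1 within {0..1::real} \<noteq> bot" by (simp add: at_within_Icc_at_left)
  ultimately obtain l where l: "chord p (\<gamma> t) l \<in> W" "0 \<le> l" "l \<le> 1" "l \<noteq> 1"
    using eventually_happens' by force
  have "z t \<in> closure inner_dom" by (auto simp: closure_inner)
  then have "chord p (\<gamma> t) l \<in> closure inner_dom" using l gamma_in by (intro chord_closure p) auto
  then have "mink (hyp_normalize (seg p (\<gamma> t) l)) (N t) \<le> 0"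
    using W(1) l unfolding chord_def by (intro W(4) seg_in p gamma_in) auto
  from chord_support[OF p(1) gamma_in l(2,3) this]
  have "(1 - l) * mink p (N t) \<le> 0" by simp
  then show ?thesis using l by (simp add: mult_le_0_iff)
qed

text \<open>Equality would be a critical zero, which puts the inner point \<open>p\<close> on the
  curve.\<close>

lemma support_neg:
  assumes p: "p \<in> hyp_plane" "proj p \<in> inner_dom"
  shows "mink p (N t) < 0"
proof (rule ccontr)
  assume "\<not> ?thesis"
  then have 0: "mink p (N t) = 0" using support_nonpos[OF p, of t] by simp
  have "mink p (T t) = 0" by (rule support_critical[of 1]) (use 0 support_nonpos[OF p] in auto)
  then show False using 0 p orthogonal_eq_gamma not_inner_gamma by blast
qed

lemma support_closure:
  assumes p: "p \<in> hyp_plane" "proj p \<in> closure inner_dom"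
  shows "mink p (N t) \<le> 0"
proof -
  have "(\<lambda>w. mink (lift w) (N t)) ` closure inner_dom \<subseteq> {..0}"
    using support_nonpos[OF lift_in]
    by (intro image_closure_subset mink.continuous_on continuous_on_lift continuous_intros) auto
  then have "mink (lift (proj p)) (N t) \<le> 0" using p(2) by blast
  then show ?thesis by (simp add: lift_proj p(1))
qed

end

section \<open>Change of variables in the plane\<close>

text \<open>The chart of the area lives on \<open>real \<times> real\<close>, the change of
  variables theorem on \<open>real^2\<close>; these maps carry integrals between the two.\<close>

definition vec_of_pair :: "real \<times> real \<Rightarrow> real^2" where
  "vec_of_pair p = vector [fst p, snd p]"

definition pair_of_vec :: "real^2 \<Rightarrow> real \<times> real" where
  "pair_of_vec x = (x $ 1, x $ 2)"

lemma pair_vec [simp]: "pair_of_vec (vec_of_pair p) = p" "vec_of_pair (pair_of_vec x) = x"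
  by (simp_all add: pair_of_vec_def vec_of_pair_def vec_eq_iff forall_2)

lemma vec_of_pair_nth [simp]: "vec_of_pair p $ 1 = fst p" "vec_of_pair p $ 2 = snd p"
  by (simp_all add: vec_of_pair_def)

lemma bounded_linear_pair_of_vec: "bounded_linear pair_of_vec"
proof -
  have "linear pair_of_vec" by (auto intro!: linearI simp: pair_of_vec_def)
  then show ?thesis by (rule linear_conv_bounded_linear[THEN iffD1])
qed

lemma bounded_linear_vec_of_pair: "bounded_linear vec_of_pair"
proof -
  have "linear vec_of_pair" by (auto intro!: linearI simp: vec_eq_iff forall_2)
  then show ?thesis by (rule linear_conv_bounded_linear[THEN iffD1])
qed

lemma vec_of_pair_image: "vec_of_pair ` S = pair_of_vec -` S"
  by (auto intro: image_eqI[of _ _ "pair_of_vec _"])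

lemma pair_of_vec_image: "pair_of_vec ` S = vec_of_pair -` S"
  by (auto intro: image_eqI[of _ _ "vec_of_pair _"])

lemma pair_of_vec_cbox: "pair_of_vec ` cbox u v = cbox (pair_of_vec u) (pair_of_vec v)"
  by (auto simp: pair_of_vec_image mem_box_cart forall_2 cbox_Pair_eq pair_of_vec_def[of u] pair_of_vec_def[of v])

lemma vec_of_pair_cbox: "vec_of_pair ` cbox u v = cbox (vec_of_pair u) (vec_of_pair v)"
proof -
  have "vec_of_pair ` cbox (pair_of_vec (vec_of_pair u)) (pair_of_vec (vec_of_pair v))
      = cbox (vec_of_pair u) (vec_of_pair v)"
    unfolding pair_of_vec_cbox[symmetric] by (simp add: image_image)
  then show ?thesis by simp
qed

lemma content_pair_of_vec: "measure lborel (pair_of_vec ` cbox u v) = measure lborel (cbox u v)"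
proof (cases "cbox u v = {}")
  case False
  then have "u $ 1 \<le> v $ 1" "u $ 2 \<le> v $ 2"
    by (auto simp: interval_ne_empty_cart)
  then show ?thesis
    unfolding pair_of_vec_cbox pair_of_vec_def[of u] pair_of_vec_def[of v] content_Pair
    by (simp add: content_cbox_cart[OF False] UNIV_2)
qed simp

text \<open>Boundedness puts both sets into boxes, whose contents the relabelling of coordinates
  preserves in both directions.\<close>

lemma has_integral_pair_of_vec_iff:
  fixes f :: "real \<times> real \<Rightarrow> real"
  assumes "bounded S"
  shows "((\<lambda>x. f (pair_of_vec x)) has_integral i) (vec_of_pair ` S) \<longleftrightarrow> (f has_integral i) S"
proof -
  obtain a where a: "S \<subseteq> cbox (-a) a" using bounded_subset_cbox_symmetric[OF assms] by blast
  let ?b = "vec_of_pair (-a)" and ?c = "vec_of_pair a"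
  have S': "vec_of_pair ` S \<subseteq> cbox ?b ?c"
    using a unfolding vec_of_pair_cbox[symmetric] by blast
  let ?f = "\<lambda>x. if x \<in> S then f x else 0"
  let ?g = "\<lambda>x. if x \<in> vec_of_pair ` S then f (pair_of_vec x) else 0"
  have g: "?g = (\<lambda>x. ?f (pair_of_vec x))" "?f = (\<lambda>x. ?g (vec_of_pair x))"
    by (auto simp: vec_of_pair_image fun_eq_iff)
  have content': "measure lborel (vec_of_pair ` cbox u v) = measure lborel (cbox u v)" for u v
    using content_pair_of_vec[of "vec_of_pair u" "vec_of_pair v"]
    by (simp add: vec_of_pair_cbox pair_of_vec_cbox)
  have e1: "\<exists>w z. pair_of_vec ` cbox u v = cbox w z" and e2: "\<exists>w z. vec_of_pair ` cbox r s = cbox w z"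
    for u v r s
    using pair_of_vec_cbox vec_of_pair_cbox by blast+
  have "(?g has_integral i) (cbox ?b ?c)" if "(?f has_integral i) (cbox (-a) a)"
  proof -
    have "((\<lambda>x. ?f (pair_of_vec x)) has_integral (1 / 1) *\<^sub>R i) (vec_of_pair ` cbox (-a) a)"
      by (rule has_integral_twiddle[OF _ _ _ _ e1 e2 _ that])
        (simp_all add: content_pair_of_vec linear_continuous_at[OF bounded_linear_pair_of_vec])
    then show ?thesis unfolding g(1)[symmetric] by (simp add: vec_of_pair_cbox)
  qed
  moreover have "(?f has_integral i) (cbox (-a) a)" if "(?g has_integral i) (cbox ?b ?c)"
  proof -
    have "((\<lambda>x. ?g (vec_of_pair x)) has_integral (1 / 1) *\<^sub>R i) (pair_of_vec ` cbox ?b ?c)"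
      by (rule has_integral_twiddle[OF _ _ _ _ e2 e1 _ that])
        (simp_all add: content' linear_continuous_at[OF bounded_linear_vec_of_pair])
    then show ?thesis unfolding g(2)[symmetric] by (simp add: pair_of_vec_cbox)
  qed
  ultimately show ?thesis
    using has_integral_restrict[OF a, of f i] has_integral_restrict[OF S', of "\<lambda>x. f (pair_of_vec x)" i]
    by blast
qed

text \<open>The derivative is given by its columns \<open>A x\<close> and \<open>B x\<close>, so the
  Jacobian is a 2 by 2 determinant. Nonnegativity turns integrability into the absolute
  integrability that the general theorem asks for.\<close>

lemma has_integral_change_of_variables_pair:
  fixes f :: "real \<times> real \<Rightarrow> real" and g :: "real \<times> real \<Rightarrow> real \<times> real"
  assumes S: "S \<in> sets borel" "bounded S" "bounded (g ` S)"
    and der: "\<And>x. x \<in> S \<Longrightarrow> (g has_derivative (\<lambda>h. fst h *\<^sub>R A x + snd h *\<^sub>R B x)) (at x)"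
    and inj: "inj_on g S"
    and nonneg: "\<And>x. f x \<ge> 0"
    and int: "((\<lambda>x. \<bar>fst (A x) * snd (B x) - snd (A x) * fst (B x)\<bar> * f (g x)) has_integral b) S"
  shows "(f has_integral b) (g ` S)"
proof -
  define G where "G = vec_of_pair \<circ> g \<circ> pair_of_vec"
  define G' where "G' x = vec_of_pair \<circ> (\<lambda>h. fst h *\<^sub>R A (pair_of_vec x) + snd h *\<^sub>R B (pair_of_vec x)) \<circ> pair_of_vec" for x
  let ?S = "vec_of_pair ` S"
  let ?J = "\<lambda>x. \<bar>fst (A x) * snd (B x) - snd (A x) * fst (B x)\<bar>"
  have "?S \<in> sets borel"
    unfolding vec_of_pair_image
    by (rule measurable_sets_borel[OF _ S(1)])
      (intro borel_measurable_continuous_onI linear_continuous_on bounded_linear_pair_of_vec)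
  then have S': "?S \<in> sets lebesgue" by simp
  have der': "(G has_derivative G' x) (at x within ?S)" if "x \<in> ?S" for x
  proof -
    have "pair_of_vec x \<in> S" using that by auto
    from der[OF this] have "(G has_derivative G' x) (at x)"
      unfolding G_def G'_def
      by (intro diff_chain_at bounded_linear_imp_has_derivative bounded_linear_pair_of_vec bounded_linear_vec_of_pair) simp_all
    then show ?thesis by (rule has_derivative_at_withinI)
  qed
  have inj': "inj_on G ?S"
    unfolding G_def using inj by (auto simp: inj_on_def dest!: arg_cong[of _ _ pair_of_vec])
  have det: "\<bar>det (matrix (G' x))\<bar> = ?J (pair_of_vec x)" for x
  proof -
    have "pair_of_vec (axis 1 1) = (1, 0)" "pair_of_vec (axis 2 1) = (0, 1)"
      by (simp_all add: pair_of_vec_def axis_def)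
    then show ?thesis by (simp add: det_2 matrix_def G'_def algebra_simps)
  qed
  \<comment> \<open>The general theorem is about vector-valued integrands, so the scalar one is read
    in \<open>real^1\<close>.\<close>
  let ?f = "\<lambda>x. vec (f (pair_of_vec x)) :: real^1"
  have img: "G ` ?S = vec_of_pair ` g ` S" by (auto simp: G_def image_image)
  have "((\<lambda>x. ?J (pair_of_vec x) * f (g (pair_of_vec x))) has_integral b) ?S"
    using has_integral_pair_of_vec_iff[OF S(2), of "\<lambda>x. ?J x * f (g x)" b] int by blast
  moreover have "(\<lambda>x. \<bar>det (matrix (G' x))\<bar> *\<^sub>R ?f (G x)) = (\<lambda>x. vec (?J (pair_of_vec x) * f (g (pair_of_vec x))))"
    by (simp add: det G_def fun_eq_iff vec_eq_iff)
  moreover have "(\<lambda>x. ?J (pair_of_vec x) * f (g (pair_of_vec x))) absolutely_integrable_on ?S"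
    by (rule nonnegative_absolutely_integrable_1) (use calculation(1) nonneg in auto)
  ultimately have "(\<lambda>x. \<bar>det (matrix (G' x))\<bar> *\<^sub>R ?f (G x)) absolutely_integrable_on ?S \<and>
     integral ?S (\<lambda>x. \<bar>det (matrix (G' x))\<bar> *\<^sub>R ?f (G x)) = vec b"
    by (simp add: absolutely_integrable_on_1_iff integral_on_1_eq integral_unique)
  then have "?f absolutely_integrable_on (G ` ?S)" "integral (G ` ?S) ?f = vec b"
    using has_absolute_integral_change_of_variables[OF S' der' inj', of ?f "vec b"] by blast+
  then have "((\<lambda>x. f (pair_of_vec x)) has_integral b) (vec_of_pair ` g ` S)"
    unfolding img
    by (simp add: absolutely_integrable_on_1_iff integral_on_1_eq has_integral_iff
        set_lebesgue_integral_eq_integral vec_eq_iff)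
  then show ?thesis
    using has_integral_pair_of_vec_iff[OF S(3)] by blast
qed

section \<open>Polar coordinates about a pole\<close>

lemma ex_unit_tangent:
  assumes "p \<in> hyp_plane" obtains e where "mink e p = 0" "mink e e = 1"
proof -
  \<comment> \<open>By the hyperboloid equation \<open>d\<close> is the Minkowski square of (p2, p1,
    0), which is visibly orthogonal to \<open>p\<close>.\<close>
  define d where "d = 1 + (p $ 3)\<^sup>2"
  define e :: "real^3" where "e = vector [p $ 2, p $ 1, 0] /\<^sub>R sqrt d"
  have pos: "d > 0" by (simp add: d_def add_pos_nonneg)
  have "mink e p = 0" by (simp add: e_def mink_def)
  moreover have "mink e e = 1"
  proof -
    have "mink (vector [p $ 2, p $ 1, 0]) (vector [p $ 2, p $ 1, 0]) = d"
      using hyp_planeD(1)[OF assms] by (simp add: d_def mink_def power2_eq_square)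
    then show ?thesis using pos by (simp add: e_def mink_simps field_simps)
  qed
  ultimately show ?thesis by (rule that)
qed

text \<open>Provides a continuous logarithm along a curve avoiding 0:
  \<open>f t * exp (- L t)\<close> has derivative zero.\<close>

lemma exp_logarithmic_integral:
  fixes f :: "real \<Rightarrow> complex"
  assumes D: "\<And>t. (f has_vector_derivative f' t) (at t)" and cont: "continuous_on UNIV f'"
    and nz: "\<And>t. f t \<noteq> 0" and t: "0 \<le> t" "t \<le> c"
  shows "f t = f 0 * exp (integral {0..t} (\<lambda>s. f' s / f s))"
proof -
  define L where "L t = integral {0..t} (\<lambda>s. f' s / f s)" for t
  have "continuous_on UNIV f"
    using D by (intro continuous_at_imp_continuous_on ballI has_vector_derivative_continuous)
  then have quot: "continuous_on {0..c} (\<lambda>s. f' s / f s)"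
    by (intro continuous_on_divide ballI nz continuous_on_subset[OF cont]
        continuous_on_subset[OF \<open>continuous_on UNIV f\<close>] subset_UNIV)
  have "((\<lambda>t. f t * exp (- L t)) has_vector_derivative 0) (at t within {0..c})" if "t \<in> {0..c}" for t
  proof -
    have "(L has_vector_derivative f' t / f t) (at t within {0..c})"
      unfolding L_def by (rule integral_has_vector_derivative[OF quot that])
    then have "((\<lambda>t. - L t) has_vector_derivative - (f' t / f t)) (at t within {0..c})"
      by (rule has_vector_derivative_minus)
    from field_vector_diff_chain_within[OF this DERIV_subset[OF DERIV_exp]]
    have "((\<lambda>t. exp (- L t)) has_vector_derivative - (f' t / f t) * exp (- L t)) (at t within {0..c})"
      by (simp add: o_def)
    from has_vector_derivative_mult[OF has_vector_derivative_at_within[OF D] this]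
    show ?thesis using nz by simp
  qed
  then obtain k where "\<And>t. t \<in> {0..c} \<Longrightarrow> f t * exp (- L t) = k"
    by (rule has_vector_derivative_zero_constant[OF convex_real_interval(5)]) (assumption, rule that)
  from this[of t] this[of 0] have "f t * exp (- L t) = f 0 * exp (- L 0)" using t by simp
  then have "f t * exp (- L t) * exp (L t) = f 0 * exp (L t)" by (simp add: L_def)
  then show ?thesis by (simp add: L_def mult.assoc flip: exp_add)
qed

context hyp_curve
begin

lemma N_period: "N (t + 2 * pi) = N t"
  by (simp add: N_def nrm_period)

end

text \<open>Assumes the support inequality rather than that \<open>p\<close> is inside, so that it
  also applies to the centre found for a curve of constant curvature.\<close>

locale pole = horoconvex_curve +
  fixes p :: "real^3"
  assumes p_in: "p \<in> hyp_plane" and support: "\<And>t. mink p (N t) < 0"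
begin

text \<open>With r the distance from \<open>p\<close> to \<open>\<gamma> t\<close>,
  \<open>c t\<close> is cosh r, while \<open>a t\<close> and \<open>b t\<close> are sinh r times the
  tangential and the normal component of the outward radial unit vector.\<close>

definition a :: "real \<Rightarrow> real" where "a t = - mink p (T t)"
definition b :: "real \<Rightarrow> real" where "b t = - mink p (N t)"
definition c :: "real \<Rightarrow> real" where "c t = - mink p (\<gamma> t)"

lemma D_a: "(a has_real_derivative \<sigma> t * (c t - k t * b t)) (at t)"
  using DERIV_minus[OF mink_const_vector_derivatives(2), of p t]
  by (simp add: a_def[abs_def] b_def c_def algebra_simps)

lemma D_b: "(b has_real_derivative \<sigma> t * k t * a t) (at t)"
  using DERIV_minus[OF mink_const_vector_derivatives(3), of p t]
  by (simp add: b_def[abs_def] a_def)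

lemma D_c: "(c has_real_derivative \<sigma> t * a t) (at t)"
  using DERIV_minus[OF mink_const_vector_derivatives(1), of p t]
  by (simp add: c_def[abs_def] a_def)

lemma cont_abc: "continuous_on S a" "continuous_on S b" "continuous_on S c"
  using D_a D_b D_c by (auto intro!: continuous_at_imp_continuous_on DERIV_isCont)

lemma b_pos: "b t > 0"
  using support by (simp add: b_def)

lemma c_sq: "(c t)\<^sup>2 = 1 + (a t)\<^sup>2 + (b t)\<^sup>2"
  using frame.mink_expand[of p p t] hyp_planeD(1)[OF p_in]
  by (simp add: a_def b_def c_def power2_eq_square)

lemma c_sq_gt: "(c t)\<^sup>2 > 1"
  unfolding c_sq using b_pos[of t] by (simp add: add_nonneg_pos)

lemma c_sq_ne: "(c t)\<^sup>2 - 1 \<noteq> 0"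
  using c_sq_gt[of t] by simp

lemma c_gt: "c t > 1"
proof -
  have "c t \<ge> 1" using mink_hyp_plane_le(1)[OF p_in gamma_in[of t]] by (simp add: c_def)
  moreover have "c t \<noteq> 1" using c_sq_gt[of t] by auto
  ultimately show ?thesis by simp
qed

lemma abc_period: "a (t + 2 * pi) = a t" "b (t + 2 * pi) = b t"
  by (simp_all add: a_def b_def T_period N_period)

text \<open>The speed of the polar angle about \<open>p\<close>: the part of the velocity across the
  radial direction is \<open>\<sigma> t * b t\<close> over sinh r, and a circle of radius r has
  length 2 pi sinh r.\<close>

definition \<omega> :: "real \<Rightarrow> real" where "\<omega> t = \<sigma> t * b t / ((c t)\<^sup>2 - 1)"

lemma omega_pos: "\<omega> t > 0"
  using speed_pos b_pos c_sq_gt by (simp add: \<omega>_def)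

lemma cont_omega: "continuous_on S \<omega>"
  unfolding \<omega>_def[abs_def]
  by (intro continuous_intros cont_abc cont_speed ballI c_sq_ne)

text \<open>The quotient $a/b$ is the cotangent of the angle between the tangent and the radial direction,
  so this is the local form of the Gauss--Bonnet formula in polar coordinates.\<close>

lemma D_arctan: "((\<lambda>t. arctan (a t / b t)) has_real_derivative c t * \<omega> t - k t * \<sigma> t) (at t)"
proof -
  have b: "b t \<noteq> 0" using b_pos[of t] by simp
  have pos: "(a t)\<^sup>2 + (b t)\<^sup>2 \<noteq> 0" using b by (simp add: sum_power2_eq_zero_iff)
  have "((\<lambda>t. a t / b t) has_real_derivative
     (\<sigma> t * (c t - k t * b t) * b t - a t * (\<sigma> t * k t * a t)) / (b t * b t)) (at t)"
    by (rule DERIV_divide[OF D_a D_b b])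
  from DERIV_chain2[OF DERIV_arctan this]
  have "((\<lambda>t. arctan (a t / b t)) has_real_derivative
    inverse (1 + (a t / b t)\<^sup>2) * ((\<sigma> t * (c t - k t * b t) * b t - a t * (\<sigma> t * k t * a t)) / (b t * b t))) (at t)" .
  also have "inverse (1 + (a t / b t)\<^sup>2) = (b t * b t) / ((a t)\<^sup>2 + (b t)\<^sup>2)"
    using b pos by (simp add: field_simps power2_eq_square)
  also have "\<sigma> t * (c t - k t * b t) * b t - a t * (\<sigma> t * k t * a t)
      = c t * \<sigma> t * b t - k t * \<sigma> t * ((a t)\<^sup>2 + (b t)\<^sup>2)"
    by (simp add: power2_eq_square algebra_simps)
  also have "(b t * b t) / ((a t)\<^sup>2 + (b t)\<^sup>2)
        * ((c t * \<sigma> t * b t - k t * \<sigma> t * ((a t)\<^sup>2 + (b t)\<^sup>2)) / (b t * b t))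
     = (c t * \<sigma> t * b t - k t * \<sigma> t * ((a t)\<^sup>2 + (b t)\<^sup>2)) / ((a t)\<^sup>2 + (b t)\<^sup>2)"
    using b by simp
  also have "\<dots> = c t * \<omega> t - k t * \<sigma> t"
    using pos by (simp add: \<omega>_def c_sq diff_divide_distrib)
  finally show ?thesis .
qed

text \<open>The derivative of a periodic function integrates to 0, so the total curvature is the
  integral of cosh r against the angle. Splitting off 1 from cosh r leaves the total angle and the
  area integral, where a factor \<open>c t - 1\<close> cancels.\<close>

lemma total_curvature: "integral {0..2 * pi} (\<lambda>t. k t * \<sigma> t)
  = integral {0..2 * pi} \<omega> + integral {0..2 * pi} (\<lambda>t. \<sigma> t * b t / (c t + 1))"
proof -
  have "((\<lambda>t. c t * \<omega> t - k t * \<sigma> t) has_integral arctan (a (2 * pi) / b (2 * pi)) - arctan (a 0 / b 0)) {0..2 * pi}"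
    by (rule fundamental_theorem_of_calculus)
      (simp_all add: has_vector_derivative_at_within D_arctan[unfolded has_real_derivative_iff_has_vector_derivative])
  then have "integral {0..2 * pi} (\<lambda>t. c t * \<omega> t - k t * \<sigma> t) = 0"
    using abc_period[of 0] by (simp add: integral_unique)
  moreover have "integral {0..2 * pi} (\<lambda>t. c t * \<omega> t - k t * \<sigma> t)
      = integral {0..2 * pi} (\<lambda>t. c t * \<omega> t) - integral {0..2 * pi} (\<lambda>t. k t * \<sigma> t)"
    by (intro integral_diff integrable_continuous_real continuous_intros cont_omega cont_abc cont_k cont_speed)
  moreover have "c t * \<omega> t = \<omega> t + \<sigma> t * b t / (c t + 1)" for t
  proof -
    have "(c t)\<^sup>2 - 1 = (c t - 1) * (c t + 1)" by (simp add: power2_eq_square algebra_simps)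
    then have "(c t - 1) * \<omega> t = \<sigma> t * b t / (c t + 1)" using c_gt[of t] by (simp add: \<omega>_def)
    then show ?thesis by (simp add: algebra_simps)
  qed
  moreover have "integral {0..2 * pi} (\<lambda>t. \<omega> t + \<sigma> t * b t / (c t + 1))
      = integral {0..2 * pi} \<omega> + integral {0..2 * pi} (\<lambda>t. \<sigma> t * b t / (c t + 1))"
  proof (intro integral_add integrable_continuous_real continuous_intros cont_omega cont_abc cont_speed ballI)
    show "c t + 1 \<noteq> 0" for t using c_gt[of t] by simp
  qed
  ultimately show ?thesis by simp
qed

definition e1 :: "real^3" where "e1 = (SOME e. mink e p = 0 \<and> mink e e = 1)"
text \<open>The factor \<open>- orient\<close> orients the tangent plane at \<open>p\<close> so that
  the polar angle increases along the curve.\<close>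

definition e2 :: "real^3" where "e2 = - orient *\<^sub>R lcross p e1"

lemma e1: "mink e1 p = 0" "mink e1 e1 = 1"
proof -
  have "\<exists>e. mink e p = 0 \<and> mink e e = 1" using ex_unit_tangent[OF p_in] by blast
  from someI_ex[OF this] show "mink e1 p = 0" "mink e1 e1 = 1" by (simp_all add: e1_def)
qed

sublocale pframe: mink_frame p e1 e2
  by unfold_locales
    (simp_all add: hyp_planeD(1)[OF p_in] e1 e2_def mink_simps mink_lcross_lcross mink_commute[of p e1])

text \<open>The tangential part of \<open>\<gamma> t\<close> at the pole as a complex number:
  modulus sinh r, argument the polar angle.\<close>

definition \<zeta> :: "real \<Rightarrow> complex" where
  "\<zeta> t = Complex (mink (\<gamma> t) e1) (mink (\<gamma> t) e2)"

definition \<zeta>' :: "real \<Rightarrow> complex" where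
  "\<zeta>' t = Complex (\<sigma> t * mink (T t) e1) (\<sigma> t * mink (T t) e2)"

lemma D_zeta: "(\<zeta> has_vector_derivative \<zeta>' t) (at t)"
proof -
  have D: "((\<lambda>t. of_real (mink (\<gamma> t) e) :: complex) has_vector_derivative of_real (\<sigma> t * mink (T t) e)) (at t)" for e
    using mink_const_vector_derivatives(1)[of e t]
    by (intro has_vector_derivative_of_real)
      (simp add: mink_commute[of e] has_real_derivative_iff_has_vector_derivative)
  show ?thesis
    unfolding \<zeta>_def[abs_def] \<zeta>'_def Complex_eq
    by (intro has_vector_derivative_add has_vector_derivative_mult_right D)
qed

lemma cont_zeta': "continuous_on S \<zeta>'"
  unfolding \<zeta>'_def[abs_def] Complex_eq
  by (intro continuous_intros cont_speed mink.continuous_on cont_T)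

lemma norm_zeta: "(Re (\<zeta> t))\<^sup>2 + (Im (\<zeta> t))\<^sup>2 = (c t)\<^sup>2 - 1"
  using pframe.mink_expand[of "\<gamma> t" "\<gamma> t"]
  by (simp add: \<zeta>_def c_def mink_gamma mink_commute[of p] power2_eq_square)

lemma zeta_nz: "\<zeta> t \<noteq> 0"
  using norm_zeta[of t] c_sq_gt[of t] by auto

lemma Im_zeta: "Im (\<zeta>' t / \<zeta> t) = \<omega> t"
proof -
  \<comment> \<open>A determinant of coordinates in the tangent plane at \<open>p\<close> is a
    triple product with \<open>p\<close>; for \<open>\<gamma> t\<close> and \<open>T t\<close> this
    triple product is \<open>mink p (nrm t)\<close>.\<close>
  have id: "mink x e1 * mink y (lcross p e1) - mink y e1 * mink x (lcross p e1) = mink p (lcross x y)" for x y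
  proof -
    have "mink x e1 * mink y (lcross p e1) - mink y e1 * mink x (lcross p e1)
       = mink (lcross p e1) (mink e1 x *\<^sub>R y - mink e1 y *\<^sub>R x)"
      by (simp add: mink_simps mink_commute[of e1 x] mink_commute[of e1 y]
          mink_commute[of "lcross p e1" x] mink_commute[of "lcross p e1" y])
    also have "\<dots> = mink p (lcross x y)"
      unfolding lcross_lcross[symmetric] mink_lcross_lcross by (simp add: e1 mink_commute[of p e1])
    finally show ?thesis .
  qed
  have "Im (\<zeta>' t) * Re (\<zeta> t) - Re (\<zeta>' t) * Im (\<zeta> t)
     = - orient * \<sigma> t * (mink (\<gamma> t) e1 * mink (T t) (lcross p e1) - mink (T t) e1 * mink (\<gamma> t) (lcross p e1))"
    by (simp add: \<zeta>_def \<zeta>'_def e2_def mink_simps algebra_simps)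
  also have "\<dots> = \<sigma> t * b t"
    unfolding id using orient(1) by (auto simp: b_def N_def nrm_def mink_simps)
  finally show ?thesis
    by (simp add: Im_divide norm_zeta \<omega>_def)
qed

definition W :: "real \<Rightarrow> real" where "W t = integral {0..t} \<omega>"

lemma zeta_polar:
  assumes "0 \<le> t"
  obtains r where "r > 0" "\<zeta> t = \<zeta> 0 * of_real r * exp (\<i> * of_real (W t))"
proof -
  define L where "L = integral {0..t} (\<lambda>s. \<zeta>' s / \<zeta> s)"
  have "continuous_on {0..t} \<zeta>"
    using D_zeta by (intro continuous_at_imp_continuous_on ballI has_vector_derivative_continuous)
  then have "(\<lambda>s. \<zeta>' s / \<zeta> s) integrable_on {0..t}"
    by (intro integrable_continuous_real continuous_intros cont_zeta') (auto simp: zeta_nz)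
  from integral_linear[OF this bounded_linear_Im] have "Im L = W t"
    by (simp add: L_def W_def o_def Im_zeta)
  then have "exp L = of_real (exp (Re L)) * exp (\<i> * of_real (W t))"
    unfolding cis_conv_exp[symmetric] by (metis exp_eq_polar)
  moreover have "\<zeta> t = \<zeta> 0 * exp L"
    unfolding L_def by (rule exp_logarithmic_integral[OF D_zeta cont_zeta' zeta_nz assms order_refl])
  ultimately show ?thesis using that[of "exp (Re L)"] by simp
qed

lemma cont_W: "continuous_on {0..2 * pi} W"
  unfolding W_def[abs_def]
  by (rule indefinite_integral_continuous_1) (intro integrable_continuous_real cont_omega)

lemma W_IVT:
  assumes "0 \<le> \<alpha>" "\<alpha> \<le> W (2 * pi)" obtains t where "0 \<le> t" "t \<le> 2 * pi" "W t = \<alpha>"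
  using IVT'[of W 0 \<alpha> "2 * pi"] assms cont_W that by (auto simp: W_def)

lemma W_pos: "W (2 * pi) > 0"
proof -
  have "W (2 * pi) \<ge> 0" unfolding W_def
    by (rule integral_nonneg) (auto intro: integrable_continuous_real cont_omega less_imp_le omega_pos)
  moreover have "W (2 * pi) \<noteq> 0"
  proof
    assume "W (2 * pi) = 0"
    then have "\<omega> 0 = 0" unfolding W_def
      by (subst (asm) integral_eq_0_iff) (auto intro: cont_omega less_imp_le omega_pos)
    then show False using omega_pos[of 0] by simp
  qed
  ultimately show ?thesis by simp
qed

text \<open>The curve closes up, so the swept angle is a multiple of 2 pi, and it is positive
  because \<open>\<omega>\<close> is.\<close>

lemma W_multiple: obtains m :: int where "W (2 * pi) = 2 * pi * of_int m" "m \<ge> 1"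
proof -
  obtain r where r: "r > 0" "\<zeta> (2 * pi) = \<zeta> 0 * of_real r * exp (\<i> * of_real (W (2 * pi)))"
    by (rule zeta_polar[of "2 * pi"]) auto
  moreover have "\<zeta> (2 * pi) = \<zeta> 0" using gamma_period[of 0] by (simp add: \<zeta>_def)
  ultimately have eq: "of_real r * exp (\<i> * of_real (W (2 * pi))) = 1"
    using zeta_nz[of 0] by (simp add: mult.assoc)
  then have "norm (of_real r * exp (\<i> * of_real (W (2 * pi)))) = norm (1::complex)" by simp
  then have "r = 1" using r(1) by (simp add: norm_mult)
  with eq have "exp (\<i> * of_real (W (2 * pi))) = 1" by simp
  then obtain n :: int where n: "W (2 * pi) = of_int (2 * n) * pi" by (auto simp: exp_eq_1)
  then have "n > 0" using W_pos by (simp add: zero_less_mult_iff)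
  then show ?thesis using that[of n] n by simp
qed

lemma gamma_eq_zeta: "\<gamma> t = c t *\<^sub>R p + Re (\<zeta> t) *\<^sub>R e1 + Im (\<zeta> t) *\<^sub>R e2"
  using pframe.expand[of "\<gamma> t"] by (simp add: \<zeta>_def c_def mink_commute[of p])

end

locale inner_pole = horoconvex_curve +
  fixes p :: "real^3"
  assumes p_in_plane: "p \<in> hyp_plane" and p_inner: "proj p \<in> inner_dom"

sublocale inner_pole \<subseteq> pole
  using p_in_plane p_inner by unfold_locales (auto intro: support_neg)

context inner_pole
begin

text \<open>A point of the curve strictly between the pole and \<open>\<gamma> t\<close> would lie strictly inside.\<close>

lemma ray_meets_curve_once_aux:
  assumes eq: "\<gamma> s - c s *\<^sub>R p = \<mu> *\<^sub>R (\<gamma> t - c t *\<^sub>R p)" and \<mu>: "0 < \<mu>" "\<mu> \<le> 1"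
  shows "\<gamma> s = \<gamma> t"
proof -
  have norm: "mink (\<gamma> t - c t *\<^sub>R p) (\<gamma> t - c t *\<^sub>R p) = (c t)\<^sup>2 - 1" for t
    by (simp add: mink_simps mink_gamma hyp_planeD(1)[OF p_in] c_def mink_commute[of "\<gamma> t" p] power2_eq_square)
  have "(c s)\<^sup>2 - 1 = \<mu>\<^sup>2 * ((c t)\<^sup>2 - 1)"
    unfolding norm[symmetric] eq
    by (simp only: mink.scaleR_left mink.scaleR_right real_scaleR_def power2_eq_square mult.assoc)
  then have sq: "(c s)\<^sup>2 = (\<mu> * c t)\<^sup>2 + (1 - \<mu>\<^sup>2)" by (simp add: power_mult_distrib algebra_simps)
  show ?thesis
  proof (cases "\<mu> = 1")
    case True
    with sq have "c s = c t" using c_gt[of s] c_gt[of t] by (simp add: power2_eq_iff)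
    then show ?thesis using eq True by simp
  next
    case False
    then have "\<mu>\<^sup>2 < 1" using \<mu> by (simp add: power_less_one_iff abs_square_less_1)
    then have "(\<mu> * c t)\<^sup>2 < (c s)\<^sup>2" using sq by simp
    then have less: "\<mu> * c t < c s"
      by (rule power2_less_imp_less) (use c_gt[of s] in simp)
    \<comment> \<open>Both coefficients are positive. Paired with \<open>N s\<close> the left side
      vanishes, while the right side is negative by the support inequality.\<close>
    have "\<gamma> s = \<mu> *\<^sub>R \<gamma> t + (c s - \<mu> * c t) *\<^sub>R p"
      using eq by (simp add: algebra_simps)
    then have "mink (\<gamma> s) (N s) = \<mu> * mink (\<gamma> t) (N s) + (c s - \<mu> * c t) * mink p (N s)"
      by (metis mink.add_left mink.scaleR_left real_scaleR_def)
    moreover have "mink (\<gamma> t) (N s) \<le> 0"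
      by (intro support_closure gamma_in) (auto simp: closure_inner)
    then have "\<mu> * mink (\<gamma> t) (N s) \<le> 0" using \<mu> by (simp add: mult_nonneg_nonpos)
    moreover have "(c s - \<mu> * c t) * mink p (N s) < 0" using less support[of s] by (simp add: mult_pos_neg)
    ultimately show ?thesis by simp
  qed
qed

lemma ray_meets_curve_once:
  assumes eq: "\<gamma> s - c s *\<^sub>R p = \<mu> *\<^sub>R (\<gamma> t - c t *\<^sub>R p)" and \<mu>: "0 < \<mu>"
  shows "\<gamma> s = \<gamma> t"
proof (cases "\<mu> \<le> 1")
  case True
  then show ?thesis using ray_meets_curve_once_aux[OF eq \<mu>] by simp
next
  case False
  have "\<gamma> t - c t *\<^sub>R p = (1 / \<mu>) *\<^sub>R (\<gamma> s - c s *\<^sub>R p)" using eq \<mu> by simp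
  then have "\<gamma> t = \<gamma> s" by (rule ray_meets_curve_once_aux) (use False in auto)
  then show ?thesis by simp
qed

text \<open>If more than one turn were swept, the angle 2 pi would be reached at a parameter
  strictly between 0 and 2 pi. That point lies on the ray through \<open>\<gamma> 0\<close>, hence
  equals \<open>\<gamma> 0\<close>, against simplicity.\<close>

lemma total_angle: "integral {0..2 * pi} \<omega> = 2 * pi"
proof -
  obtain m :: int where m: "W (2 * pi) = 2 * pi * of_int m" "m \<ge> 1" by (rule W_multiple)
  have "m = 1"
  proof (rule ccontr)
    assume "m \<noteq> 1"
    then have "m > 1" using m(2) by simp
    then have lt: "2 * pi < W (2 * pi)" using m(1) by simp
    obtain t where t: "0 \<le> t" "t \<le> 2 * pi" "W t = 2 * pi"
      using W_IVT[of "2 * pi"] lt by auto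
    obtain r where r: "r > 0" "\<zeta> t = \<zeta> 0 * of_real r * exp (\<i> * of_real (W t))"
      by (rule zeta_polar[OF t(1)])
    have "exp (\<i> * of_real (W t)) = 1" by (simp add: t(3) exp_eq_1)
    then have "\<zeta> t = r *\<^sub>R \<zeta> 0" using r by (simp add: scaleR_conv_of_real)
    then have "\<gamma> t - c t *\<^sub>R p = r *\<^sub>R (\<gamma> 0 - c 0 *\<^sub>R p)"
      by (simp add: gamma_eq_zeta[of t] gamma_eq_zeta[of 0] scaleR_add_right)
    then have "\<gamma> t = \<gamma> 0" using r(1) by (rule ray_meets_curve_once)
    moreover have "t < 2 * pi" using t lt by (cases "t = 2 * pi") auto
    ultimately have "t = 0" using t(1) by (intro gamma_eqD) auto
    then show False using t(3) by (simp add: W_def)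
  qed
  then show ?thesis using m(1) by (simp add: W_def)
qed

end

section \<open>The area of the enclosed region\<close>

text \<open>A pairing with a point of the upper sheet decides the sheet: points of the lower one
  pair with \<open>p\<close> to at least 1.\<close>

lemma hyp_planeI:
  assumes "p \<in> hyp_plane" "mink x x = -1" "mink p x < 0" shows "x \<in> hyp_plane"
proof -
  have "x $ 1 > 0"
  proof (rule ccontr)
    assume "\<not> x $ 1 > 0"
    then consider "x $ 1 = 0" | "(- x) $ 1 > 0" by fastforce
    then show False
    proof cases
      case 1
      then show False using assms(2) sum_squares_ge_zero[of "x $ 2" "x $ 3"] by (simp add: mink_def)
    next
      case 2
      then have "- x \<in> hyp_plane" using assms(2) by (simp add: hyp_plane_def mink_simps)
      from mink_hyp_plane_le(1)[OF assms(1) this] assms(3) show False by (simp add: mink_simps)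
    qed
  qed
  then show ?thesis using assms(2) by (simp add: hyp_plane_def)
qed

text \<open>The cross product of two vectors tangent at \<open>x\<close> is normal to the
  hyperboloid, hence a multiple of \<open>x\<close>.\<close>

lemma lcross_tangent:
  assumes "mink x x = -1" "mink x v = 0" "mink x w = 0"
  shows "lcross v w = - mink (lcross v w) x *\<^sub>R x"
proof -
  have "lcross x (lcross x (lcross v w)) = 0"
    unfolding lcross_lcross[of x v w] using assms by (simp add: lcross.zero_right)
  then have "mink x x *\<^sub>R lcross v w = mink x (lcross v w) *\<^sub>R x"
    by (simp add: lcross_lcross[of x x])
  then have "- lcross v w = mink (lcross v w) x *\<^sub>R x"
    using assms(1) by (simp add: mink_commute[of x "lcross v w"])
  then show ?thesis by (metis minus_minus scaleR_minus_left)
qed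

lemma hyp_area_density_pos: "hyp_area_density q > 0"
proof -
  have "1 + (fst q)\<^sup>2 + (snd q)\<^sup>2 > 0" by (simp add: add_pos_nonneg)
  then show ?thesis using hyp_area_density_eq[of "fst q" "snd q"] by simp
qed

lemma continuous_on_hyp_area_density: "continuous_on S hyp_area_density"
proof -
  have ne: "1 + (fst q)\<^sup>2 + (snd q)\<^sup>2 \<noteq> 0" for q :: "real \<times> real"
    by (metis add_pos_nonneg less_irrefl zero_le_power2 zero_less_one)
  have "hyp_area_density = (\<lambda>q. 1 / sqrt (1 + (fst q)\<^sup>2 + (snd q)\<^sup>2))"
    using hyp_area_density_eq by (metis prod.collapse)
  moreover have "continuous_on S (\<lambda>q. 1 / sqrt (1 + (fst q)\<^sup>2 + (snd q)\<^sup>2))"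
    using ne by (intro continuous_intros) auto
  ultimately show ?thesis by metis
qed

lemma hyp_area_density_coords:
  assumes "x \<in> hyp_plane" shows "hyp_area_density (x $ 2, x $ 3) = 1 / x $ 1"
proof -
  have "1 + (x $ 2)\<^sup>2 + (x $ 3)\<^sup>2 = (x $ 1)\<^sup>2"
    using hyp_planeD(1)[OF assms] by (simp add: mink_def power2_eq_square)
  then show ?thesis using hyp_planeD(2)[OF assms] by (simp add: hyp_area_density_eq)
qed

lemma hyp_chart_eq_lift: "hyp_chart q = lift (Complex (fst q) (snd q))"
  by (simp add: lift_def)

text \<open>The radial part of the area integral, with \<open>m\<close> standing for sinh^2 of the
  distance to the boundary; a primitive is \<open>sqrt (1 + x\<^sup>2 * m) / m\<close>.\<close>

lemma has_integral_radial:
  assumes "m > -1" "m \<noteq> 0"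
  shows "((\<lambda>x. x / sqrt (1 + x\<^sup>2 * m)) has_integral (sqrt (1 + m) - 1) / m) {0..1}"
proof -
  have "((\<lambda>x. x / sqrt (1 + x\<^sup>2 * m)) has_integral sqrt (1 + 1\<^sup>2 * m) / m - sqrt (1 + 0\<^sup>2 * m) / m) {0..1}"
  proof (rule fundamental_theorem_of_calculus)
    fix x :: real assume x: "x \<in> {0..1}"
    have "1 + x\<^sup>2 * m > 0"
    proof (cases "m \<ge> 0")
      case True
      then show ?thesis by (simp add: add_pos_nonneg)
    next
      case False
      have "x\<^sup>2 \<le> 1" using x by (simp add: power_le_one)
      then have "x\<^sup>2 * (- m) \<le> 1 * (- m)" using False by (intro mult_right_mono) auto
      then show ?thesis using assms by simp
    qed
    then have "((\<lambda>x. sqrt (1 + x\<^sup>2 * m) / m) has_real_derivative x / sqrt (1 + x\<^sup>2 * m)) (at x)"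
      using assms by (auto intro!: derivative_eq_intros simp: field_simps)
    then show "((\<lambda>x. sqrt (1 + x\<^sup>2 * m) / m) has_vector_derivative x / sqrt (1 + x\<^sup>2 * m)) (at x within {0..1})"
      by (simp add: has_real_derivative_iff_has_vector_derivative has_vector_derivative_at_within)
  qed simp
  then show ?thesis by (simp add: diff_divide_distrib)
qed

section \<open>Polar parametrization of the region\<close>

context inner_pole
begin

definition u :: "real \<Rightarrow> real^3" where "u t = \<gamma> t - c t *\<^sub>R p"
definition m :: "real \<Rightarrow> real" where "m t = (c t)\<^sup>2 - 1"
definition h :: "real \<times> real \<Rightarrow> real" where "h x = sqrt (1 + (snd x)\<^sup>2 * m (fst x))"
text \<open>The geodesic ray from the pole to \<open>\<gamma> t\<close>, parametrized linearly by
  its component tangent at the pole: parameter 0 gives \<open>p\<close>, parameter 1 gives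
  \<open>\<gamma> t\<close>. The coefficient \<open>h\<close> restores the hyperboloid
  equation.\<close>

definition \<Psi> :: "real \<times> real \<Rightarrow> real^3" where "\<Psi> x = h x *\<^sub>R p + snd x *\<^sub>R u (fst x)"

lemma mink_pp: "mink p p = -1"
  using hyp_planeD(1)[OF p_in] .

lemma mink_u: "mink p (u t) = 0" "mink (u t) p = 0" "mink (u t) (u t) = m t"
  by (simp_all add: u_def c_def m_def mink_simps mink_pp mink_gamma mink_commute[of "\<gamma> t" p] power2_eq_square)

lemma m_pos: "m t > 0"
  using c_sq_gt by (simp add: m_def)

lemma h_sq: "(h x)\<^sup>2 = 1 + (snd x)\<^sup>2 * m (fst x)" and h_pos: "h x > 0"
proof -
  have "0 < 1 + (snd x)\<^sup>2 * m (fst x)"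
    using m_pos[of "fst x"] by (intro add_pos_nonneg) auto
  then show "(h x)\<^sup>2 = 1 + (snd x)\<^sup>2 * m (fst x)" "h x > 0" by (simp_all add: h_def)
qed

lemma mink_Psi: "mink (\<Psi> x) (\<Psi> x) = -1" "mink p (\<Psi> x) = - h x"
proof -
  have "mink (\<Psi> x) (\<Psi> x) = - (h x)\<^sup>2 + (snd x)\<^sup>2 * m (fst x)"
    by (simp add: \<Psi>_def mink_simps mink_u mink_pp power2_eq_square)
  then show "mink (\<Psi> x) (\<Psi> x) = -1" by (simp add: h_sq)
  show "mink p (\<Psi> x) = - h x" by (simp add: \<Psi>_def mink_simps mink_u mink_pp)
qed

lemma Psi_in: "\<Psi> x \<in> hyp_plane"
  by (rule hyp_planeI[OF p_in]) (simp_all add: mink_Psi h_pos)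

text \<open>With \<open>d\<close> positive, the point lies on the chord from \<open>p\<close> to
  \<open>\<gamma> t\<close>, so convexity puts it in the closed region. It is off the curve because
  it pairs strictly negatively with every \<open>N s\<close>.\<close>

lemma Psi_inner:
  assumes "0 < \<tau>" "\<tau> < 1"
  shows "proj (\<Psi> (t, \<tau>)) \<in> inner_dom"
proof -
  define d where "d = h (t, \<tau>) - \<tau> * c t"
  have "(\<tau> * c t)\<^sup>2 < (h (t, \<tau>))\<^sup>2"
    using assms by (simp add: h_sq m_def power_mult_distrib algebra_simps abs_square_less_1)
  then have d: "d > 0" unfolding d_def
    using power2_less_imp_less[OF _ less_imp_le[OF h_pos]] by simp
  have eq: "\<Psi> (t, \<tau>) = d *\<^sub>R p + \<tau> *\<^sub>R \<gamma> t"
    by (simp add: \<Psi>_def u_def d_def algebra_simps)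
  have "\<Psi> (t, \<tau>) = (d + \<tau>) *\<^sub>R seg p (\<gamma> t) (\<tau> / (d + \<tau>))"
    using d assms by (simp add: eq seg_def scaleR_add_right diff_divide_distrib right_diff_distrib)
  then have "hyp_normalize (\<Psi> (t, \<tau>)) = hyp_normalize (seg p (\<gamma> t) (\<tau> / (d + \<tau>)))"
    using hyp_normalize_scaleR d assms by simp
  then have "proj (\<Psi> (t, \<tau>)) = chord p (\<gamma> t) (\<tau> / (d + \<tau>))"
    by (simp add: chord_def hyp_normalize_eq Psi_in)
  moreover have "z t \<in> closure inner_dom" by (simp add: closure_inner)
  then have "chord p (\<gamma> t) (\<tau> / (d + \<tau>)) \<in> closure inner_dom"
    using d assms p_inner by (intro chord_closure p_in gamma_in) auto
  moreover have "proj (\<Psi> (t, \<tau>)) \<noteq> z s" for s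
  proof
    assume "proj (\<Psi> (t, \<tau>)) = z s"
    then have "\<Psi> (t, \<tau>) = \<gamma> s" using Psi_in gamma_in inj_on_proj by (auto dest: inj_onD)
    then have "mink (\<Psi> (t, \<tau>)) (N s) = 0" by simp
    moreover have "mink (\<gamma> t) (N s) \<le> 0"
      by (intro support_closure gamma_in) (auto simp: closure_inner)
    then have "\<tau> * mink (\<gamma> t) (N s) \<le> 0" using assms by (simp add: mult_nonneg_nonpos)
    moreover have "d * mink p (N s) < 0" using d support[of s] by (simp add: mult_pos_neg)
    ultimately show False by (simp add: eq mink_simps)
  qed
  ultimately show ?thesis by (auto simp: closure_inner)
qed

text \<open>Equal heights over the pole leave \<open>u s\<close> and \<open>u t\<close> on the same
  ray, which meets the curve only once.\<close>

lemma Psi_inj: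
  assumes eq: "\<Psi> (s, \<tau>) = \<Psi> (t, \<tau>')" and pos: "0 < \<tau>" "0 < \<tau>'"
    and st: "s \<in> {0..<2 * pi}" "t \<in> {0..<2 * pi}"
  shows "s = t" "\<tau> = \<tau>'"
proof -
  have "h (s, \<tau>) = h (t, \<tau>')" using mink_Psi(2)[of "(s, \<tau>)"] mink_Psi(2)[of "(t, \<tau>')"] eq by simp
  then have tu: "\<tau> *\<^sub>R u s = \<tau>' *\<^sub>R u t" using eq by (simp add: \<Psi>_def)
  have "u s = (1 / \<tau>) *\<^sub>R (\<tau> *\<^sub>R u s)" using pos by simp
  also have "\<dots> = (\<tau>' / \<tau>) *\<^sub>R u t" unfolding tu by simp
  finally have "u s = (\<tau>' / \<tau>) *\<^sub>R u t" .
  then have "\<gamma> s = \<gamma> t" using pos unfolding u_def by (intro ray_meets_curve_once[of s "\<tau>' / \<tau>" t]) auto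
  then show "s = t" using st gamma_inj by (auto dest: inj_onD)
  have "u t \<noteq> 0" using mink_u(3)[of t] m_pos[of t] by (auto simp: mink_simps)
  then show "\<tau> = \<tau>'" using tu \<open>s = t\<close> by simp
qed

text \<open>The geodesic ray \<open>R\<close> from \<open>p\<close> through \<open>q = R 1\<close>,
  prolonged beyond \<open>q\<close>, is unbounded and must cross the boundary at some
  \<open>R x\<close> with \<open>x > 1\<close>. Seen from that boundary point, \<open>q\<close> has
  radial parameter \<open>1 / x\<close>.\<close>

lemma Psi_surj:
  assumes q: "q \<in> hyp_plane" "proj q \<in> inner_dom" "q \<noteq> p"
  obtains t \<tau> where "t \<in> {0..<2 * pi}" "0 < \<tau>" "\<tau> < 1" "q = \<Psi> (t, \<tau>)"
proof -
  define d where "d = - mink p q"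
  define v where "v = q - d *\<^sub>R p"
  define R where "R x = sqrt (1 + x\<^sup>2 * (d\<^sup>2 - 1)) *\<^sub>R p + x *\<^sub>R v" for x
  have d1: "d > 1" using mink_hyp_plane_le[OF p_in q(1)] q(3) by (fastforce simp: d_def)
  then have D: "d\<^sup>2 - 1 > 0" using power_strict_mono[of 1 d 2] by simp
  have v: "mink p v = 0" "mink v p = 0" "mink v v = d\<^sup>2 - 1"
    using hyp_planeD(1)[OF q(1)]
    by (simp_all add: v_def d_def mink_simps mink_pp mink_commute[of q p] power2_eq_square)
  have pos: "1 + x\<^sup>2 * (d\<^sup>2 - 1) > 0" for x
    using D by (intro add_pos_nonneg) auto
  have Rp: "mink p (R x) = - sqrt (1 + x\<^sup>2 * (d\<^sup>2 - 1))" for x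
    by (simp add: R_def mink_simps v mink_pp)
  have Rin: "R x \<in> hyp_plane" for x
  proof (rule hyp_planeI[OF p_in])
    have "mink (R x) (R x) = - (sqrt (1 + x\<^sup>2 * (d\<^sup>2 - 1)))\<^sup>2 + x\<^sup>2 * (d\<^sup>2 - 1)"
      by (simp add: R_def mink_simps v mink_pp power2_eq_square)
    also have "\<dots> = -1" using pos[of x] by simp
    finally show "mink (R x) (R x) = -1" .
    show "mink p (R x) < 0" using pos[of x] by (simp add: Rp)
  qed
  have R1: "R 1 = q" using d1 by (simp add: R_def v_def)
  have "connected ((\<lambda>x. proj (R x)) ` {1..})"
    unfolding R_def by (intro connected_continuous_image continuous_on_proj continuous_intros) auto
  moreover have "(\<lambda>x. proj (R x)) ` {1..} \<inter> inner_dom \<noteq> {}"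
    using R1 q(2) by force
  moreover have "(\<lambda>x. proj (R x)) ` {1..} - inner_dom \<noteq> {}"
  proof
    assume "(\<lambda>x. proj (R x)) ` {1..} - inner_dom = {}"
    then have "proj ` R ` {1..} \<subseteq> inner_dom" by (auto simp: image_image)
    then have "bounded (proj ` R ` {1..})" using bounded_inner bounded_subset by blast
    then have "bounded (R ` {1..})" using bounded_proj_image_iff[of "R ` {1..}"] Rin by blast
    then have "bounded (mink p ` R ` {1..})"
      by (rule bounded_linear_image[OF _ mink.bounded_linear_right])
    then obtain B where B: "\<And>x. x \<ge> 1 \<Longrightarrow> \<bar>mink p (R x)\<bar> \<le> B"
      by (auto simp: bounded_iff)
    \<comment> \<open>Chosen so that the height at \<open>x\<close> exceeds the bound
      \<open>B\<close>; the lower bound 1 gives \<open>x \<le> x\<^sup>2\<close>.\<close>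
    define x where "x = max 1 ((B\<^sup>2 + 1) / (d\<^sup>2 - 1))"
    have x: "x \<ge> 1" "(B\<^sup>2 + 1) / (d\<^sup>2 - 1) \<le> x" by (simp_all add: x_def)
    then have "B\<^sup>2 + 1 \<le> x * (d\<^sup>2 - 1)" using D by (simp add: field_simps)
    also have "\<dots> \<le> x\<^sup>2 * (d\<^sup>2 - 1)"
      using D x(1) by (intro mult_right_mono) (auto simp: power2_eq_square)
    finally have "B\<^sup>2 < 1 + x\<^sup>2 * (d\<^sup>2 - 1)" by simp
    then have "\<bar>B\<bar> < sqrt (1 + x\<^sup>2 * (d\<^sup>2 - 1))" by (rule real_less_rsqrt[of "\<bar>B\<bar>", simplified])
    then show False using B[OF x(1)] pos[of x] by (simp add: Rp)
  qed
  ultimately have "(\<lambda>x. proj (R x)) ` {1..} \<inter> range z \<noteq> {}"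
    using connected_Int_frontier frontier_inner by metis
  then obtain x s where x: "x \<ge> 1" "proj (R x) = z s" by force
  then have Rs: "R x = \<gamma> s" using Rin gamma_in inj_on_proj by (auto dest: inj_onD)
  obtain n t where t: "t \<in> {0..<0 + 2 * pi}" "s = t + 2 * pi * of_int n" "\<gamma> t = \<gamma> s"
    by (rule gamma_reduce)
  have Rt: "\<gamma> t = R x" using Rs t by simp
  have "x \<noteq> 1" using Rs R1 not_inner_gamma[OF q(2)] by auto
  then have x1: "x > 1" using x(1) by simp
  have ct: "c t = sqrt (1 + x\<^sup>2 * (d\<^sup>2 - 1))" by (simp add: c_def Rt Rp)
  have ut: "u t = x *\<^sub>R v" by (simp add: u_def Rt ct R_def)
  have mt: "m t = x\<^sup>2 * (d\<^sup>2 - 1)" using pos[of x] by (simp add: m_def ct)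
  have "h (t, 1 / x) = d"
    using x1 d1 by (simp add: h_def mt power_divide)
  then have "\<Psi> (t, 1 / x) = q" using x1 by (simp add: \<Psi>_def ut v_def)
  then show ?thesis using that[of t "1 / x"] t x1 by simp
qed

definition \<Psi>2 :: "real \<times> real \<Rightarrow> real \<times> real" where
  "\<Psi>2 x = (\<Psi> x $ 2, \<Psi> x $ 3)"

text \<open>Half-open in the curve parameter to avoid counting a ray twice, open in the radial one
  to leave out the pole and the boundary.\<close>

definition S :: "(real \<times> real) set" where
  "S = {0..<2 * pi} \<times> {0<..<1}"

definition D :: "(real \<times> real) set" where
  "D = {q. hyp_chart q \<in> enclosed_region \<gamma>}"

lemma D_eq: "D = {q. Complex (fst q) (snd q) \<in> inner_dom}"
  by (auto simp: D_def region_eq hyp_chart_eq_lift)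

lemma open_D: "open D"
proof -
  have "continuous_on UNIV (\<lambda>q :: real \<times> real. Complex (fst q) (snd q))"
    unfolding Complex_eq by (intro continuous_intros)
  then have "open ((\<lambda>q :: real \<times> real. Complex (fst q) (snd q)) -` inner_dom)"
    by (rule open_vimage[OF open_inner])
  then show ?thesis by (simp add: D_eq vimage_def)
qed

lemma bounded_D: "bounded D"
proof -
  have "D = (\<lambda>w. (Re w, Im w)) ` inner_dom"
    unfolding D_eq by force
  moreover have "bounded_linear (\<lambda>w. (Re w, Im w))"
    by (intro bounded_linear_Pair bounded_linear_Re bounded_linear_Im)
  ultimately show ?thesis using bounded_linear_image[OF bounded_inner] by metis
qed

lemma Psi2_image: "\<Psi>2 ` S = D - {(p $ 2, p $ 3)}"
proof
  show "\<Psi>2 ` S \<subseteq> D - {(p $ 2, p $ 3)}"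
  proof
    fix y assume "y \<in> \<Psi>2 ` S"
    then obtain t \<tau> where x: "0 < \<tau>" "\<tau> < 1" "y = \<Psi>2 (t, \<tau>)" by (auto simp: S_def)
    have "y \<in> D" using Psi_inner[OF x(1,2), of t] by (simp add: D_eq x(3) \<Psi>2_def proj_def)
    moreover have "y \<noteq> (p $ 2, p $ 3)"
    proof
      assume "y = (p $ 2, p $ 3)"
      then have "proj (\<Psi> (t, \<tau>)) = proj p" by (simp add: x(3) \<Psi>2_def proj_def)
      then have "\<Psi> (t, \<tau>) = p" using Psi_in p_in inj_on_proj by (auto dest: inj_onD)
      then have "(h (t, \<tau>))\<^sup>2 = 1" using mink_Psi(2)[of "(t, \<tau>)"] by (simp add: mink_pp)
      then show False using x m_pos[of t] by (simp add: h_sq)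
    qed
    ultimately show "y \<in> D - {(p $ 2, p $ 3)}" by simp
  qed
  show "D - {(p $ 2, p $ 3)} \<subseteq> \<Psi>2 ` S"
  proof
    fix y assume y: "y \<in> D - {(p $ 2, p $ 3)}"
    define q where "q = hyp_chart y"
    have q: "q \<in> hyp_plane" "proj q \<in> inner_dom" "(q $ 2, q $ 3) = y"
      using y by (auto simp: q_def hyp_chart_eq_lift D_eq) (simp add: lift_def hyp_chart_def)
    then have "q \<noteq> p" using y by auto
    then obtain t \<tau> where "t \<in> {0..<2 * pi}" "0 < \<tau>" "\<tau> < 1" "q = \<Psi> (t, \<tau>)"
      using Psi_surj q by metis
    then show "y \<in> \<Psi>2 ` S" using q(3) by (intro image_eqI[of _ _ "(t, \<tau>)"]) (auto simp: S_def \<Psi>2_def)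
  qed
qed

lemma inj_Psi2: "inj_on \<Psi>2 S"
proof
  fix x y assume xy: "x \<in> S" "y \<in> S" "\<Psi>2 x = \<Psi>2 y"
  then have "proj (\<Psi> x) = proj (\<Psi> y)" by (simp add: \<Psi>2_def proj_def)
  then have "\<Psi> x = \<Psi> y" by (rule inj_onD[OF inj_on_proj _ Psi_in Psi_in])
  then show "x = y" using Psi_inj[of "fst x" "snd x" "fst y" "snd y"] xy
    by (auto simp: S_def prod_eq_iff)
qed

definition u' :: "real \<Rightarrow> real^3" where "u' t = \<sigma> t *\<^sub>R T t - (\<sigma> t * a t) *\<^sub>R p"
definition Psi_t :: "real \<times> real \<Rightarrow> real^3" where
  "Psi_t x = ((snd x)\<^sup>2 * c (fst x) * (\<sigma> (fst x) * a (fst x)) / h x) *\<^sub>R p + snd x *\<^sub>R u' (fst x)"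
definition Psi_tau :: "real \<times> real \<Rightarrow> real^3" where
  "Psi_tau x = (snd x * m (fst x) / h x) *\<^sub>R p + u (fst x)"

lemma D_Psi: "(\<Psi> has_derivative (\<lambda>k. fst k *\<^sub>R Psi_t x + snd k *\<^sub>R Psi_tau x)) (at x)"
proof -
  have D_u: "(u has_vector_derivative u' t) (at t)" for t
  proof -
    have "((\<lambda>t. c t *\<^sub>R p) has_vector_derivative (\<sigma> t * a t) *\<^sub>R p) (at t)"
      using has_vector_derivative_scaleR[OF D_c[of t] has_vector_derivative_const[of p]] by simp
    from has_vector_derivative_diff[OF D_gamma_T this] show ?thesis
      by (simp add: u_def[abs_def] u'_def)
  qed
  have fst_D: "(fst has_derivative fst) (at x)" for x :: "real \<times> real"
    using has_derivative_fst[OF has_derivative_ident] .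
  have du: "((\<lambda>x. u (fst x)) has_derivative (\<lambda>k. fst k *\<^sub>R u' (fst x))) (at x)"
    using has_derivative_compose[OF has_derivative_fst[OF has_derivative_ident]
          D_u[unfolded has_vector_derivative_def]] .
  have dm: "((\<lambda>x. m (fst x)) has_derivative (\<lambda>k. fst k * (2 * c (fst x) * (\<sigma> (fst x) * a (fst x))))) (at x)"
  proof -
    have "(m has_real_derivative 2 * c t * (\<sigma> t * a t)) (at t)" for t
      unfolding m_def[abs_def] by (auto intro!: derivative_eq_intros D_c)
    from DERIV_compose_FDERIV[OF this fst_D] show ?thesis .
  qed
  have pos: "1 + (snd x)\<^sup>2 * m (fst x) > 0"
    using m_pos[of "fst x"] by (intro add_pos_nonneg) auto
  have dw: "((\<lambda>x. 1 + (snd x)\<^sup>2 * m (fst x)) has_derivative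
     (\<lambda>k. fst k * ((snd x)\<^sup>2 * (2 * c (fst x) * (\<sigma> (fst x) * a (fst x)))) + snd k * (2 * snd x * m (fst x)))) (at x)"
    by (rule derivative_eq_intros dm refl)+ (simp add: fun_eq_iff algebra_simps)
  have dh: "(h has_derivative (\<lambda>k. fst k * ((snd x)\<^sup>2 * c (fst x) * (\<sigma> (fst x) * a (fst x)) / h x)
       + snd k * (snd x * m (fst x) / h x))) (at x)"
    unfolding h_def[abs_def]
    by (rule has_derivative_eq_rhs[OF DERIV_compose_FDERIV[OF DERIV_real_sqrt[OF pos] dw]])
      (simp add: fun_eq_iff divide_simps)
  show ?thesis
    unfolding \<Psi>_def[abs_def]
    by (rule derivative_eq_intros dh du refl)+ (simp add: fun_eq_iff Psi_t_def Psi_tau_def algebra_simps)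
qed

lemma mink_u': "mink p (u' t) = 0" "mink (u t) (u' t) = c t * (\<sigma> t * a t)"
  by (simp_all add: u'_def u_def a_def c_def mink_simps mink_pp mink_commute[of "\<gamma> t" p])

text \<open>The polar area element is $\sinh r\,dr\,d\theta$; here the radial parameter is
  \<open>\<tau> = sinh r / sinh r\<^sub>0\<close> with \<open>r\<^sub>0\<close> the distance from the pole to \<open>\<gamma> t\<close>.\<close>

lemma jacobian:
  assumes "snd x > 0"
  shows "\<bar>Psi_t x $ 2 * Psi_tau x $ 3 - Psi_t x $ 3 * Psi_tau x $ 2\<bar> * hyp_area_density (\<Psi>2 x)
    = snd x * (\<sigma> (fst x) * b (fst x)) / h x"
proof -
  define \<tau> t where "\<tau> = snd x" and "t = fst x"
  define \<alpha> \<beta> where "\<alpha> = \<tau>\<^sup>2 * c t * (\<sigma> t * a t) / h x" and "\<beta> = \<tau> * m t / h x"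
  have Psi_t: "Psi_t x = \<alpha> *\<^sub>R p + \<tau> *\<^sub>R u' t" and Psi_tau: "Psi_tau x = \<beta> *\<^sub>R p + u t" and Psi: "\<Psi> x = h x *\<^sub>R p + \<tau> *\<^sub>R u t"
    by (simp_all add: Psi_t_def Psi_tau_def \<Psi>_def \<alpha>_def \<beta>_def \<tau>_def t_def)
  have h: "h x > 0" "(h x)\<^sup>2 = 1 + \<tau>\<^sup>2 * m t" using h_pos h_sq by (simp_all add: \<tau>_def t_def)
  \<comment> \<open>Both partial derivatives are tangent to the hyperboloid, so their cross product
    is a multiple of \<open>\<Psi> x\<close>. Its first component is, up to sign, the chart
    Jacobian, and the factor \<open>\<Psi> x $ 1\<close> will cancel against the area
    density.\<close>
  have "mink (\<Psi> x) (Psi_t x) = 0" "mink (\<Psi> x) (Psi_tau x) = 0"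
    using h by (simp_all add: Psi_t Psi_tau Psi \<alpha>_def \<beta>_def mink_simps mink_u mink_u' mink_pp
        power2_eq_square)
  from lcross_tangent[OF mink_Psi(1) this]
  have V: "lcross (Psi_t x) (Psi_tau x) $ 1 = - mink (lcross (Psi_t x) (Psi_tau x)) (\<Psi> x) * \<Psi> x $ 1"
    by (metis vector_scaleR_component real_scaleR_def)
  \<comment> \<open>The triple product that survives the expansion; its sign depends on the
    orientation, its absolute value is \<open>\<sigma> t * b t\<close>.\<close>
  define E where "E = mink (lcross (u t) (u' t)) p"
  have r1: "mink (lcross (u' t) (u t)) p = - E" unfolding E_def by (rule mink_lcross_swap)
  have r3: "mink (lcross (u' t) p) (u t) = E"
    unfolding E_def by (simp add: mink_lcross_rotate[of "u' t" p] mink_lcross_rotate[of p "u t"])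
  have "mink (lcross (Psi_t x) (Psi_tau x)) (\<Psi> x) = - (\<tau> * E * (h x - \<tau> * \<beta>))"
    unfolding Psi_t Psi_tau Psi
    by (simp add: lcross.add_left lcross.add_right lcross.scaleR_left lcross.scaleR_right
        mink_simps r1 r3 algebra_simps)
  also have "h x - \<tau> * \<beta> = 1 / h x"
    using h by (simp add: \<beta>_def field_simps power2_eq_square)
  finally have VE: "mink (lcross (Psi_t x) (Psi_tau x)) (\<Psi> x) = - (\<tau> * E / h x)" by simp
  have "E = \<sigma> t * mink (lcross (\<gamma> t) (T t)) p"
    unfolding E_def u_def u'_def
    by (simp add: lcross.diff_left lcross.diff_right lcross.scaleR_left lcross.scaleR_right mink_simps)
  then have "\<bar>E\<bar> = \<sigma> t * b t"
    using b_pos[of t] speed_pos[of t] orient(1)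
    by (auto simp: b_def N_def mink_simps mink_commute[of p "nrm t"] abs_mult simp flip: nrm_def)
  then have "\<bar>lcross (Psi_t x) (Psi_tau x) $ 1\<bar> = \<tau> * (\<sigma> t * b t) / h x * \<Psi> x $ 1"
    unfolding V VE using h(1) assms hyp_planeD(2)[OF Psi_in[of x]] by (simp add: abs_mult \<tau>_def)
  then show ?thesis
    using hyp_area_density_coords[OF Psi_in[of x]] hyp_planeD(2)[OF Psi_in[of x]]
    by (simp add: \<Psi>2_def abs_minus_commute mult.commute \<tau>_def t_def)
qed

text \<open>Fubini on the closed box, with the radial integral equal to
  \<open>(c t - 1) / m t = 1 / (c t + 1)\<close> up to the factor \<open>\<sigma> t * b t\<close>.
  The box exceeds \<open>S\<close> only within three lines.\<close>

lemma has_integral_S: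
  "((\<lambda>x. snd x * (\<sigma> (fst x) * b (fst x)) / h x) has_integral
     integral {0..2 * pi} (\<lambda>t. \<sigma> t * b t / (c t + 1))) S"
proof -
  let ?F = "\<lambda>x. snd x * (\<sigma> (fst x) * b (fst x)) / h x"
  have comp: "continuous_on X (\<lambda>x :: real \<times> real. f (fst x))" if "continuous_on UNIV f" for f :: "real \<Rightarrow> real" and X
    using that by (rule continuous_on_compose2) (auto intro!: continuous_intros)
  have hne: "h x \<noteq> 0" for x using h_pos[of x] by simp
  have cont_h: "continuous_on X h" for X
    unfolding h_def m_def by (intro continuous_intros comp cont_abc)
  have cont: "continuous_on (cbox (0, 0) (2 * pi, 1)) ?F"
    using hne by (intro continuous_intros comp cont_speed cont_abc cont_h) auto
  have inner: "integral {0..1} (\<lambda>\<tau>. ?F (t, \<tau>)) = \<sigma> t * b t / (c t + 1)" for t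
  proof -
    have "((\<lambda>\<tau>. (\<sigma> t * b t) * (\<tau> / sqrt (1 + \<tau>\<^sup>2 * m t))) has_integral (\<sigma> t * b t) * ((sqrt (1 + m t) - 1) / m t)) {0..1}"
      using m_pos[of t] by (intro has_integral_mult_right has_integral_radial) auto
    moreover have "sqrt (1 + m t) = c t" using c_gt[of t] by (simp add: m_def)
    moreover have "m t = (c t - 1) * (c t + 1)" by (simp add: m_def power2_eq_square algebra_simps)
    then have "(c t - 1) / m t = 1 / (c t + 1)" using c_gt[of t] by simp
    ultimately have "((\<lambda>\<tau>. (\<sigma> t * b t) * (\<tau> / sqrt (1 + \<tau>\<^sup>2 * m t))) has_integral (\<sigma> t * b t) * (1 / (c t + 1))) {0..1}"
      by simp
    then show ?thesis by (simp add: h_def integral_unique mult.commute)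
  qed
  have "(?F has_integral integral (cbox (0, 0) (2 * pi, 1)) ?F) (cbox (0, 0) (2 * pi, 1))"
    by (intro integrable_integral integrable_continuous cont)
  also have "integral (cbox (0, 0) (2 * pi, 1)) ?F = integral {0..2 * pi} (\<lambda>t. \<sigma> t * b t / (c t + 1))"
    unfolding integral_prod_continuous[OF cont] by (simp add: inner[simplified])
  finally have "(?F has_integral integral {0..2 * pi} (\<lambda>t. \<sigma> t * b t / (c t + 1))) (cbox (0, 0) (2 * pi, 1))" .
  moreover have "negligible (cbox (0, 0) (2 * pi, 1) - S)"
  proof (rule negligible_subset)
    have "negligible {x :: real \<times> real. x \<bullet> (1, 0) = 2 * pi}" "negligible {x :: real \<times> real. x \<bullet> (0, 1) = e}" for e
      by (intro negligible_standard_hyperplane; simp add: Basis_prod_def)+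
    then show "negligible ({x :: real \<times> real. x \<bullet> (1, 0) = 2 * pi} \<union> {x. x \<bullet> (0, 1) = 0} \<union> {x. x \<bullet> (0, 1) = 1})"
      by (simp only: negligible_Un_eq simp_thms)
    show "cbox (0, 0) (2 * pi, 1) - S \<subseteq> {x :: real \<times> real. x \<bullet> (1, 0) = 2 * pi} \<union> {x. x \<bullet> (0, 1) = 0} \<union> {x. x \<bullet> (0, 1) = 1}"
      by (auto simp: S_def cbox_Pair_eq)
  qed
  moreover have "S - cbox (0, 0) (2 * pi, 1) = {}" by (auto simp: S_def cbox_Pair_eq)
  ultimately show ?thesis
    by (subst has_integral_spike_set_eq[of S "cbox (0, 0) (2 * pi, 1)"]) (auto intro: negligible_subset)
qed

text \<open>The parametrization misses only the pole, a null set. Positivity of the density turns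
  the gauge integral of the change of variables into a Lebesgue integral.\<close>

lemma area: "hyp_area (enclosed_region \<gamma>) = integral {0..2 * pi} (\<lambda>t. \<sigma> t * b t / (c t + 1))"
proof -
  let ?V = "integral {0..2 * pi} (\<lambda>t. \<sigma> t * b t / (c t + 1))"
  have "(hyp_area_density has_integral ?V) (\<Psi>2 ` S)"
  proof (rule has_integral_change_of_variables_pair)
    show "S \<in> sets borel" unfolding S_def by (intro borel_Times) auto
    show "bounded S" unfolding S_def by (intro bounded_Times) (auto intro: bounded_subset[OF bounded_closed_interval])
    show "bounded (\<Psi>2 ` S)" unfolding Psi2_image by (rule bounded_subset[OF bounded_D]) blast
    show "inj_on \<Psi>2 S" by (rule inj_Psi2)
    show "(\<Psi>2 has_derivative (\<lambda>k. fst k *\<^sub>R (Psi_t x $ 2, Psi_t x $ 3) + snd k *\<^sub>R (Psi_tau x $ 2, Psi_tau x $ 3))) (at x)" for x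
      using bounded_linear.has_derivative[OF bounded_linear_Pair[OF bounded_linear_vec_nth[of 2] bounded_linear_vec_nth[of 3]] D_Psi[of x]]
      by (simp add: \<Psi>2_def[abs_def])
    show "hyp_area_density x \<ge> 0" for x using hyp_area_density_pos[of x] by simp
    show "((\<lambda>x. \<bar>fst (Psi_t x $ 2, Psi_t x $ 3) * snd (Psi_tau x $ 2, Psi_tau x $ 3) - snd (Psi_t x $ 2, Psi_t x $ 3) * fst (Psi_tau x $ 2, Psi_tau x $ 3)\<bar>
       * hyp_area_density (\<Psi>2 x)) has_integral ?V) S"
      by (rule has_integral_eq[OF _ has_integral_S]) (auto simp: S_def jacobian)
  qed
  then have int: "(hyp_area_density has_integral ?V) D"
    unfolding Psi2_image
    by (subst (asm) has_integral_spike_set_eq[of _ D])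
      (auto intro!: negligible_subset[OF negligible_sing[of "(p $ 2, p $ 3)"]])
  then have "hyp_area_density absolutely_integrable_on D"
    by (intro nonnegative_absolutely_integrable_1) (auto intro: less_imp_le hyp_area_density_pos)
  then have "set_lebesgue_integral lebesgue D hyp_area_density = ?V"
    using int by (simp add: set_lebesgue_integral_eq_integral integral_unique)
  \<comment> \<open>For a Borel integrand the completed measure gives the same integral as
    \<open>lborel\<close>, in which the area is defined.\<close>
  moreover have "set_lebesgue_integral lebesgue D hyp_area_density = set_lebesgue_integral lborel D hyp_area_density"
  proof -
    have "hyp_area_density \<in> borel_measurable lborel"
      using borel_measurable_continuous_onI[OF continuous_on_hyp_area_density] by simp
    then have "(\<lambda>x. indicat_real D x *\<^sub>R hyp_area_density x) \<in> borel_measurable lborel"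
      using open_D by (intro borel_measurable_scaleR borel_measurable_indicator) auto
    then show ?thesis
      unfolding set_lebesgue_integral_def by (rule integral_completion)
  qed
  ultimately show ?thesis by (simp add: hyp_area_def D_def)
qed

lemma Gauss_Bonnet: "integral {0..2 * pi} (\<lambda>t. k t * \<sigma> t) = 2 * pi + hyp_area (enclosed_region \<gamma>)"
  using total_curvature total_angle area by simp

end

context horoconvex_curve
begin

text \<open>Any inner point can serve as pole, since it no longer occurs in the formula.\<close>

lemma Gauss_Bonnet: "integral {0..2 * pi} (\<lambda>t. k t * \<sigma> t) = 2 * pi + hyp_area (enclosed_region \<gamma>)"
proof -
  obtain w where "w \<in> inner_dom" using inner_ne by blast
  then interpret inner_pole \<gamma> "lift w" by unfold_locales simp_all
  show ?thesis by (rule Gauss_Bonnet)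
qed

end

section \<open>The sharpened inequality and its equality case\<close>

lemma integral_product_pair:
  fixes f g :: "real \<Rightarrow> real"
  assumes "continuous_on {a..b} f" "continuous_on {c..d} g"
  shows "((\<lambda>(s, t). f s * g t) has_integral integral {a..b} f * integral {c..d} g) ({a..b} \<times> {c..d})"
proof -
  have eq: "{a..b} \<times> {c..d} = cbox (a, c) (b, d)" by (simp add: cbox_Pair_eq)
  have cont: "continuous_on (cbox (a, c) (b, d)) (\<lambda>(s, t). f s * g t)"
    unfolding eq[symmetric] split_beta
    by (intro continuous_intros continuous_on_compose2[OF assms(1)] continuous_on_compose2[OF assms(2)]) auto
  have "integral (cbox (a, c) (b, d)) (\<lambda>(s, t). f s * g t) = integral {a..b} f * integral {c..d} g"
    by (subst integral_prod_continuous[OF cont]) simp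
  then show ?thesis unfolding eq
    using integrable_integral[OF integrable_continuous[OF cont]] by simp
qed

lemma hyp_dist_eq_iff:
  assumes "p \<in> hyp_plane" "x \<in> hyp_plane" "r > 0"
  shows "hyp_dist p x = r \<longleftrightarrow> mink p x = - cosh r"
proof
  assume "hyp_dist p x = r"
  then have "cosh (arcosh (- mink p x)) = cosh r" by (simp add: hyp_dist_def)
  then show "mink p x = - cosh r"
    using mink_hyp_plane_le(1)[OF assms(1,2)] by (simp add: cosh_arcosh_real)
qed (use assms in \<open>simp add: hyp_dist_def arcosh_cosh_real\<close>)

context horoconvex_curve
begin

abbreviation "kE \<equiv> horo_curvature \<gamma>"

lemma kE_sq: "kE t * kE t = (k t)\<^sup>2 - 1"
  using k_sq[of t] by (simp add: horo_curvature_def)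

lemma cont_kE: "continuous_on S kE"
  unfolding horo_curvature_def[abs_def] by (intro continuous_intros cont_k)

abbreviation "remainder_density s t \<equiv>
  (k s - k t)\<^sup>2 / (sqrt (((k s)\<^sup>2 - 1) * ((k t)\<^sup>2 - 1)) + k s * k t - 1)"

lemma denominator_pos: "sqrt (((k s)\<^sup>2 - 1) * ((k t)\<^sup>2 - 1)) + k s * k t - 1 > 0"
proof -
  have "k s * k t > 1" using k_gt[of s] k_gt[of t] by (metis less_1_mult)
  moreover have "sqrt (((k s)\<^sup>2 - 1) * ((k t)\<^sup>2 - 1)) \<ge> 0" using k_sq[of s] k_sq[of t] by simp
  ultimately show ?thesis by linarith
qed

text \<open>A difference of two squares: (k k' - 1)^2 - (k^2 - 1)(k'^2 - 1) = (k - k')^2.\<close>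

lemma remainder_density_eq: "remainder_density s t = k s * k t - 1 - kE s * kE t"
proof -
  have r: "sqrt (((k s)\<^sup>2 - 1) * ((k t)\<^sup>2 - 1)) = kE s * kE t"
    by (simp add: horo_curvature_def real_sqrt_mult)
  have "(kE s * kE t) * (kE s * kE t) = ((k s)\<^sup>2 - 1) * ((k t)\<^sup>2 - 1)"
    by (simp add: kE_sq[symmetric])
  then have "(k s - k t)\<^sup>2 = (k s * k t - 1 - kE s * kE t) * (kE s * kE t + k s * k t - 1)"
    by (simp add: power2_eq_square algebra_simps)
  then show ?thesis using denominator_pos[of s t] unfolding r by (simp add: nonzero_divide_eq_eq)
qed

text \<open>In the form without quotient each term is a product of a function of \<open>s\<close>
  and the same function of \<open>t\<close>, so each double integral is a square.\<close>

lemma remainder_has_integral: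
  "((\<lambda>(s, t). remainder_density s t * \<sigma> s * \<sigma> t) has_integral
     (integral {0..2 * pi} (\<lambda>t. k t * \<sigma> t))\<^sup>2 - (curve_length \<gamma>)\<^sup>2 - (arc_integral \<gamma> kE)\<^sup>2)
   ({0..2 * pi} \<times> {0..2 * pi})"
proof -
  have prod: "((\<lambda>(s, t). (f s * \<sigma> s) * (f t * \<sigma> t)) has_integral (integral {0..2 * pi} (\<lambda>t. f t * \<sigma> t))\<^sup>2)
      ({0..2 * pi} \<times> {0..2 * pi})" if "continuous_on {0..2 * pi} f" for f
    unfolding power2_eq_square
    by (intro integral_product_pair continuous_intros that cont_speed)
  have "((\<lambda>x. (case x of (s, t) \<Rightarrow> (k s * \<sigma> s) * (k t * \<sigma> t))
       - (case x of (s, t) \<Rightarrow> (1 * \<sigma> s) * (1 * \<sigma> t)) - (case x of (s, t) \<Rightarrow> (kE s * \<sigma> s) * (kE t * \<sigma> t))) has_integral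
      (integral {0..2 * pi} (\<lambda>t. k t * \<sigma> t))\<^sup>2 - (integral {0..2 * pi} (\<lambda>t. 1 * \<sigma> t))\<^sup>2
       - (integral {0..2 * pi} (\<lambda>t. kE t * \<sigma> t))\<^sup>2) ({0..2 * pi} \<times> {0..2 * pi})"
    by (intro has_integral_diff prod cont_k cont_kE continuous_on_const)
  moreover have "(\<lambda>x. (case x of (s, t) \<Rightarrow> (k s * \<sigma> s) * (k t * \<sigma> t))
       - (case x of (s, t) \<Rightarrow> (1 * \<sigma> s) * (1 * \<sigma> t)) - (case x of (s, t) \<Rightarrow> (kE s * \<sigma> s) * (kE t * \<sigma> t)))
     = (\<lambda>(s, t). remainder_density s t * \<sigma> s * \<sigma> t)"
    unfolding remainder_density_eq by (simp add: fun_eq_iff algebra_simps)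
  ultimately show ?thesis by (simp add: curve_length_def arc_integral_def)
qed

lemma curvature_remainder_eq: "curvature_remainder \<gamma>
   = (integral {0..2 * pi} (\<lambda>t. k t * \<sigma> t))\<^sup>2 - (curve_length \<gamma>)\<^sup>2 - (arc_integral \<gamma> kE)\<^sup>2"
  unfolding curvature_remainder_def arc_integral2_def
  using remainder_has_integral by (rule integral_unique)

lemma remainder_integrand_nonneg: "remainder_density s t * \<sigma> s * \<sigma> t \<ge> 0"
  using denominator_pos[of s t] speed_pos[of s] speed_pos[of t]
  by (intro mult_nonneg_nonneg divide_nonneg_pos) auto

lemma curvature_remainder_nonneg: "curvature_remainder \<gamma> \<ge> 0"
  unfolding curvature_remainder_eq
  by (rule has_integral_nonneg[OF remainder_has_integral]) (use remainder_integrand_nonneg in auto)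

lemma curvature_remainder_eq_0_iff:
  "curvature_remainder \<gamma> = 0 \<longleftrightarrow> (\<forall>s\<in>{0..2 * pi}. \<forall>t\<in>{0..2 * pi}. k s = k t)"
proof -
  have eq: "{0..2 * pi} \<times> {0..2 * pi} = cbox (0, 0) (2 * pi, 2 * pi)" by (simp add: cbox_Pair_eq)
  have comp: "continuous_on X (\<lambda>x :: real \<times> real. f (fst x))" "continuous_on X (\<lambda>x :: real \<times> real. f (snd x))"
    if "continuous_on UNIV f" for f :: "real \<Rightarrow> real" and X
    by (rule continuous_on_compose2[OF that]; simp add: continuous_on_fst continuous_on_snd)+
  have cont: "continuous_on (cbox (0, 0) (2 * pi, 2 * pi)) (\<lambda>(s, t). remainder_density s t * \<sigma> s * \<sigma> t)"
    \<comment> \<open>Continuity is read off from the form without quotient; a continuous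
      nonnegative integrand with integral 0 vanishes everywhere on the box.\<close>
    unfolding remainder_density_eq split_beta
    by (intro continuous_intros comp cont_k cont_kE cont_speed)
  have "curvature_remainder \<gamma> = 0 \<longleftrightarrow>
      (\<forall>x\<in>cbox (0, 0) (2 * pi, 2 * pi). (\<lambda>(s, t). remainder_density s t * \<sigma> s * \<sigma> t) x = 0)"
    unfolding curvature_remainder_def arc_integral2_def eq
    by (rule integral_cbox_eq_0_iff[OF cont])
      (use remainder_integrand_nonneg in \<open>auto simp: box_eq_empty Basis_prod_def not_le\<close>)
  also have "\<dots> \<longleftrightarrow> (\<forall>s\<in>{0..2 * pi}. \<forall>t\<in>{0..2 * pi}. k s = k t)"
  proof -
    have "remainder_density s t * \<sigma> s * \<sigma> t = 0 \<longleftrightarrow> k s = k t" for s t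
      using denominator_pos[of s t] by simp
    then show ?thesis unfolding eq[symmetric] by auto
  qed
  finally show ?thesis .
qed

text \<open>Differentiating the constant \<open>mink p (\<gamma> u)\<close> gives
  \<open>mink p (T u) = 0\<close>; differentiating again gives
  \<open>k u * mink p (N u) = - cosh r\<close>. The factor \<open>mink p (N u)\<close> is itself
  constant.\<close>

lemma geodesic_circle_imp_constant:
  assumes "geodesic_circle (range \<gamma>)" shows "k s = k t"
proof -
  obtain p r where p: "p \<in> hyp_plane" "r > 0" "range \<gamma> = {x \<in> hyp_plane. hyp_dist p x = r}"
    using assms by (auto simp: geodesic_circle_def)
  have "\<gamma> u \<in> {x \<in> hyp_plane. hyp_dist p x = r}" for u using p(3) by blast
  then have c: "mink p (\<gamma> u) = - cosh r" for u using hyp_dist_eq_iff[OF p(1) gamma_in p(2)] by blast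
  have "\<sigma> u * mink p (T u) = 0" for u
    using DERIV_unique[OF mink_const_vector_derivatives(1)[of p u], of 0] c by simp
  then have T0: "mink p (T u) = 0" for u by simp
  have "\<sigma> u * (mink p (\<gamma> u) - k u * mink p (N u)) = 0" for u
    using DERIV_unique[OF mink_const_vector_derivatives(2)[of p u], of 0] T0 by simp
  then have kN: "k u * mink p (N u) = - cosh r" for u using c by simp
  have "mink p (N s) = mink p (N t)"
    by (rule DERIV_isconst_all) (use mink_const_vector_derivatives(3)[of p] in \<open>simp add: T0\<close>)
  then have "k s * mink p (N s) = k t * mink p (N s)" using kN[of s] kN[of t] by simp
  moreover have "mink p (N s) \<noteq> 0" using kN[of s] cosh_real_pos[of r] by auto
  ultimately show ?thesis by simp
qed

text \<open>The centre is \<open>V\<close> normalized, and \<kappa> = coth r for the radius r. That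
  the curve fills the whole circle follows because it sweeps at least one full turn about the
  centre.\<close>

lemma constant_imp_geodesic_circle:
  assumes const: "\<forall>s\<in>{0..2 * pi}. \<forall>t\<in>{0..2 * pi}. k s = k t"
  shows "geodesic_circle (range \<gamma>)"
proof -
  define \<kappa> where "\<kappa> = k 0"
  define q where "q = sqrt (\<kappa>\<^sup>2 - 1)"
  \<comment> \<open>Both \<open>\<kappa> *\<^sub>R \<gamma> t\<close> and \<open>N t\<close> have
    derivative \<open>(\<sigma> t * \<kappa>) *\<^sub>R T t\<close>, so \<open>V\<close> is
    constant.\<close>
  define V where "V t = \<kappa> *\<^sub>R \<gamma> t - N t" for t
  define p where "p = V 0 /\<^sub>R q"
  have \<kappa>: "\<kappa> > 1" "\<kappa>\<^sup>2 > 1" using k_gt k_sq by (simp_all add: \<kappa>_def)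
  have q: "q > 0" "q * q = \<kappa>\<^sup>2 - 1" using \<kappa> by (simp_all add: q_def)
  have V0: "V t = V 0" for t
  proof -
    have "(V has_vector_derivative 0) (at t within {0..2 * pi})" if "t \<in> {0..2 * pi}" for t
    proof -
      have "k t = \<kappa>" using const[rule_format, OF that, of 0] by (simp add: \<kappa>_def)
      have "((\<lambda>t. \<kappa> *\<^sub>R \<gamma> t) has_vector_derivative \<kappa> *\<^sub>R \<sigma> t *\<^sub>R T t) (at t)"
        using has_vector_derivative_scaleR[OF DERIV_const[of \<kappa>] D_gamma_T[of t]] by simp
      from has_vector_derivative_diff[OF this D_N[of t]] have "(V has_vector_derivative 0) (at t)"
        by (simp add: V_def[abs_def] \<open>k t = \<kappa>\<close> mult.commute)
      then show ?thesis by (rule has_vector_derivative_at_within)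
    qed
    then obtain w where w: "\<And>t. t \<in> {0..2 * pi} \<Longrightarrow> V t = w"
      by (rule has_vector_derivative_zero_constant[OF convex_real_interval(5)]) (assumption, rule that)
    obtain n s where s: "s \<in> {0..<0 + 2 * pi}" "t = s + 2 * pi * of_int n" "\<gamma> s = \<gamma> t"
      by (rule gamma_reduce)
    \<comment> \<open>The curvature is known to be constant on one period only; periodicity carries
      the value of \<open>V\<close> to all parameters.\<close>
    have "V (s + 2 * pi * of_int n) = V s"
    proof (induction n rule: int_induct[of _ 0])
      case base
      then show ?case by simp
    next
      case (step1 i)
      then show ?case using gamma_period[of "s + 2 * pi * of_int i"] N_period[of "s + 2 * pi * of_int i"]
        by (simp add: V_def algebra_simps)
    next
      case (step2 i)
      then show ?case using gamma_period[of "s + 2 * pi * of_int (i - 1)"] N_period[of "s + 2 * pi * of_int (i - 1)"]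
        by (simp add: V_def algebra_simps)
    qed
    then show ?thesis using w[of s] w[of 0] s by simp
  qed
  have p_eq: "p = (\<kappa> *\<^sub>R \<gamma> t - N t) /\<^sub>R q" for t
    unfolding p_def V0[of t, symmetric] by (simp add: V_def)
  have p_gamma: "mink p (\<gamma> t) = - (\<kappa> / q)" for t
    by (subst p_eq[of t]) (simp add: mink_simps mink_gamma divide_inverse mult.commute)
  have p_in: "p \<in> hyp_plane"
  proof (rule hyp_planeI[OF gamma_in[of 0]])
    have "mink (\<kappa> *\<^sub>R \<gamma> 0 - N 0) (\<kappa> *\<^sub>R \<gamma> 0 - N 0) = - (q * q)"
      unfolding q(2) by (simp add: mink_simps mink_gamma power2_eq_square)
    then show "mink p p = -1"
      unfolding p_eq[of 0] mink.scaleR_left mink.scaleR_right using q(1) by (simp add: field_simps)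
    show "mink (\<gamma> 0) p < 0"
      using p_gamma[of 0] q \<kappa> by (simp add: mink_commute[of "\<gamma> 0" p])
  qed
  \<comment> \<open>The centre is not yet known to lie inside, but it satisfies the support
    inequality with \<open>mink p (N t) = - 1 / q\<close>.\<close>
  interpret pole \<gamma> p
  proof
    show "mink p (N t) < 0" for t
      using q(1) by (subst p_eq[of t]) (simp add: mink_simps)
  qed (rule p_in)
  have c: "c t = \<kappa> / q" for t by (simp add: c_def p_gamma)
  define r where "r = arcosh (\<kappa> / q)"
  have cr: "cosh r = \<kappa> / q" "r > 0"
    using c_gt[of 0] unfolding c r_def by (auto simp: cosh_arcosh_real)
  have "x \<in> range \<gamma>" if x: "x \<in> hyp_plane" "mink p x = - cosh r" for x
  proof -
    define w where "w = Complex (mink x e1) (mink x e2)"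
    have "mink x x = - (cosh r)\<^sup>2 + (mink x e1)\<^sup>2 + (mink x e2)\<^sup>2"
      using pframe.mink_expand[of x x] x(2) by (simp add: mink_commute[of x p] power2_eq_square)
    then have "(norm w)\<^sup>2 = (cosh r)\<^sup>2 - 1"
      using hyp_planeD(1)[OF x(1)] by (simp add: w_def cmod_power2)
    moreover have nz: "(norm (\<zeta> t))\<^sup>2 = (cosh r)\<^sup>2 - 1" for t
      by (simp add: cmod_power2 norm_zeta c cr)
    ultimately have "norm w = norm (\<zeta> 0)" by (metis norm_ge_zero power2_eq_iff_nonneg)
    then have "norm (w / \<zeta> 0) = 1" using zeta_nz[of 0] by (simp add: norm_divide)
    then obtain \<alpha> where \<alpha>: "0 \<le> \<alpha>" "\<alpha> < 2 * pi" "w / \<zeta> 0 = Complex (cos \<alpha>) (sin \<alpha>)"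
      by (rule complex_unimodular_polar)
    obtain m :: int where m: "W (2 * pi) = 2 * pi * of_int m" "m \<ge> 1" by (rule W_multiple)
    \<comment> \<open>A full turn at least is swept, so the angle of \<open>w\<close> is attained;
      since \<open>\<zeta>\<close> has constant modulus, it takes the value \<open>w\<close>
      there.\<close>
    have "2 * pi * 1 \<le> W (2 * pi)" unfolding m(1) using m(2) by (intro mult_left_mono) auto
    then obtain t where t: "0 \<le> t" "t \<le> 2 * pi" "W t = \<alpha>"
      using W_IVT[of \<alpha>] \<alpha> by auto
    obtain \<rho> where \<rho>: "\<rho> > 0" "\<zeta> t = \<zeta> 0 * of_real \<rho> * exp (\<i> * of_real (W t))"
      by (rule zeta_polar[OF t(1)])
    have "norm (\<zeta> t) = norm (\<zeta> 0)" using nz by (metis norm_ge_zero power2_eq_iff_nonneg)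
    then have "\<rho> = 1" using \<rho> zeta_nz[of 0] by (simp add: norm_mult)
    then have "\<zeta> t = \<zeta> 0 * cis \<alpha>" using \<rho> t(3) by (simp add: cis_conv_exp)
    also have "cis \<alpha> = w / \<zeta> 0" using \<alpha>(3) by (simp add: complex_eq_iff)
    finally have "\<zeta> t = w" using zeta_nz[of 0] by simp
    then have "\<gamma> t = x"
      using gamma_eq_zeta[of t] pframe.expand[of x] x(2)
      by (simp add: w_def c cr mink_commute[of x p])
    then show ?thesis by blast
  qed
  moreover have "mink p (\<gamma> t) = - cosh r" for t by (simp add: p_gamma cr)
  ultimately have "range \<gamma> = {x \<in> hyp_plane. hyp_dist p x = r}"
    using hyp_dist_eq_iff[OF p_in _ cr(2)] gamma_in by auto
  then show ?thesis using p_in cr(2) unfolding geodesic_circle_def by blast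
qed

lemma isoperimetric_identity:
  "(curve_length \<gamma>)\<^sup>2 - hyp_area (enclosed_region \<gamma>) * (4 * pi + hyp_area (enclosed_region \<gamma>))
     = 4 * pi\<^sup>2 - (arc_integral \<gamma> (horo_curvature \<gamma>))\<^sup>2 - curvature_remainder \<gamma>"
  unfolding curvature_remainder_eq Gauss_Bonnet by (simp add: power2_eq_square algebra_simps)

end

theorem theorem33:
  fixes \<gamma> :: "real \<Rightarrow> real^3"
  assumes "smooth_simple_closed_curve_H2 \<gamma>"
    and "strictly_horoconvex \<gamma>"
  shows "strong_spacelike \<gamma> \<and> (\<forall>t. spacelike_curvature \<gamma> t = horo_curvature \<gamma> t)
    \<and> (curve_length \<gamma>)\<^sup>2
        - hyp_area (enclosed_region \<gamma>) * (4 * pi + hyp_area (enclosed_region \<gamma>))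
      \<le> 4 * pi\<^sup>2 - (arc_integral \<gamma> (horo_curvature \<gamma>))\<^sup>2
    \<and> (curve_length \<gamma>)\<^sup>2
        - hyp_area (enclosed_region \<gamma>) * (4 * pi + hyp_area (enclosed_region \<gamma>))
      = 4 * pi\<^sup>2 - (arc_integral \<gamma> (horo_curvature \<gamma>))\<^sup>2 - curvature_remainder \<gamma>
    \<and> curvature_remainder \<gamma> \<ge> 0
    \<and> ((curve_length \<gamma>)\<^sup>2
        - hyp_area (enclosed_region \<gamma>) * (4 * pi + hyp_area (enclosed_region \<gamma>))
      = 4 * pi\<^sup>2 - (arc_integral \<gamma> (horo_curvature \<gamma>))\<^sup>2
      \<longleftrightarrow> geodesic_circle (range \<gamma>))"
proof -
  interpret horoconvex_curve \<gamma> using assms by unfold_locales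
  have "curvature_remainder \<gamma> = 0 \<longleftrightarrow> geodesic_circle (range \<gamma>)"
    unfolding curvature_remainder_eq_0_iff
    using geodesic_circle_imp_constant constant_imp_geodesic_circle by blast
  then show ?thesis
    using strong_spacelike spacelike_curvature_eq isoperimetric_identity curvature_remainder_nonneg
    by auto
qed

end
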